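(* Let $(S,\mathfrak m_S,k)$ and $(T,\mathfrak m_T,k)$ be artinian local rings, and let $R=S\times_kT$ be their fiber product over $k$, with maximal ideal $\mathfrak m_R=\mathfrak m_S\oplus\mathfrak m_T$. If $S$ and $T$ are not Gorenstein, then $$E_R^*\cong\operatorname{Hom}_R(E_S\oplus E_T,\ \mathfrak m_S\oplus\mathfrak m_T)\cong\operatorname{Hom}_S(E_S,S)\oplus\operatorname{Hom}_T(E_T,T)\oplus k^{\oplus 2\operatorname{type}(S)\operatorname{type}(T)}$$ as $R$-modules. In particular, $E_S^*$ and $E_T^*$ are annihilated by $\mathfrak m_S$ and $\mathfrak m_T$, respectively, if and only if $E_R^*$ is annihilated by $\mathfrak m_R$.
   Context: Rings are commutative. With natural surjections $\pi_S:S\to k$ and $\pi_T:T\to k$, $S\times_kT=\{(s,t)\in S\times T:\pi_S(s)=\pi_T(t)\}$, which is an artinian local ring with maximal ideal $\mathfrak m_S\oplus\mathfrak m_T$; one has $S\cong R/\mathfrak m_T$ and $T\cong R/\mathfrak m_S$, and $S$-modules and $T$-modules are regarded as $R$-modules via the projections. $E_R,E_S,E_T$ denote the injective envelopes of $k$ over $R,S,T$. For an artinian local ring $A$ with residue field $k$, $E_A^*=\operatorname{Hom}_A(E_A,A)$ and $\operatorname{type}(A)=\dim_k\operatorname{Hom}_A(k,A)$. *)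

theory Defs
  imports
    "Jordan_Normal_Form.Missing_VectorSpace"
    "HOL-Algebra.Chinese_Remainder"
    "HOL-Algebra.QuotRing"
begin

section \<open>Artinian local rings and fiber products\<close>

definition artinian_ring :: "('a, 'b) ring_scheme \<Rightarrow> bool" where
  "artinian_ring A \<longleftrightarrow> cring A \<and>
     (\<forall>I :: nat \<Rightarrow> 'a set. (\<forall>n. ideal (I n) A \<and> I (Suc n) \<subseteq> I n) \<longrightarrow> (\<exists>n. \<forall>m\<ge>n. I m = I n))"

definition local_ring :: "('a, 'b) ring_scheme \<Rightarrow> 'a set \<Rightarrow> bool" where
  "local_ring A \<mm> \<longleftrightarrow> cring A \<and> maximalideal \<mm> A \<and> (\<forall>J. maximalideal J A \<longrightarrow> J = \<mm>)"

text \<open>The residue field is given as a field \<open>K\<close> together with the natural surjection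
  \<open>\<pi> : A \<rightarrow> K\<close> with kernel \<open>\<mm>\<close>, so that two local rings can share the same \<open>K\<close>.\<close>
definition artinian_local_ring ::
    "('a, 'b) ring_scheme \<Rightarrow> 'a set \<Rightarrow> ('k, 'c) ring_scheme \<Rightarrow> ('a \<Rightarrow> 'k) \<Rightarrow> bool" where
  "artinian_local_ring A \<mm> K \<pi> \<longleftrightarrow>
     artinian_ring A \<and> local_ring A \<mm> \<and>
     field K \<and> \<pi> \<in> ring_hom A K \<and> \<pi> ` carrier A = carrier K \<and> a_kernel A K \<pi> = \<mm>"

definition fiber_product ::
    "('s, 'b) ring_scheme \<Rightarrow> ('t, 'c) ring_scheme \<Rightarrow> ('s \<Rightarrow> 'k) \<Rightarrow> ('t \<Rightarrow> 'k) \<Rightarrow> ('s \<times> 't) ring" where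
  "fiber_product S T \<pi>\<^sub>S \<pi>\<^sub>T =
     (RDirProd S T)\<lparr>carrier := {(s, t). s \<in> carrier S \<and> t \<in> carrier T \<and> \<pi>\<^sub>S s = \<pi>\<^sub>T t}\<rparr>"

section \<open>Modules\<close>

text \<open>A record of type \<open>module\<close> also carries the fields \<open>mult\<close> and \<open>one\<close>, which play no
  role for modules.\<close>
definition self_module :: "('a, 'b) ring_scheme \<Rightarrow> ('a, 'a) module" where
  "self_module A = \<lparr>carrier = carrier A, mult = mult A, one = one A,
     zero = zero A, add = add A, smult = mult A\<rparr>"

definition ideal_module :: "('a, 'b) ring_scheme \<Rightarrow> 'a set \<Rightarrow> ('a, 'a) module" where
  "ideal_module A I = (self_module A)\<lparr>carrier := I\<rparr>"

definition restrict_scalars ::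
    "('r \<Rightarrow> 'a) \<Rightarrow> ('a, 'm, 'b) module_scheme \<Rightarrow> ('r, 'm) module" where
  "restrict_scalars \<phi> M = \<lparr>carrier = carrier M, mult = mult M, one = one M,
     zero = zero M, add = add M, smult = (\<lambda>r x. \<phi> r \<odot>\<^bsub>M\<^esub> x)\<rparr>"

text \<open>Homomorphisms are taken to be extensional, so that they are determined by their
  values on \<open>carrier M\<close>.\<close>
definition Hom_module ::
    "('a, 'b) ring_scheme \<Rightarrow> ('a, 'm, 'c) module_scheme \<Rightarrow> ('a, 'n, 'd) module_scheme
      \<Rightarrow> ('a, 'm \<Rightarrow> 'n) module" where
  "Hom_module A M N = \<lparr>carrier = module_hom A M N \<inter> extensional (carrier M),
     mult = (\<lambda>f g. \<lambda>x\<in>carrier M. \<zero>\<^bsub>N\<^esub>),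
     one = (\<lambda>x\<in>carrier M. \<zero>\<^bsub>N\<^esub>),
     zero = (\<lambda>x\<in>carrier M. \<zero>\<^bsub>N\<^esub>),
     add = (\<lambda>f g. \<lambda>x\<in>carrier M. f x \<oplus>\<^bsub>N\<^esub> g x),
     smult = (\<lambda>a f. \<lambda>x\<in>carrier M. a \<odot>\<^bsub>N\<^esub> f x)\<rparr>"

definition dual_module ::
    "('a, 'b) ring_scheme \<Rightarrow> ('a, 'm, 'c) module_scheme \<Rightarrow> ('a, 'm \<Rightarrow> 'a) module" where
  "dual_module A M = Hom_module A M (self_module A)"

definition module_isomorphic ::
    "('a, 'b) ring_scheme \<Rightarrow> ('a, 'm, 'c) module_scheme \<Rightarrow> ('a, 'n, 'd) module_scheme \<Rightarrow> bool" where
  "module_isomorphic A M N \<longleftrightarrow> (\<exists>f \<in> module_hom A M N. bij_betw f (carrier M) (carrier N))"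

definition annihilates :: "'a set \<Rightarrow> ('a, 'm, 'c) module_scheme \<Rightarrow> bool" where
  "annihilates I M \<longleftrightarrow> (\<forall>a\<in>I. \<forall>x\<in>carrier M. a \<odot>\<^bsub>M\<^esub> x = \<zero>\<^bsub>M\<^esub>)"

text \<open>\<open>k\<close> and \<open>k\<^sup>n\<close> as modules over a ring mapping to \<open>k\<close>.\<close>
definition residue_module :: "('k, 'c) ring_scheme \<Rightarrow> ('a \<Rightarrow> 'k) \<Rightarrow> ('a, 'k) module" where
  "residue_module K \<pi> = restrict_scalars \<pi> (self_module K)"

definition residue_power ::
    "('k, 'c) ring_scheme \<Rightarrow> ('a \<Rightarrow> 'k) \<Rightarrow> nat \<Rightarrow> ('a, nat \<Rightarrow> 'k) module" where
  "residue_power K \<pi> n = restrict_scalars \<pi> (ring.func_space K {..<n})"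

text \<open>\<open>Hom\<^sub>A(k, A)\<close> as a vector space over \<open>k\<close>: the scalar \<open>c\<close> sends \<open>f\<close> to
  \<open>x \<mapsto> f (c x)\<close>.\<close>
definition residue_Hom_space ::
    "('a, 'b) ring_scheme \<Rightarrow> ('k, 'c) ring_scheme \<Rightarrow> ('a \<Rightarrow> 'k) \<Rightarrow> ('k, 'k \<Rightarrow> 'a) module" where
  "residue_Hom_space A K \<pi> =
     (let H = Hom_module A (residue_module K \<pi>) (self_module A) in
      \<lparr>carrier = carrier H, mult = mult H, one = one H, zero = zero H, add = add H,
       smult = (\<lambda>c f. \<lambda>x\<in>carrier K. f (c \<otimes>\<^bsub>K\<^esub> x))\<rparr>)"

definition ring_type :: "('a, 'b) ring_scheme \<Rightarrow> ('k, 'c) ring_scheme \<Rightarrow> ('a \<Rightarrow> 'k) \<Rightarrow> nat" where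
  "ring_type A K \<pi> = vectorspace.dim K (residue_Hom_space A K \<pi>)"

section \<open>Injective modules, injective envelopes, Gorenstein rings\<close>

text \<open>HOL cannot quantify over types inside a definition, so the test modules \<open>M\<close>, \<open>N\<close> have
  their carriers in the element type of \<open>A\<close>.  This includes the inclusions of ideals into
  \<open>A\<close>, so by Baer's criterion nothing is lost: see \<open>injective_module_extend\<close> below, where
  \<open>M\<close> and \<open>N\<close> are arbitrary.\<close>
definition injective_module ::
    "('a, 'b) ring_scheme \<Rightarrow> ('a, 'e, 'c) module_scheme \<Rightarrow> bool" where
  "injective_module A E \<longleftrightarrow> module A E \<and>
     (\<forall>(M :: ('a, 'a) module) (N :: ('a, 'a) module) i g.
        module A M \<and> module A N \<and> i \<in> module_hom A M N \<and> inj_on i (carrier M) \<and>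
        g \<in> module_hom A M E \<longrightarrow>
        (\<exists>h \<in> module_hom A N E. \<forall>x\<in>carrier M. h (i x) = g x))"

lemma self_module_is_module: assumes "cring A" shows "module A (self_module A)"
proof -
  interpret cring A by fact
  have "abelian_group (self_module A)"
    by (rule abelian_groupI)
      (auto simp: self_module_def a_ac intro!: bexI[of _ "\<ominus>\<^bsub>A\<^esub> _"] l_neg)
  then show ?thesis
    by (intro moduleI) (auto simp: self_module_def l_distr r_distr m_assoc cring_axioms)
qed

lemma ideal_module_is_module: assumes "cring A" "ideal I A" shows "module A (ideal_module A I)"
proof -
  interpret M: module A "self_module A" by (rule self_module_is_module[OF assms(1)])
  interpret ideal I A by (rule assms(2))
  have "submodule A I (self_module A)"
    by (unfold_locales) (auto simp: self_module_def I_l_closed)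
  from M.submodule_is_module[OF this] show ?thesis unfolding ideal_module_def by simp
qed

text \<open>Baer's criterion, hence test modules with carriers in any types.\<close>
lemma injective_module_extend:
  assumes E: "injective_module A E" and M: "module A M" and N: "module A N"
    and i: "i \<in> module_hom A M N" and inj: "inj_on i (carrier M)" and g: "g \<in> module_hom A M E"
  shows "\<exists>h \<in> module_hom A N E. \<forall>x\<in>carrier M. h (i x) = g x"
proof -
  interpret M: module A M by fact
  interpret N: module A N by fact
  interpret E: module A E using E by (simp add: injective_module_def)
  interpret i: mod_hom A M N i using i by unfold_locales
  interpret g: mod_hom A M E g using g by unfold_locales
  define P where "P G \<longleftrightarrow> G \<subseteq> carrier N \<times> carrier E \<and> (\<zero>\<^bsub>N\<^esub>, \<zero>\<^bsub>E\<^esub>) \<in> G \<and>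
      (\<forall>n e n' e'. (n, e) \<in> G \<and> (n', e') \<in> G \<longrightarrow> (n \<oplus>\<^bsub>N\<^esub> n', e \<oplus>\<^bsub>E\<^esub> e') \<in> G) \<and>
      (\<forall>a n e. a \<in> carrier A \<and> (n, e) \<in> G \<longrightarrow> (a \<odot>\<^bsub>N\<^esub> n, a \<odot>\<^bsub>E\<^esub> e) \<in> G) \<and>
      (\<forall>e. (\<zero>\<^bsub>N\<^esub>, e) \<in> G \<longrightarrow> e = \<zero>\<^bsub>E\<^esub>) \<and> (\<lambda>x. (i x, g x)) ` carrier M \<subseteq> G" for G
  note Pc = P_def[THEN iffD1, THEN conjunct1]
    and Pzero = P_def[THEN iffD1, THEN conjunct2, THEN conjunct1]
    and Pa = P_def[THEN iffD1, THEN conjunct2, THEN conjunct2, THEN conjunct1, rule_format]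
    and Ps = P_def[THEN iffD1, THEN conjunct2, THEN conjunct2, THEN conjunct2, THEN conjunct1, rule_format]
    and Pz = P_def[THEN iffD1, THEN conjunct2, THEN conjunct2, THEN conjunct2, THEN conjunct2,
        THEN conjunct1, rule_format]
    and Pi = P_def[THEN iffD1, THEN conjunct2, THEN conjunct2, THEN conjunct2, THEN conjunct2, THEN conjunct2]
  have i0: "x = \<zero>\<^bsub>M\<^esub>" if "x \<in> carrier M" "i x = \<zero>\<^bsub>N\<^esub>" for x
    using that inj i.f0_is_0 by (metis M.M.zero_closed inj_on_def)
  have P0: "P ((\<lambda>x. (i x, g x)) ` carrier M)"
    unfolding P_def
  proof (intro conjI allI impI)
    show "(\<zero>\<^bsub>N\<^esub>, \<zero>\<^bsub>E\<^esub>) \<in> (\<lambda>x. (i x, g x)) ` carrier M"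
      by (rule image_eqI[of _ _ "\<zero>\<^bsub>M\<^esub>"]) auto
    show "(n \<oplus>\<^bsub>N\<^esub> n', e \<oplus>\<^bsub>E\<^esub> e') \<in> (\<lambda>x. (i x, g x)) ` carrier M"
      if "(n, e) \<in> (\<lambda>x. (i x, g x)) ` carrier M \<and> (n', e') \<in> (\<lambda>x. (i x, g x)) ` carrier M"
      for n e n' e'
    proof -
      from that obtain x y where "x \<in> carrier M" "y \<in> carrier M" "n = i x" "e = g x" "n' = i y" "e' = g y"
        by auto
      then show ?thesis by (intro image_eqI[of _ _ "x \<oplus>\<^bsub>M\<^esub> y"]) auto
    qed
    show "(a \<odot>\<^bsub>N\<^esub> n, a \<odot>\<^bsub>E\<^esub> e) \<in> (\<lambda>x. (i x, g x)) ` carrier M"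
      if "a \<in> carrier A \<and> (n, e) \<in> (\<lambda>x. (i x, g x)) ` carrier M" for a n e
    proof -
      from that obtain x where "a \<in> carrier A" "x \<in> carrier M" "n = i x" "e = g x" by auto
      then show ?thesis by (intro image_eqI[of _ _ "a \<odot>\<^bsub>M\<^esub> x"]) auto
    qed
    show "e = \<zero>\<^bsub>E\<^esub>" if "(\<zero>\<^bsub>N\<^esub>, e) \<in> (\<lambda>x. (i x, g x)) ` carrier M" for e
    proof -
      from that obtain x where x: "x \<in> carrier M" "\<zero>\<^bsub>N\<^esub> = i x" "e = g x" by blast
      from i0[OF x(1) x(2)[symmetric]] x(3) show ?thesis by simp
    qed
  qed auto
  have "\<exists>G\<in>Collect P. \<forall>X\<in>Collect P. G \<subseteq> X \<longrightarrow> X = G"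
  proof (rule subset_Zorn_nonempty)
    show "Collect P \<noteq> {}" using P0 by auto
    fix C assume ne: "C \<noteq> {}" and ch: "subset.chain (Collect P) C"
    have CP: "P G" if "G \<in> C" for G using ch that by (auto simp: subset.chain_def)
    have lin: "G \<subseteq> H \<or> H \<subseteq> G" if "G \<in> C" "H \<in> C" for G H
      using ch that by (auto simp: subset_chain_def)
    have "P (\<Union>C)" unfolding P_def
    proof (intro conjI allI impI)
      show "\<Union> C \<subseteq> carrier N \<times> carrier E" using Pc[OF CP] by (rule Union_least)
      show "(\<zero>\<^bsub>N\<^esub>, \<zero>\<^bsub>E\<^esub>) \<in> \<Union> C" using Pzero[OF CP] ne by auto
      show "(\<lambda>x. (i x, g x)) ` carrier M \<subseteq> \<Union> C" using Pi[OF CP] ne by blast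
      show "(n \<oplus>\<^bsub>N\<^esub> n', e \<oplus>\<^bsub>E\<^esub> e') \<in> \<Union> C" if "(n, e) \<in> \<Union> C \<and> (n', e') \<in> \<Union> C" for n e n' e'
      proof -
        from that obtain G H where GH: "G \<in> C" "H \<in> C" "(n, e) \<in> G" "(n', e') \<in> H" by auto
        then obtain L where "L \<in> C" "(n, e) \<in> L" "(n', e') \<in> L" using lin[OF GH(1,2)] by blast
        then show ?thesis using Pa[OF CP] by blast
      qed
      show "(a \<odot>\<^bsub>N\<^esub> n, a \<odot>\<^bsub>E\<^esub> e) \<in> \<Union> C" if "a \<in> carrier A \<and> (n, e) \<in> \<Union> C" for a n e
        using that Ps[OF CP] by blast
      show "e = \<zero>\<^bsub>E\<^esub>" if "(\<zero>\<^bsub>N\<^esub>, e) \<in> \<Union> C" for e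
        using that Pz[OF CP] by blast
    qed
    then show "\<Union> C \<in> Collect P" by simp
  qed
  then obtain G where G: "P G" and mx: "\<And>X. P X \<Longrightarrow> G \<subseteq> X \<Longrightarrow> X = G" by auto
  have Gc: "n \<in> carrier N" "e \<in> carrier E" if "(n, e) \<in> G" for n e
    using Pc[OF G] that by auto
  have G0: "(\<zero>\<^bsub>N\<^esub>, \<zero>\<^bsub>E\<^esub>) \<in> G" by (rule Pzero[OF G])
  have Ga: "(n \<oplus>\<^bsub>N\<^esub> n', e \<oplus>\<^bsub>E\<^esub> e') \<in> G" if "(n, e) \<in> G" "(n', e') \<in> G" for n e n' e'
    using Pa[OF G] that by blast
  have Gs: "(a \<odot>\<^bsub>N\<^esub> n, a \<odot>\<^bsub>E\<^esub> e) \<in> G" if "a \<in> carrier A" "(n, e) \<in> G" for a n e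
    using Ps[OF G] that by blast
  have Gz: "e = \<zero>\<^bsub>E\<^esub>" if "(\<zero>\<^bsub>N\<^esub>, e) \<in> G" for e
    by (rule Pz[OF G that])
  have Gi: "(i x, g x) \<in> G" if "x \<in> carrier M" for x
    using Pi[OF G] that by blast
  have Gn: "(\<ominus>\<^bsub>N\<^esub> n, \<ominus>\<^bsub>E\<^esub> e) \<in> G" if "(n, e) \<in> G" for n e
    using Gs[OF _ that, of "\<ominus>\<^bsub>A\<^esub> \<one>\<^bsub>A\<^esub>"] Gc[OF that] by (simp add: N.smult_l_minus E.smult_l_minus)
  have uniq: "e = e'" if "(n, e) \<in> G" "(n, e') \<in> G" for n e e'
  proof -
    have "(\<zero>\<^bsub>N\<^esub>, e \<oplus>\<^bsub>E\<^esub> \<ominus>\<^bsub>E\<^esub> e') \<in> G"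
      using Ga[OF that(1) Gn[OF that(2)]] Gc[OF that(1)] by (simp add: N.M.r_neg)
    from Gz[OF this] have "e \<oplus>\<^bsub>E\<^esub> \<ominus>\<^bsub>E\<^esub> e' = \<zero>\<^bsub>E\<^esub>" .
    then have "e = \<ominus>\<^bsub>E\<^esub> (\<ominus>\<^bsub>E\<^esub> e')"
      using Gc that by (metis E.M.a_inv_closed E.M.minus_equality E.M.minus_minus)
    then show ?thesis using Gc that by auto
  qed
  have total: "\<exists>e. (n, e) \<in> G" if n: "n \<in> carrier N" for n
  proof (rule ccontr)
    assume no: "\<nexists>e. (n, e) \<in> G"
    define I where "I = {a \<in> carrier A. \<exists>e. (a \<odot>\<^bsub>N\<^esub> n, e) \<in> G}"
    define f where "f a = (THE e. (a \<odot>\<^bsub>N\<^esub> n, e) \<in> G)" for a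
    have f: "f a = e" if "(a \<odot>\<^bsub>N\<^esub> n, e) \<in> G" for a e
      unfolding f_def using that uniq by blast
    have fI: "(a \<odot>\<^bsub>N\<^esub> n, f a) \<in> G" if "a \<in> I" for a
      using that f unfolding I_def by auto
    have IA: "I \<subseteq> carrier A" unfolding I_def by auto
    have add: "(( a \<oplus>\<^bsub>A\<^esub> b) \<odot>\<^bsub>N\<^esub> n, f a \<oplus>\<^bsub>E\<^esub> f b) \<in> G" if "a \<in> I" "b \<in> I" for a b
      using Ga[OF fI[OF that(1)] fI[OF that(2)]] that IA n N.smult_l_distr by (metis subsetD)
    have mul: "((b \<otimes>\<^bsub>A\<^esub> a) \<odot>\<^bsub>N\<^esub> n, b \<odot>\<^bsub>E\<^esub> f a) \<in> G" if "a \<in> I" "b \<in> carrier A" for a b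
      using Gs[OF that(2) fI[OF that(1)]] that IA n N.smult_assoc1 by (metis subsetD)
    have ideal: "ideal I A"
    proof (rule idealI)
      show "ring A" by (rule M.R.ring_axioms)
      show "subgroup I (add_monoid A)"
      proof (rule M.R.add.subgroupI)
        show "I \<noteq> {}" using G0 n by (auto simp: I_def intro!: exI[of _ "\<zero>\<^bsub>A\<^esub>"])
        show "\<ominus>\<^bsub>A\<^esub> a \<in> I" if "a \<in> I" for a
          using Gn[OF fI[OF that]] that n unfolding I_def by (auto simp: N.smult_l_minus)
        show "a \<oplus>\<^bsub>A\<^esub> b \<in> I" if "a \<in> I" "b \<in> I" for a b
          using add[OF that] that IA unfolding I_def by auto
      qed (use IA in auto)
      show "x \<otimes>\<^bsub>A\<^esub> a \<in> I" if "a \<in> I" "x \<in> carrier A" for a x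
        using mul[OF that] that IA unfolding I_def by auto
      then show "a \<otimes>\<^bsub>A\<^esub> x \<in> I" if "a \<in> I" "x \<in> carrier A" for a x
        using that IA M.R.m_comm by (metis subsetD)
    qed
    have fhom: "f \<in> module_hom A (ideal_module A I) E"
      unfolding module_hom_def
      using f[OF add] f[OF mul] Gc(2)[OF fI] by (auto simp: ideal_module_def self_module_def)
    have inc: "id \<in> module_hom A (ideal_module A I) (self_module A)"
      using IA by (auto simp: module_hom_def ideal_module_def self_module_def)
    have "inj_on id (carrier (ideal_module A I))" by simp
    then have "\<exists>h\<in>module_hom A (self_module A) E. \<forall>x\<in>carrier (ideal_module A I). h (id x) = f x"
      using E[unfolded injective_module_def, THEN conjunct2, rule_format,
          of "ideal_module A I" "self_module A" id f]
        ideal_module_is_module[OF M.R.cring_axioms ideal] self_module_is_module[OF M.R.cring_axioms]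
        inc fhom by blast
    then obtain h where h: "h \<in> module_hom A (self_module A) E" and hf: "\<And>a. a \<in> I \<Longrightarrow> h a = f a"
      unfolding ideal_module_def by auto
    define e0 where "e0 = h \<one>\<^bsub>A\<^esub>"
    have e0: "e0 \<in> carrier E" using h by (auto simp: module_hom_def self_module_def e0_def)
    have he: "h a = a \<odot>\<^bsub>E\<^esub> e0" if "a \<in> carrier A" for a
      using module_hom_smult[OF h that, of "\<one>\<^bsub>A\<^esub>"] that by (simp add: self_module_def e0_def)
    define G' where "G' = {(d \<oplus>\<^bsub>N\<^esub> a \<odot>\<^bsub>N\<^esub> n, e \<oplus>\<^bsub>E\<^esub> a \<odot>\<^bsub>E\<^esub> e0) | d e a. (d, e) \<in> G \<and> a \<in> carrier A}"
    have G'I: "(d \<oplus>\<^bsub>N\<^esub> a \<odot>\<^bsub>N\<^esub> n, e \<oplus>\<^bsub>E\<^esub> a \<odot>\<^bsub>E\<^esub> e0) \<in> G'" if "(d, e) \<in> G" "a \<in> carrier A" for d e a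
      using that unfolding G'_def by blast
    have sub: "G \<subseteq> G'"
    proof
      fix p assume p: "p \<in> G"
      obtain d e where pe: "p = (d, e)" by (cases p)
      show "p \<in> G'" using G'I[of d e "\<zero>\<^bsub>A\<^esub>"] p Gc[of d e] n e0 pe by simp
    qed
    have "P G'" unfolding P_def
    proof (intro conjI allI impI)
      show "G' \<subseteq> carrier N \<times> carrier E" unfolding G'_def using Gc n e0 by auto
      show "(\<zero>\<^bsub>N\<^esub>, \<zero>\<^bsub>E\<^esub>) \<in> G'" using sub G0 by auto
      show "(\<lambda>x. (i x, g x)) ` carrier M \<subseteq> G'" using Gi sub by auto
      show "(x \<oplus>\<^bsub>N\<^esub> x', y \<oplus>\<^bsub>E\<^esub> y') \<in> G'" if "(x, y) \<in> G' \<and> (x', y') \<in> G'" for x y x' y'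
      proof -
        from that obtain d e a d' e' a' where
          1: "(d, e) \<in> G" "a \<in> carrier A" "x = d \<oplus>\<^bsub>N\<^esub> a \<odot>\<^bsub>N\<^esub> n" "y = e \<oplus>\<^bsub>E\<^esub> a \<odot>\<^bsub>E\<^esub> e0"
            "(d', e') \<in> G" "a' \<in> carrier A" "x' = d' \<oplus>\<^bsub>N\<^esub> a' \<odot>\<^bsub>N\<^esub> n" "y' = e' \<oplus>\<^bsub>E\<^esub> a' \<odot>\<^bsub>E\<^esub> e0"
          unfolding G'_def by blast
        show ?thesis
          using G'I[OF Ga[OF 1(1,5)], of "a \<oplus>\<^bsub>A\<^esub> a'"] 1 Gc[OF 1(1)] Gc[OF 1(5)] n e0
          by (simp add: N.smult_l_distr E.smult_l_distr N.M.a_ac E.M.a_ac)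
      qed
      show "(b \<odot>\<^bsub>N\<^esub> x, b \<odot>\<^bsub>E\<^esub> y) \<in> G'" if "b \<in> carrier A \<and> (x, y) \<in> G'" for b x y
      proof -
        from that obtain d e a where
          1: "(d, e) \<in> G" "a \<in> carrier A" "x = d \<oplus>\<^bsub>N\<^esub> a \<odot>\<^bsub>N\<^esub> n" "y = e \<oplus>\<^bsub>E\<^esub> a \<odot>\<^bsub>E\<^esub> e0"
          unfolding G'_def by blast
        show ?thesis
          using G'I[OF Gs[OF _ 1(1), of b], of "b \<otimes>\<^bsub>A\<^esub> a"] 1 that Gc[OF 1(1)] n e0
          by (simp add: N.smult_r_distr E.smult_r_distr N.smult_assoc1 E.smult_assoc1)
      qed
      show "y = \<zero>\<^bsub>E\<^esub>" if "(\<zero>\<^bsub>N\<^esub>, y) \<in> G'" for y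
      proof -
        from that obtain d e a where
          1: "(d, e) \<in> G" "a \<in> carrier A" "\<zero>\<^bsub>N\<^esub> = d \<oplus>\<^bsub>N\<^esub> a \<odot>\<^bsub>N\<^esub> n" "y = e \<oplus>\<^bsub>E\<^esub> a \<odot>\<^bsub>E\<^esub> e0"
          unfolding G'_def by blast
        have "a \<odot>\<^bsub>N\<^esub> n = \<ominus>\<^bsub>N\<^esub> d"
          using 1 Gc[OF 1(1)] n by (metis N.M.a_comm N.M.minus_equality N.smult_closed)
        then have ag: "(a \<odot>\<^bsub>N\<^esub> n, \<ominus>\<^bsub>E\<^esub> e) \<in> G" using Gn[OF 1(1)] by simp
        then have "a \<in> I" using 1(2) unfolding I_def by auto
        then have "a \<odot>\<^bsub>E\<^esub> e0 = \<ominus>\<^bsub>E\<^esub> e" using hf he[OF 1(2)] f[OF ag] by metis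
        then show ?thesis using 1(4) Gc[OF 1(1)] by (simp add: E.M.r_neg)
      qed
    qed
    then have "G' = G" using mx sub by blast
    moreover have "(n, e0) \<in> G'" using G'I[OF G0, of "\<one>\<^bsub>A\<^esub>"] n e0 by simp
    ultimately show False using no by auto
  qed
  define h where "h n = (THE e. (n, e) \<in> G)" for n
  have h: "h n = e" if "(n, e) \<in> G" for n e
    unfolding h_def using that uniq by blast
  have hG: "(n, h n) \<in> G" if "n \<in> carrier N" for n using total[OF that] h by auto
  have "h \<in> module_hom A N E"
    unfolding module_hom_def using Gc(2)[OF hG] h[OF Ga[OF hG hG]] h[OF Gs[OF _ hG]] by auto
  moreover have "h (i x) = g x" if "x \<in> carrier M" for x using h[OF Gi[OF that]] .
  ultimately show ?thesis by blast
qed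

definition injective_envelope ::
    "('a, 'b) ring_scheme \<Rightarrow> ('a, 'm, 'c) module_scheme \<Rightarrow> ('a, 'e, 'd) module_scheme \<Rightarrow> bool" where
  "injective_envelope A M E \<longleftrightarrow> injective_module A E \<and>
     (\<exists>\<iota> \<in> module_hom A M E. inj_on \<iota> (carrier M) \<and>
        (\<forall>H. submodule A H E \<and> H \<inter> \<iota> ` carrier M = {\<zero>\<^bsub>E\<^esub>} \<longrightarrow> H = {\<zero>\<^bsub>E\<^esub>}))"

text \<open>A finite injective resolution \<open>0 \<rightarrow> M \<rightarrow> I\<^sub>0 \<rightarrow> I\<^sub>1 \<rightarrow> \<dots> \<rightarrow> I\<^sub>n \<rightarrow> 0\<close>.  The terms
  have their carriers in \<open>nat \<Rightarrow> 'a\<close>, into which the carrier of every finitely generated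
  module over \<open>A\<close> embeds; over an artinian ring the minimal injective
  resolution of a finitely generated module has finitely generated terms.\<close>
definition finite_injective_dimension ::
    "('a, 'b) ring_scheme \<Rightarrow> ('a, 'm, 'c) module_scheme \<Rightarrow> bool" where
  "finite_injective_dimension A M \<longleftrightarrow>
     (\<exists>(I :: nat \<Rightarrow> ('a, nat \<Rightarrow> 'a) module) \<epsilon> d n.
        (\<forall>i. injective_module A (I i)) \<and>
        \<epsilon> \<in> module_hom A M (I 0) \<and> inj_on \<epsilon> (carrier M) \<and>
        (\<forall>i. d i \<in> module_hom A (I i) (I (Suc i))) \<and>
        \<epsilon> ` carrier M = {x \<in> carrier (I 0). d 0 x = \<zero>\<^bsub>I 1\<^esub>} \<and>
        (\<forall>i. d i ` carrier (I i) = {x \<in> carrier (I (Suc i)). d (Suc i) x = \<zero>\<^bsub>I (Suc (Suc i))\<^esub>}) \<and>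
        (\<forall>i>n. carrier (I i) = {\<zero>\<^bsub>I i\<^esub>}))"

text \<open>For noetherian (in particular artinian) local rings \<open>A\<close>.\<close>
definition gorenstein :: "('a, 'b) ring_scheme \<Rightarrow> bool" where
  "gorenstein A \<longleftrightarrow> finite_injective_dimension A (self_module A)"

end

theory Submission
  imports Defs
begin

text \<open>Since \<open>S\<close> is not Gorenstein, no homomorphism \<open>E\<^sub>S \<rightarrow> S\<close> is surjective or injective: either one would
  make \<open>S\<close> a retract of \<open>E\<^sub>S\<close>. So they all map into \<open>\<mm>\<^sub>S\<close> and kill \<open>soc E\<^sub>S\<close>. Injectivity of \<open>E\<^sub>R\<close> gives
  \<open>E\<^sub>R = (0 : \<mm>\<^sub>T) + (0 : \<mm>\<^sub>S)\<close>, and the summands are \<open>E\<^sub>S\<close> and \<open>E\<^sub>T\<close>, glued along the socle. As every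
  homomorphism \<open>E\<^sub>S \<oplus> E\<^sub>T \<rightarrow> R\<close> maps into \<open>\<mm>\<^sub>S \<oplus> \<mm>\<^sub>T\<close> and kills both socles, this yields the first isomorphism.
  In the second one, the mixed homomorphisms \<open>E\<^sub>S \<rightarrow> \<mm>\<^sub>T\<close> are the \<open>k\<close>-linear maps \<open>E\<^sub>S / \<mm>\<^sub>S E\<^sub>S \<rightarrow> soc T\<close>, and
  \<open>E\<^sub>S / \<mm>\<^sub>S E\<^sub>S\<close> is dual to \<open>soc S\<close>, hence of dimension \<open>type S\<close>.\<close>

section \<open>Modules\<close>

text \<open>Matlis duality enters only through the pairing of \<open>soc A\<close> with
  \<open>E / \<mm> E\<close> into \<open>soc E = k\<close>. Its finiteness comes from the descending
  chain condition: inside a given ideal, the annihilator of a set of ring or module elements is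
  already that of a finite subset. Injectivity of \<open>E\<close> then produces the elements of
  \<open>E\<close> that are required. The two kinds of maps on \<open>E\<^sub>S\<close> kill the
  socle for different reasons: those into \<open>\<mm>\<^sub>S\<close> by essentiality, the mixed
  ones because they kill \<open>\<mm>\<^sub>S E\<^sub>S\<close>, and \<open>soc E\<close> lies in
  \<open>\<mm> E\<close> as soon as \<open>soc A\<close> lies in \<open>\<mm>\<close>. That
  inclusion fails only for fields, which are Gorenstein. The factor 2 counts the two mixed blocks,
  \<open>E\<^sub>S\<close> to \<open>\<mm>\<^sub>T\<close> and \<open>E\<^sub>T\<close> to
  \<open>\<mm>\<^sub>S\<close>. For the statement on annihilators only the diagonal summands matter,
  since \<open>\<mm>\<^sub>R\<close> kills \<open>k\<close>.\<close>

lemmas module_constr_simps =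
  restrict_scalars_def self_module_def ideal_module_def residue_module_def direct_sum_def

lemma (in abelian_group) minus_eq_zero_iff:
  assumes "x \<in> carrier G" "y \<in> carrier G"
  shows "x \<ominus> y = \<zero> \<longleftrightarrow> x = y"
proof
  assume "x \<ominus> y = \<zero>"
  then have "\<ominus> (\<ominus> y) = x" using assms by (intro minus_equality) (simp_all add: a_minus_def)
  then show "x = y" using assms by simp
qed (use assms in \<open>simp add: a_minus_def r_neg\<close>)

lemma module_homI:
  assumes "\<And>x. x \<in> carrier M \<Longrightarrow> f x \<in> carrier N"
    and "\<And>x y. x \<in> carrier M \<Longrightarrow> y \<in> carrier M \<Longrightarrow> f (x \<oplus>\<^bsub>M\<^esub> y) = f x \<oplus>\<^bsub>N\<^esub> f y"
    and "\<And>a x. a \<in> carrier A \<Longrightarrow> x \<in> carrier M \<Longrightarrow> f (a \<odot>\<^bsub>M\<^esub> x) = a \<odot>\<^bsub>N\<^esub> f x"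
  shows "f \<in> module_hom A M N"
  using assms by (auto simp: module_hom_def)

lemma module_hom_mem: "f \<in> module_hom A M N \<Longrightarrow> x \<in> carrier M \<Longrightarrow> f x \<in> carrier N"
  by (auto simp: module_hom_def)

lemma module_hom_zero:
  assumes "module A M" "module A N" "f \<in> module_hom A M N"
  shows "f \<zero>\<^bsub>M\<^esub> = \<zero>\<^bsub>N\<^esub>"
proof -
  interpret mod_hom A M N f using assms by (simp add: mod_hom_def mod_hom_axioms_def)
  show ?thesis by simp
qed

lemma module_hom_minus:
  assumes "module A M" "module A N" "f \<in> module_hom A M N" "x \<in> carrier M" "y \<in> carrier M"
  shows "f (x \<ominus>\<^bsub>M\<^esub> y) = f x \<ominus>\<^bsub>N\<^esub> f y"
proof -
  interpret mod_hom A M N f using assms by (simp add: mod_hom_def mod_hom_axioms_def)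
  show ?thesis using assms by simp
qed

lemma module_hom_restrict:
  assumes "module A M" "f \<in> module_hom A M N"
  shows "(\<lambda>x\<in>carrier M. f x) \<in> module_hom A M N"
proof -
  interpret module A M by fact
  show ?thesis using assms(2) by (auto simp: module_hom_def)
qed

lemma module_hom_compose:
  "f \<in> module_hom A M N \<Longrightarrow> g \<in> module_hom A N P \<Longrightarrow> (\<lambda>x. g (f x)) \<in> module_hom A M P"
  by (auto simp: module_hom_def Pi_iff)

lemma submodule_criterion:
  assumes "module A M" "N \<subseteq> carrier M" "\<zero>\<^bsub>M\<^esub> \<in> N"
    and "\<And>x y. x \<in> N \<Longrightarrow> y \<in> N \<Longrightarrow> x \<oplus>\<^bsub>M\<^esub> y \<in> N"
    and "\<And>a x. a \<in> carrier A \<Longrightarrow> x \<in> N \<Longrightarrow> a \<odot>\<^bsub>M\<^esub> x \<in> N"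
  shows "submodule A N M"
  using assms by (simp add: submodule_def)

lemma module_hom_kernel:
  assumes "module A M" "module A N" "f \<in> module_hom A M N"
  shows "submodule A {x \<in> carrier M. f x = \<zero>\<^bsub>N\<^esub>} M"
proof -
  interpret mod_hom A M N f using assms by (simp add: mod_hom_def mod_hom_axioms_def)
  show ?thesis by (rule submodule_criterion) (auto simp: assms(1))
qed

lemma module_hom_inj_onI:
  assumes "module A M" "module A N" "f \<in> module_hom A M N"
    and "\<And>x. x \<in> carrier M \<Longrightarrow> f x = \<zero>\<^bsub>N\<^esub> \<Longrightarrow> x = \<zero>\<^bsub>M\<^esub>"
  shows "inj_on f (carrier M)"
proof (rule inj_onI)
  interpret mod_hom A M N f using assms by (simp add: mod_hom_def mod_hom_axioms_def)
  fix x y assume x: "x \<in> carrier M" and y: "y \<in> carrier M" and eq: "f x = f y"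
  have "f (x \<ominus>\<^bsub>M\<^esub> y) = \<zero>\<^bsub>N\<^esub>" using x y eq by (simp add: N.M.minus_eq_zero_iff)
  then have "x \<ominus>\<^bsub>M\<^esub> y = \<zero>\<^bsub>M\<^esub>" using assms(4) x y by simp
  then show "x = y" using x y by (simp add: M.M.minus_eq_zero_iff)
qed

lemma restrict_scalars_is_module:
  assumes "cring R" "\<phi> \<in> ring_hom R A" "module A M"
  shows "module R (restrict_scalars \<phi> M)"
proof -
  interpret B: cring R by fact
  interpret module A M by fact
  interpret h: ring_hom_cring R A \<phi>
    using assms by (simp add: ring_hom_cring_def ring_hom_cring_axioms_def B.cring_axioms R.cring_axioms)
  show ?thesis
  proof (rule moduleI)
    show "abelian_group (restrict_scalars \<phi> M)"
      by (rule abelian_groupI)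
        (auto simp: restrict_scalars_def M.a_ac intro!: bexI[of _ "\<ominus>\<^bsub>M\<^esub> _"] M.l_neg)
  qed (auto simp: restrict_scalars_def smult_l_distr smult_r_distr smult_assoc1 assms(1))
qed

lemma Hom_module_is_module:
  assumes "module A M" "module A N"
  shows "module A (Hom_module A M N)"
proof -
  interpret M: module A M by fact
  interpret N: module A N by fact
  note hom = module_hom_mem module_hom_add module_hom_smult
  show ?thesis
  proof (rule moduleI)
    show "abelian_group (Hom_module A M N)"
    proof (rule abelian_groupI)
      fix f assume "f \<in> carrier (Hom_module A M N)"
      then have f: "f \<in> module_hom A M N" by (simp add: Hom_module_def)
      have "(\<lambda>x\<in>carrier M. \<ominus>\<^bsub>N\<^esub> f x) \<in> module_hom A M N"
        using f by (intro module_hom_restrict[OF assms(1)] module_homI)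
          (auto simp: hom N.M.minus_add N.smult_r_minus)
      moreover have "(\<lambda>x\<in>carrier M. \<ominus>\<^bsub>N\<^esub> f x) \<oplus>\<^bsub>Hom_module A M N\<^esub> f = \<zero>\<^bsub>Hom_module A M N\<^esub>"
        using f by (auto simp: Hom_module_def fun_eq_iff hom N.M.l_neg)
      ultimately show "\<exists>g\<in>carrier (Hom_module A M N). g \<oplus>\<^bsub>Hom_module A M N\<^esub> f = \<zero>\<^bsub>Hom_module A M N\<^esub>"
        by (intro bexI[of _ "\<lambda>x\<in>carrier M. \<ominus>\<^bsub>N\<^esub> f x"]) (simp_all add: Hom_module_def)
    next
      fix f g assume "f \<in> carrier (Hom_module A M N)" "g \<in> carrier (Hom_module A M N)"
      then show "f \<oplus>\<^bsub>Hom_module A M N\<^esub> g \<in> carrier (Hom_module A M N)"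
        by (auto simp: Hom_module_def hom N.smult_r_distr N.M.a_ac
            intro!: module_homI module_hom_restrict[OF assms(1)])
    next
      show "\<zero>\<^bsub>Hom_module A M N\<^esub> \<in> carrier (Hom_module A M N)"
        by (auto simp: Hom_module_def intro!: module_homI)
    qed (auto simp: Hom_module_def fun_eq_iff hom N.M.a_ac extensional_def)
  next
    fix a f assume "a \<in> carrier A" "f \<in> carrier (Hom_module A M N)"
    then show "a \<odot>\<^bsub>Hom_module A M N\<^esub> f \<in> carrier (Hom_module A M N)"
      by (auto simp: Hom_module_def hom N.smult_r_distr N.smult_assoc1[symmetric] M.R.m_comm
          intro!: module_homI module_hom_restrict[OF assms(1)])
  qed (auto simp: Hom_module_def fun_eq_iff hom N.smult_l_distr N.smult_r_distr N.smult_assoc1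
      extensional_def M.R.cring_axioms)
qed

lemma module_isomorphicI:
  assumes "\<And>x. x \<in> carrier M \<Longrightarrow> f x \<in> carrier N"
    and "\<And>x y. x \<in> carrier M \<Longrightarrow> y \<in> carrier M \<Longrightarrow> f (x \<oplus>\<^bsub>M\<^esub> y) = f x \<oplus>\<^bsub>N\<^esub> f y"
    and "\<And>a x. a \<in> carrier A \<Longrightarrow> x \<in> carrier M \<Longrightarrow> f (a \<odot>\<^bsub>M\<^esub> x) = a \<odot>\<^bsub>N\<^esub> f x"
    and "inj_on f (carrier M)" and "\<And>y. y \<in> carrier N \<Longrightarrow> \<exists>x\<in>carrier M. f x = y"
  shows "module_isomorphic A M N"
proof -
  have "f ` carrier M = carrier N" using assms(1,5) by force
  then show ?thesis unfolding module_isomorphic_def bij_betw_def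
    using assms(1-4) by (intro bexI[of _ f] module_homI) auto
qed

lemma module_isomorphic_trans:
  assumes "module_isomorphic A M N" "module_isomorphic A N P"
  shows "module_isomorphic A M P"
proof -
  from assms obtain f g where fg: "f \<in> module_hom A M N" "bij_betw f (carrier M) (carrier N)"
      "g \<in> module_hom A N P" "bij_betw g (carrier N) (carrier P)"
    unfolding module_isomorphic_def by blast
  show ?thesis unfolding module_isomorphic_def
    using module_hom_compose[OF fg(1,3)] bij_betw_trans[OF fg(2,4)]
    by (intro bexI[of _ "\<lambda>x. g (f x)"]) (auto simp: comp_def)
qed

lemma module_isomorphic_direct_sum:
  assumes "module_isomorphic A M M'" "module_isomorphic A N N'"
  shows "module_isomorphic A (direct_sum M N) (direct_sum M' N')"
proof -
  from assms obtain f g where f: "f \<in> module_hom A M M'" "bij_betw f (carrier M) (carrier M')"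
      and g: "g \<in> module_hom A N N'" "bij_betw g (carrier N) (carrier N')"
    unfolding module_isomorphic_def by blast
  have "bij_betw (map_prod f g) (carrier M \<times> carrier N) (carrier M' \<times> carrier N')"
    using f(2) g(2) by (rule bij_betw_map_prod)
  moreover have "map_prod f g \<in> module_hom A (direct_sum M N) (direct_sum M' N')"
    using f(1) g(1) by (auto simp: module_hom_def direct_sum_def Pi_iff)
  ultimately show ?thesis by (auto simp: module_isomorphic_def direct_sum_def)
qed

lemma annihilates_isomorphic:
  assumes M: "module A M" and N: "module A N" and iso: "module_isomorphic A M N" and I: "I \<subseteq> carrier A"
  shows "annihilates I M \<longleftrightarrow> annihilates I N"
proof -
  interpret M: module A M by fact
  from iso obtain f where f: "f \<in> module_hom A M N" and bij: "bij_betw f (carrier M) (carrier N)"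
    unfolding module_isomorphic_def by blast
  note f0 = module_hom_zero[OF M N f]
  have "a \<odot>\<^bsub>N\<^esub> f x = \<zero>\<^bsub>N\<^esub> \<longleftrightarrow> a \<odot>\<^bsub>M\<^esub> x = \<zero>\<^bsub>M\<^esub>" if "a \<in> I" "x \<in> carrier M" for a x
  proof -
    have a: "a \<in> carrier A" using that I by auto
    have "a \<odot>\<^bsub>N\<^esub> f x = f (a \<odot>\<^bsub>M\<^esub> x)" using module_hom_smult[OF f a that(2)] by simp
    then show ?thesis using f0 bij a that(2) unfolding bij_betw_def
      by (metis M.smult_closed M.M.zero_closed inj_onD)
  qed
  then show ?thesis unfolding annihilates_def bij_betw_imp_surj_on[OF bij, symmetric] by simp
qed

text \<open>A homomorphism between two-term sums is a 2 by 2 matrix. The diagonal blocks are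
  bracketed together, apart from the mixed ones, because in the end the mixed pair becomes a single
  power of \<open>k\<close>.\<close>

lemma Hom_module_direct_sum:
  assumes M: "module A M" "module A M'" and N: "module A N" "module A N'"
  shows "module_isomorphic A (Hom_module A (direct_sum M M') (direct_sum N N'))
    (direct_sum (direct_sum (Hom_module A M N) (Hom_module A M' N'))
                (direct_sum (Hom_module A M N') (Hom_module A M' N)))"
proof -
  interpret M: module A M by fact
  interpret M': module A M' by fact
  interpret N: module A N by fact
  interpret N': module A N' by fact
  note hom = module_hom_mem module_hom_add module_hom_smult
  let ?H = "Hom_module A (direct_sum M M') (direct_sum N N')"
  let ?i = "\<lambda>x. (x, \<zero>\<^bsub>M'\<^esub>)" and ?j = "\<lambda>y. (\<zero>\<^bsub>M\<^esub>, y)"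
  have i: "?i \<in> module_hom A M (direct_sum M M')" and j: "?j \<in> module_hom A M' (direct_sum M M')"
    by (auto simp: module_hom_def direct_sum_def)
  have p: "fst \<in> module_hom A (direct_sum N N') N" and q: "snd \<in> module_hom A (direct_sum N N') N'"
    by (auto simp: module_hom_def direct_sum_def)
  let ?f = "\<lambda>h. ((\<lambda>x\<in>carrier M. fst (h (?i x)), \<lambda>y\<in>carrier M'. snd (h (?j y))),
                 (\<lambda>x\<in>carrier M. snd (h (?i x)), \<lambda>y\<in>carrier M'. fst (h (?j y))))"
  show ?thesis
  proof (rule module_isomorphicI[where f = ?f])
    fix h assume h: "h \<in> carrier ?H"
    then have "h \<in> module_hom A (direct_sum M M') (direct_sum N N')" by (simp add: Hom_module_def)
    then show "?f h \<in> carrier (direct_sum (direct_sum (Hom_module A M N) (Hom_module A M' N'))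
                (direct_sum (Hom_module A M N') (Hom_module A M' N)))"
      using module_hom_compose[OF module_hom_compose[OF i] p]
        module_hom_compose[OF module_hom_compose[OF i] q]
        module_hom_compose[OF module_hom_compose[OF j] p]
        module_hom_compose[OF module_hom_compose[OF j] q]
      by (auto simp: direct_sum_def Hom_module_def intro!: module_hom_restrict M)
  next
    show "inj_on ?f (carrier ?H)"
    proof (rule inj_onI)
      fix h h' assume h: "h \<in> carrier ?H" "h' \<in> carrier ?H" and eq: "?f h = ?f h'"
      have D: "h \<in> module_hom A (direct_sum M M') (direct_sum N N')"
        "h' \<in> module_hom A (direct_sum M M') (direct_sum N N')"
        "h \<in> extensional (carrier M \<times> carrier M')" "h' \<in> extensional (carrier M \<times> carrier M')"
        using h by (auto simp: Hom_module_def direct_sum_def)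
      have "h (x, y) = h' (x, y)" if "x \<in> carrier M" "y \<in> carrier M'" for x y
      proof -
        have xy: "(x, y) = ?i x \<oplus>\<^bsub>direct_sum M M'\<^esub> ?j y" using that by (simp add: direct_sum_def)
        have c: "?i x \<in> carrier (direct_sum M M')" "?j y \<in> carrier (direct_sum M M')"
          using that by (auto simp: direct_sum_def)
        have "h (?i x) = h' (?i x)"
          using arg_cong[OF eq, of "\<lambda>F. fst (fst F) x"] arg_cong[OF eq, of "\<lambda>F. fst (snd F) x"] that
          by (simp add: prod_eq_iff)
        moreover have "h (?j y) = h' (?j y)"
          using arg_cong[OF eq, of "\<lambda>F. snd (fst F) y"] arg_cong[OF eq, of "\<lambda>F. snd (snd F) y"] that
          by (simp add: prod_eq_iff)
        ultimately        show ?thesis unfolding xy module_hom_add[OF D(1) c] module_hom_add[OF D(2) c] by simp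
      qed
      then show "h = h'" using D(3,4) by (intro extensionalityI) auto
    qed
  next
    fix F assume F: "F \<in> carrier (direct_sum (direct_sum (Hom_module A M N) (Hom_module A M' N'))
                (direct_sum (Hom_module A M N') (Hom_module A M' N)))"
    obtain a b c d where Fe: "F = ((a, b), (c, d))" by (metis surj_pair)
    have a: "a \<in> module_hom A M N" "a \<in> extensional (carrier M)"
      and b: "b \<in> module_hom A M' N'" "b \<in> extensional (carrier M')"
      and c: "c \<in> module_hom A M N'" "c \<in> extensional (carrier M)"
      and d: "d \<in> module_hom A M' N" "d \<in> extensional (carrier M')"
      using F by (auto simp: Fe direct_sum_def Hom_module_def)
    note z = module_hom_zero[OF M(1) N(1) a(1)] module_hom_zero[OF M(2) N(2) b(1)]
      module_hom_zero[OF M(1) N(2) c(1)] module_hom_zero[OF M(2) N(1) d(1)]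
    define h where "h = (\<lambda>(x, y)\<in>carrier M \<times> carrier M'. (a x \<oplus>\<^bsub>N\<^esub> d y, c x \<oplus>\<^bsub>N'\<^esub> b y))"
    have "h \<in> module_hom A (direct_sum M M') (direct_sum N N')"
      using a(1) b(1) c(1) d(1)
      by (auto simp: h_def module_hom_def direct_sum_def Pi_iff N.M.a_ac N'.M.a_ac
          N.smult_r_distr N'.smult_r_distr)
    then have "h \<in> carrier ?H" by (simp add: Hom_module_def h_def direct_sum_def)
    moreover have "?f h = F"
      unfolding Fe using a b c d
      by (auto simp: h_def z fun_eq_iff extensional_def module_hom_def Pi_iff)
    ultimately show "\<exists>h\<in>carrier ?H. ?f h = F" by blast
  qed (auto simp: direct_sum_def Hom_module_def fun_eq_iff prod_eq_iff)
qed

section \<open>Coordinate spaces over the residue field\<close>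

lemma func_space_direct_sum:
  assumes K: "cring K" and b: "bij_betw b (I <+> J) L"
  shows "module_isomorphic R
    (direct_sum (restrict_scalars \<rho> (ring.func_space K I)) (restrict_scalars \<rho> (ring.func_space K J)))
    (restrict_scalars \<rho> (ring.func_space K L))"
proof -
  interpret K: cring K by fact
  let ?b = "inv_into (I <+> J) b"
  have b': "bij_betw ?b L (I <+> J)" using b by (rule bij_betw_inv_into)
  have bb: "?b (b z) = z" if "z \<in> I <+> J" for z using b that by (simp add: bij_betw_inv_into_left)
  have bb': "?b l \<in> I <+> J" if "l \<in> L" for l using b' that by (auto simp: bij_betw_def)
  have bI: "i \<in> I" if "?b l = Inl i" "l \<in> L" for l i using bb'[OF that(2)] that(1) by auto
  have bJ: "j \<in> J" if "?b l = Inr j" "l \<in> L" for l j using bb'[OF that(2)] that(1) by auto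
  have bL: "b z \<in> L" if "z \<in> I <+> J" for z using b that by (auto simp: bij_betw_def)
  \<comment> \<open>A pair of functions is glued on the disjoint union \<open>I <+> J\<close> and
    transported along \<open>b\<close>. This later turns two index sets of pairs into an initial
    segment of the naturals, the index set of \<open>residue_power\<close>.\<close>
  let ?f = "\<lambda>(u, v). \<lambda>l\<in>L. case_sum u v (?b l)"
  show ?thesis
  proof (rule module_isomorphicI[where f = ?f])
    fix w assume w: "w \<in> carrier (restrict_scalars \<rho> (K.func_space L))"
    then have w: "w \<in> L \<rightarrow>\<^sub>E carrier K" by (simp add: restrict_scalars_def K.func_space_def)
    let ?u = "\<lambda>i\<in>I. w (b (Inl i))" and ?v = "\<lambda>j\<in>J. w (b (Inr j))"
    have "case_sum ?u ?v (?b l) = w l" if "l \<in> L" for l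
      using bb'[OF that] bij_betw_inv_into_right[OF b that] by (auto split: sum.split)
    then have "?f (?u, ?v) = w" using w by (auto simp: PiE_def extensional_def)
    moreover have "?u \<in> I \<rightarrow>\<^sub>E carrier K" "?v \<in> J \<rightarrow>\<^sub>E carrier K" using w bL by auto
    ultimately show "\<exists>x\<in>carrier (direct_sum (restrict_scalars \<rho> (K.func_space I)) (restrict_scalars \<rho> (K.func_space J))).
        ?f x = w"
      by (intro bexI[of _ "(?u, ?v)"]) (auto simp: direct_sum_def restrict_scalars_def K.func_space_def)
  next
    show "inj_on ?f (carrier (direct_sum (restrict_scalars \<rho> (K.func_space I)) (restrict_scalars \<rho> (K.func_space J))))"
    proof (rule inj_onI, clarify)
      fix u v u' v'
      assume c: "(u, v) \<in> carrier (direct_sum (restrict_scalars \<rho> (K.func_space I)) (restrict_scalars \<rho> (K.func_space J)))"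
        "(u', v') \<in> carrier (direct_sum (restrict_scalars \<rho> (K.func_space I)) (restrict_scalars \<rho> (K.func_space J)))"
        and eq: "(\<lambda>l\<in>L. case_sum u v (?b l)) = (\<lambda>l\<in>L. case_sum u' v' (?b l))"
      have e: "case_sum u v z = case_sum u' v' z" if "z \<in> I <+> J" for z
        using fun_cong[OF eq, of "b z"] bL[OF that] bb[OF that] by simp
      have "u = u'" using c e[of "Inl _"]
        by (intro PiE_ext[of u I "\<lambda>_. carrier K"]) (auto simp: direct_sum_def restrict_scalars_def K.func_space_def)
      moreover have "v = v'" using c e[of "Inr _"]
        by (intro PiE_ext[of v J "\<lambda>_. carrier K"]) (auto simp: direct_sum_def restrict_scalars_def K.func_space_def)
      ultimately show "u = u' \<and> v = v'" by simp
    qed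
  next
    fix x assume "x \<in> carrier (direct_sum (restrict_scalars \<rho> (K.func_space I)) (restrict_scalars \<rho> (K.func_space J)))"
    then show "?f x \<in> carrier (restrict_scalars \<rho> (K.func_space L))"
      using bb' by (fastforce simp: direct_sum_def restrict_scalars_def K.func_space_def split: sum.split)
  qed (auto simp: direct_sum_def restrict_scalars_def K.func_space_def fun_eq_iff split: sum.split dest: bI bJ)
qed

text \<open>Induction on a finite set containing the support: \<open>w\<close> is \<open>w i\<close>
  times a unit vector plus a function with one coordinate fewer. Plain closure conditions are used
  because \<open>U\<close> will mostly be the image of a map linear over another ring, where scalars
  from \<open>K\<close> have to be lifted first.\<close>

lemma (in cring) func_space_generated:
  assumes I: "finite I" and U: "U \<subseteq> I \<rightarrow>\<^sub>E carrier R" "\<zero>\<^bsub>func_space I\<^esub> \<in> U"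
    and add: "\<And>u v. u \<in> U \<Longrightarrow> v \<in> U \<Longrightarrow> u \<oplus>\<^bsub>func_space I\<^esub> v \<in> U"
    and smult: "\<And>c u. c \<in> carrier R \<Longrightarrow> u \<in> U \<Longrightarrow> c \<odot>\<^bsub>func_space I\<^esub> u \<in> U"
    and unit: "\<And>i. i \<in> I \<Longrightarrow> (\<lambda>j\<in>I. if j = i then \<one> else \<zero>) \<in> U"
  shows "U = I \<rightarrow>\<^sub>E carrier R"
proof -
  have "w \<in> U" if w: "w \<in> I \<rightarrow>\<^sub>E carrier R" and G: "finite G" "G \<subseteq> I" "\<And>i. i \<in> I - G \<Longrightarrow> w i = \<zero>" for w G
    using G w
  proof (induction G arbitrary: w rule: finite_induct)
    case empty
    then have "w = \<zero>\<^bsub>func_space I\<^esub>" by (auto simp: func_space_def fun_eq_iff PiE_def extensional_def)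
    then show ?case using U by simp
  next
    case (insert i G)
    let ?d = "\<lambda>j\<in>I. if j = i then \<one> else \<zero>"
    let ?w = "\<lambda>j\<in>I. if j = i then \<zero> else w j"
    have i: "i \<in> I" using insert by auto
    have wI: "w j \<in> carrier R" if "j \<in> I" for j using insert.prems that by auto
    have w_in: "?w \<in> U" using insert by (intro insert.IH) (auto simp: wI)
    have d_in: "w i \<odot>\<^bsub>func_space I\<^esub> ?d \<in> U" using i wI by (intro smult unit) auto
    have "(w i \<odot>\<^bsub>func_space I\<^esub> ?d) \<oplus>\<^bsub>func_space I\<^esub> ?w = w"
    proof
      fix j
      show "((w i \<odot>\<^bsub>func_space I\<^esub> ?d) \<oplus>\<^bsub>func_space I\<^esub> ?w) j = w j"
      proof (cases "j \<in> I")
        case True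
        then show ?thesis using wI[OF True] wI[OF i] by (simp add: func_space_def)
      next
        case False
        then show ?thesis using PiE_arb[OF insert.prems(3) False] by (simp add: func_space_def)
      qed
    qed
    then show ?case using add[OF d_in w_in] by simp
  qed
  from this[of _ I] show ?thesis using I U by auto
qed

text \<open>With \<open>f\<close> as coordinates, the \<open>v i\<close> generate because
  \<open>f\<close> is injective and already maps their span onto the whole coordinate space. They
  form a minimal generating set, hence a basis.\<close>

lemma (in vectorspace) dim_eq_card:
  assumes I: "finite I" and f: "f \<in> module_hom K V (func_space I)" and inj: "inj_on f (carrier V)"
    and v: "\<And>i. i \<in> I \<Longrightarrow> v i \<in> carrier V" "\<And>i. i \<in> I \<Longrightarrow> f (v i) = (\<lambda>j\<in>I. if j = i then \<one>\<^bsub>K\<^esub> else \<zero>\<^bsub>K\<^esub>)"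
  shows "dim = card I"
proof -
  have mV: "module K V" and mF: "module K (func_space I)"
    using vectorspace_axioms vectorspace_def func_space_is_module by auto
  have gen: "span B = carrier V" if B: "B = v ` I" for B
  proof -
    have BV: "B \<subseteq> carrier V" using B v by auto
    have sub: "submodule K (span B) V" by (rule span_is_submodule[OF BV])
    have sV: "span B \<subseteq> carrier V" using sub by (simp add: submodule_def)
    have "f ` span B = I \<rightarrow>\<^sub>E carrier K"
    proof (rule func_space_generated[OF I])
      show "f ` span B \<subseteq> I \<rightarrow>\<^sub>E carrier K"
        using module_hom_mem[OF f] sV by (auto simp: func_space_def)
      show "\<zero>\<^bsub>func_space I\<^esub> \<in> f ` span B"
        using module_hom_zero[OF mV mF f] sub by (metis image_eqI submodule.zero_closed)
      show "u \<oplus>\<^bsub>func_space I\<^esub> w \<in> f ` span B" if "u \<in> f ` span B" "w \<in> f ` span B" for u w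
        using that module_hom_add[OF f] sV submodule.m_closed[OF sub] by (smt (verit) image_iff subsetD)
      show "c \<odot>\<^bsub>func_space I\<^esub> u \<in> f ` span B" if "u \<in> f ` span B" "c \<in> carrier K" for u c
        using that module_hom_smult[OF f] sV submodule.smult_closed[OF sub] by (smt (verit) image_iff subsetD)
      show "(\<lambda>j\<in>I. if j = i then \<one>\<^bsub>K\<^esub> else \<zero>\<^bsub>K\<^esub>) \<in> f ` span B" if "i \<in> I" for i
        using v(2)[OF that] in_own_span[OF BV] B that by (metis image_eqI subsetD)
    qed
    then have sub': "f ` carrier V \<subseteq> f ` span B"
      using module_hom_mem[OF f] by (auto simp: func_space_def)
    have "x \<in> span B" if x: "x \<in> carrier V" for x
    proof -
      obtain y where y: "y \<in> span B" "f x = f y" using sub' x by blast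
      then have "x = y" using inj_onD[OF inj y(2) x] sV by blast
      then show ?thesis using y by simp
    qed
    then show ?thesis using sV by blast
  qed
  have injv: "inj_on v I"
  proof (rule inj_onI)
    fix i j assume "i \<in> I" "j \<in> I" "v i = v j"
    then have "(\<lambda>j\<in>I. if j = i then \<one>\<^bsub>K\<^esub> else \<zero>\<^bsub>K\<^esub>) i = (\<lambda>k\<in>I. if k = j then \<one>\<^bsub>K\<^esub> else \<zero>\<^bsub>K\<^esub>) i"
      using v(2) by metis
    then show "i = j" using \<open>i \<in> I\<close> by (auto split: if_splits)
  qed
  have "minimal (v ` I) (\<lambda>S. S \<subseteq> carrier V \<and> span S = carrier V)"
    unfolding minimal_def
  proof (intro conjI allI impI)
    fix B assume B: "B \<subseteq> v ` I \<and> B \<subseteq> carrier V \<and> span B = carrier V"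
    show "B = v ` I"
    proof (rule ccontr)
      assume "B \<noteq> v ` I"
      then obtain i where i: "i \<in> I" "v i \<notin> B" using B by auto
      \<comment> \<open>If \<open>v i\<close> is left out, all remaining generators lie in the
        kernel of the coordinate \<open>i\<close>, where \<open>v i\<close> does not lie.\<close>
      let ?N = "{x \<in> carrier V. f x i = \<zero>\<^bsub>K\<^esub>}"
      have fc: "f x i \<in> carrier K" if "x \<in> carrier V" for x
        using module_hom_mem[OF f that] i by (auto simp: func_space_def)
      have "submodule K ?N V"
        using module_hom_zero[OF mV mF f] i fc
        by (intro submodule_criterion[OF mV]) (auto simp: module_hom_add[OF f] module_hom_smult[OF f] func_space_def)
      moreover have "B \<subseteq> ?N"
      proof
        fix x assume x: "x \<in> B"
        then obtain j where j: "j \<in> I" "x = v j" using B by auto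
        then have "j \<noteq> i" using x i by auto
        then show "x \<in> ?N" using j i v by auto
      qed
      ultimately have "span B \<subseteq> ?N" by (intro span_is_subset)
      then have "f (v i) i = \<zero>\<^bsub>K\<^esub>" using B v(1)[OF i(1)] by auto
      then show False using v(2)[OF i(1)] i by simp
    qed
  qed (use v gen in auto)
  then have "basis (v ` I)" by (rule min_gen_is_basis)
  then have "dim = card (v ` I)" using I by (intro dim_basis) auto
  then show ?thesis using injv by (simp add: card_image)
qed

section \<open>Artinian rings and injective modules\<close>

text \<open>Zorn's lemma for the ideals above \<open>I\<close> that avoid \<open>\<one>\<close>, a
  condition that survives unions of chains. It will make every element outside the unique maximal
  ideal a unit.\<close>

lemma (in cring) proper_ideal_in_maximalideal:
  assumes I: "ideal I R" "\<one> \<notin> I"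
  shows "\<exists>J. maximalideal J R \<and> I \<subseteq> J"
proof -
  let ?P = "{J. ideal J R \<and> I \<subseteq> J \<and> \<one> \<notin> J}"
  have "\<exists>M\<in>?P. \<forall>X\<in>?P. M \<subseteq> X \<longrightarrow> X = M"
  proof (rule subset_Zorn_nonempty)
    show "?P \<noteq> {}" using I by auto
    fix C assume C: "C \<noteq> {}" "subset.chain ?P C"
    have CP: "C \<subseteq> ?P" using C by (simp add: subset.chain_def)
    have id: "ideal J R" if "J \<in> C" for J using CP that by auto
    have lin: "J \<subseteq> J' \<or> J' \<subseteq> J" if "J \<in> C" "J' \<in> C" for J J'
      using C(2) that by (auto simp: subset_chain_def)
    have "ideal (\<Union>C) R"
    proof (rule idealI)
      show "subgroup (\<Union>C) (add_monoid R)"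
      proof (rule add.subgroupI)
        show "\<Union>C \<subseteq> carrier R" using ideal.Icarr[OF id] by auto
        show "\<Union>C \<noteq> {}" using C(1) additive_subgroup.zero_closed[OF ideal.axioms(1)[OF id]] by auto
        show "\<ominus> a \<in> \<Union>C" if "a \<in> \<Union>C" for a
          using that additive_subgroup.a_inv_closed[OF ideal.axioms(1)[OF id]] by auto
        show "a \<oplus> b \<in> \<Union>C" if ab: "a \<in> \<Union>C" "b \<in> \<Union>C" for a b
        proof -
          from ab obtain J J' where J: "J \<in> C" "a \<in> J" "J' \<in> C" "b \<in> J'" by auto
          then obtain L where L: "L \<in> C" "a \<in> L" "b \<in> L" using lin[of J J'] by auto
          then show ?thesis using additive_subgroup.a_closed[OF ideal.axioms(1)[OF id[OF L(1)]]] by auto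
        qed
      qed
      show "x \<otimes> a \<in> \<Union>C" "a \<otimes> x \<in> \<Union>C" if "a \<in> \<Union>C" "x \<in> carrier R" for a x
        using that ideal.I_l_closed[OF id] ideal.I_r_closed[OF id] by blast+
    qed (rule ring_axioms)
    then show "\<Union>C \<in> ?P" using CP C(1) by auto
  qed
  then obtain M where M: "ideal M R" "I \<subseteq> M" "\<one> \<notin> M"
      and mx: "\<And>X. ideal X R \<Longrightarrow> I \<subseteq> X \<Longrightarrow> \<one> \<notin> X \<Longrightarrow> M \<subseteq> X \<Longrightarrow> X = M" by auto
  have "maximalideal M R"
  proof (rule maximalidealI)
    show "carrier R \<noteq> M" using M by auto
    fix J assume J: "ideal J R" "M \<subseteq> J" "J \<subseteq> carrier R"
    show "J = M \<or> J = carrier R"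
    proof (cases "\<one> \<in> J")
      case True
      then show ?thesis using ideal.one_imp_carrier[OF J(1)] by simp
    next
      case False
      then show ?thesis using mx[OF J(1)] M J by auto
    qed
  qed (rule M)
  then show ?thesis using M by auto
qed

text \<open>Otherwise every member has a strictly smaller one, and iterating a choice of these gives
  a descending sequence that never becomes constant.\<close>

lemma artinian_ring_minimal_ideal:
  assumes A: "artinian_ring A" and ne: "\<J> \<noteq> {}" and id: "\<And>J. J \<in> \<J> \<Longrightarrow> ideal J A"
  shows "\<exists>J\<in>\<J>. \<forall>J'\<in>\<J>. J' \<subseteq> J \<longrightarrow> J' = J"
proof (rule ccontr)
  assume "\<not> ?thesis"
  then have "\<forall>J\<in>\<J>. \<exists>J'\<in>\<J>. J' \<subset> J" by auto
  then obtain f where f: "\<And>J. J \<in> \<J> \<Longrightarrow> f J \<in> \<J> \<and> f J \<subset> J" by metis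
  from ne obtain J0 where J0: "J0 \<in> \<J>" by auto
  define I where "I n = (f ^^ n) J0" for n
  have I: "I n \<in> \<J>" for n by (induction n) (auto simp: I_def J0 f)
  have Is: "I (Suc n) \<subset> I n" for n using f[OF I[of n]] by (simp add: I_def)
  have "\<forall>n. ideal (I n) A \<and> I (Suc n) \<subseteq> I n" using id I Is by blast
  then obtain n where n: "\<forall>m\<ge>n. I m = I n" using A unfolding artinian_ring_def by blast
  have "I (Suc n) = I n" using n[rule_format, of "Suc n"] by simp
  then show False using Is by blast
qed

section \<open>Annihilators and division in injective modules\<close>

definition annihilator :: "('a, 'b) ring_scheme \<Rightarrow> ('a, 'm, 'c) module_scheme \<Rightarrow> 'm set \<Rightarrow> 'a set" where
  "annihilator A M X = {a \<in> carrier A. \<forall>x\<in>X. a \<odot>\<^bsub>M\<^esub> x = \<zero>\<^bsub>M\<^esub>}"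

lemma (in module) annihilator_ideal:
  assumes X: "X \<subseteq> carrier M"
  shows "ideal (annihilator R M X) R"
proof (rule idealI)
  show "ring R" by (rule R.ring_axioms)
  have Xc: "x \<in> carrier M" if "x \<in> X" for x using X that by auto
  show "subgroup (annihilator R M X) (add_monoid R)"
    by (rule R.add.subgroupI) (auto simp: annihilator_def smult_l_distr smult_l_minus Xc intro!: exI[of _ \<zero>])
  show "b \<otimes> a \<in> annihilator R M X" if "a \<in> annihilator R M X" "b \<in> carrier R" for a b
    using that by (auto simp: annihilator_def smult_assoc1 Xc)
  then show "a \<otimes> b \<in> annihilator R M X" if "a \<in> annihilator R M X" "b \<in> carrier R" for a b
    using that R.m_comm by (metis (no_types, lifting) annihilator_def mem_Collect_eq)
qed

text \<open>Among the ideals \<open>J \<inter> annihilator R M F\<close> with \<open>F\<close>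
  finite one is minimal, and adding a further element of \<open>X\<close> to that \<open>F\<close>
  cannot shrink it. This yields a finite part of \<open>\<mm>\<close> whose annihilator is
  \<open>soc A\<close>, and a finite part of \<open>E\<close> separating the elements of
  \<open>soc A\<close>.\<close>

lemma (in module) annihilator_finite:
  assumes A: "artinian_ring R" and X: "X \<subseteq> carrier M" and J: "ideal J R"
  shows "\<exists>F\<subseteq>X. finite F \<and> J \<inter> annihilator R M F = J \<inter> annihilator R M X"
proof -
  let ?J = "(\<lambda>F. J \<inter> annihilator R M F) ` {F. F \<subseteq> X \<and> finite F}"
  have "\<exists>I\<in>?J. \<forall>I'\<in>?J. I' \<subseteq> I \<longrightarrow> I' = I"
  proof (rule artinian_ring_minimal_ideal[OF A])
    show "?J \<noteq> {}" by auto
    show "ideal I R" if I: "I \<in> ?J" for I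
    proof -
      from I obtain F where F: "F \<subseteq> X" "I = J \<inter> annihilator R M F" by auto
      then have "ideal (annihilator R M F) R" using X by (intro annihilator_ideal) auto
      then show ?thesis using R.i_intersect[OF J] F by simp
    qed
  qed
  then obtain F where F: "F \<subseteq> X" "finite F"
      and mn: "\<And>F'. F' \<subseteq> X \<Longrightarrow> finite F' \<Longrightarrow> J \<inter> annihilator R M F' \<subseteq> J \<inter> annihilator R M F \<Longrightarrow>
        J \<inter> annihilator R M F' = J \<inter> annihilator R M F" by auto
  have "J \<inter> annihilator R M F \<subseteq> annihilator R M X"
  proof
    fix a assume a: "a \<in> J \<inter> annihilator R M F"
    have "a \<odot>\<^bsub>M\<^esub> x = \<zero>\<^bsub>M\<^esub>" if "x \<in> X" for x
    proof -
      have "J \<inter> annihilator R M (insert x F) = J \<inter> annihilator R M F"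
        using that F by (intro mn) (auto simp: annihilator_def)
      then show ?thesis using a by (auto simp: annihilator_def)
    qed
    then show "a \<in> annihilator R M X" using a by (auto simp: annihilator_def)
  qed
  then show ?thesis using F by (intro exI[of _ F]) (auto simp: annihilator_def)
qed

text \<open>Extend \<open>f\<close> to the whole ring; a homomorphism from \<open>A\<close> is
  multiplication by its value at \<open>\<one>\<close>, and that value is \<open>e\<close>.\<close>

lemma injective_module_baer:
  assumes E: "injective_module A E" and I: "ideal I A" and f: "f \<in> module_hom A (ideal_module A I) E"
  shows "\<exists>e\<in>carrier E. \<forall>a\<in>I. f a = a \<odot>\<^bsub>E\<^esub> e"
proof -
  interpret E: module A E using E by (simp add: injective_module_def)
  interpret I: ideal I A by fact
  have "id \<in> module_hom A (ideal_module A I) (self_module A)"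
    by (auto simp: module_hom_def ideal_module_def self_module_def)
  then obtain h where h: "h \<in> module_hom A (self_module A) E" and hf: "\<And>a. a \<in> I \<Longrightarrow> h a = f a"
    using injective_module_extend[OF E ideal_module_is_module[OF E.R.cring_axioms I]
        self_module_is_module[OF E.R.cring_axioms] _ _ f, of id]
    by (auto simp: ideal_module_def)
  have "h \<one>\<^bsub>A\<^esub> \<in> carrier E" using module_hom_mem[OF h] by (simp add: self_module_def)
  moreover have "f a = a \<odot>\<^bsub>E\<^esub> h \<one>\<^bsub>A\<^esub>" if "a \<in> I" for a
    using module_hom_smult[OF h, of a "\<one>\<^bsub>A\<^esub>"] hf[OF that] that by (simp add: self_module_def)
  ultimately show ?thesis by blast
qed

text \<open>Sending \<open>j z\<close> to \<open>j x\<close> is well defined on the ideal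
  \<open>J z\<close> because of \<open>ann\<close>, and Baer's criterion turns it into
  multiplication by \<open>e\<close>. With \<open>J\<close> the whole ring, \<open>x\<close> itself
  becomes divisible by \<open>z\<close>; a smaller \<open>J\<close> allows division by several
  elements in turn.\<close>

lemma injective_module_divide:
  assumes E: "injective_module A E" and J: "ideal J A" and z: "z \<in> carrier A" and x: "x \<in> carrier E"
    and ann: "\<And>j. j \<in> J \<Longrightarrow> j \<otimes>\<^bsub>A\<^esub> z = \<zero>\<^bsub>A\<^esub> \<Longrightarrow> j \<odot>\<^bsub>E\<^esub> x = \<zero>\<^bsub>E\<^esub>"
  shows "\<exists>e\<in>carrier E. \<forall>j\<in>J. (j \<otimes>\<^bsub>A\<^esub> z) \<odot>\<^bsub>E\<^esub> e = j \<odot>\<^bsub>E\<^esub> x"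
proof -
  interpret E: module A E using E by (simp add: injective_module_def)
  interpret J: ideal J A by fact
  define I where "I = (\<lambda>j. j \<otimes>\<^bsub>A\<^esub> z) ` J"
  define f where "f y = (SOME j. j \<in> J \<and> y = j \<otimes>\<^bsub>A\<^esub> z) \<odot>\<^bsub>E\<^esub> x" for y
  have f: "f (j \<otimes>\<^bsub>A\<^esub> z) = j \<odot>\<^bsub>E\<^esub> x" if j: "j \<in> J" for j
  proof -
    define i where "i = (SOME i. i \<in> J \<and> j \<otimes>\<^bsub>A\<^esub> z = i \<otimes>\<^bsub>A\<^esub> z)"
    have i: "i \<in> J" "j \<otimes>\<^bsub>A\<^esub> z = i \<otimes>\<^bsub>A\<^esub> z"
      using someI[of "\<lambda>i. i \<in> J \<and> j \<otimes>\<^bsub>A\<^esub> z = i \<otimes>\<^bsub>A\<^esub> z" j] j unfolding i_def by auto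
    \<comment> \<open>Two preimages of the same element differ by something in \<open>J\<close> that
      kills \<open>z\<close>, hence also \<open>x\<close>.\<close>
    have ij: "i \<oplus>\<^bsub>A\<^esub> \<ominus>\<^bsub>A\<^esub> j \<in> J" using i j by simp
    have "(i \<oplus>\<^bsub>A\<^esub> \<ominus>\<^bsub>A\<^esub> j) \<otimes>\<^bsub>A\<^esub> z = \<zero>\<^bsub>A\<^esub>"
      using i j z by (simp add: E.R.l_distr E.R.l_minus E.R.r_neg)
    then have "(i \<oplus>\<^bsub>A\<^esub> \<ominus>\<^bsub>A\<^esub> j) \<odot>\<^bsub>E\<^esub> x = \<zero>\<^bsub>E\<^esub>" by (rule ann[OF ij])
    then have "i \<odot>\<^bsub>E\<^esub> x \<ominus>\<^bsub>E\<^esub> j \<odot>\<^bsub>E\<^esub> x = \<zero>\<^bsub>E\<^esub>"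
      using i j x by (simp add: E.smult_l_distr E.smult_l_minus E.M.minus_eq)
    then have "i \<odot>\<^bsub>E\<^esub> x = j \<odot>\<^bsub>E\<^esub> x"
      using i j x by (subst (asm) E.M.minus_eq_zero_iff) auto
    then show ?thesis by (simp add: f_def i_def)
  qed
  have add: "i \<otimes>\<^bsub>A\<^esub> z \<oplus>\<^bsub>A\<^esub> j \<otimes>\<^bsub>A\<^esub> z = (i \<oplus>\<^bsub>A\<^esub> j) \<otimes>\<^bsub>A\<^esub> z" if "i \<in> J" "j \<in> J" for i j
    using that z by (simp add: E.R.l_distr)
  have mul: "a \<otimes>\<^bsub>A\<^esub> (j \<otimes>\<^bsub>A\<^esub> z) = (a \<otimes>\<^bsub>A\<^esub> j) \<otimes>\<^bsub>A\<^esub> z" if "a \<in> carrier A" "j \<in> J" for a j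
    using that z by (simp add: E.R.m_assoc)
  have I: "ideal I A"
  proof (rule idealI)
    show "ring A" by (rule E.R.ring_axioms)
    show "subgroup I (add_monoid A)"
    proof (rule E.R.add.subgroupI)
      show "I \<subseteq> carrier A" unfolding I_def using z by auto
      show "I \<noteq> {}" unfolding I_def using additive_subgroup.zero_closed[OF J.is_additive_subgroup] by blast
      show "\<ominus>\<^bsub>A\<^esub> y \<in> I" if y: "y \<in> I" for y
      proof -
        from y obtain j where j: "j \<in> J" "y = j \<otimes>\<^bsub>A\<^esub> z" unfolding I_def by auto
        then show ?thesis unfolding I_def using z by (intro image_eqI[of _ _ "\<ominus>\<^bsub>A\<^esub> j"]) (auto simp: E.R.l_minus)
      qed
      show "y \<oplus>\<^bsub>A\<^esub> y' \<in> I" if "y \<in> I" "y' \<in> I" for y y'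
        using that add unfolding I_def by fastforce
    qed
    show mI: "a \<otimes>\<^bsub>A\<^esub> y \<in> I" if "y \<in> I" "a \<in> carrier A" for a y
      using that mul J.I_l_closed unfolding I_def by fastforce
    show "y \<otimes>\<^bsub>A\<^esub> a \<in> I" if "y \<in> I" "a \<in> carrier A" for a y
    proof -
      have "y \<in> carrier A" using that z unfolding I_def by auto
      then show ?thesis using mI[OF that] that(2) E.R.m_comm by simp
    qed
  qed
  have "f \<in> module_hom A (ideal_module A I) E"
  proof (rule module_homI)
    show "f y \<in> carrier E" if "y \<in> carrier (ideal_module A I)" for y
      using that f x by (auto simp: ideal_module_def I_def)
    show "f (y \<oplus>\<^bsub>ideal_module A I\<^esub> y') = f y \<oplus>\<^bsub>E\<^esub> f y'"
      if "y \<in> carrier (ideal_module A I)" "y' \<in> carrier (ideal_module A I)" for y y'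
      using that x by (auto simp: ideal_module_def self_module_def I_def add f E.smult_l_distr)
    show "f (a \<odot>\<^bsub>ideal_module A I\<^esub> y) = a \<odot>\<^bsub>E\<^esub> f y"
      if "a \<in> carrier A" "y \<in> carrier (ideal_module A I)" for a y
      using that x by (auto simp: ideal_module_def self_module_def I_def mul f E.smult_assoc1 J.I_l_closed)
  qed
  from injective_module_baer[OF E I this] obtain e where e: "e \<in> carrier E" "\<And>y. y \<in> I \<Longrightarrow> f y = y \<odot>\<^bsub>E\<^esub> e"
    by auto
  show ?thesis
  proof (intro bexI[of _ e] ballI e(1))
    fix j assume "j \<in> J"
    then show "(j \<otimes>\<^bsub>A\<^esub> z) \<odot>\<^bsub>E\<^esub> e = j \<odot>\<^bsub>E\<^esub> x" using e(2)[of "j \<otimes>\<^bsub>A\<^esub> z"] f[of j] by (simp add: I_def)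
  qed
qed

text \<open>A retract of an injective module is injective, so \<open>A\<close> has injective dimension \<open>0\<close>.  The terms
  of the resolution have to live in \<open>nat \<Rightarrow> 'a\<close>, so \<open>A\<close> is copied onto the constant functions.\<close>
lemma gorenstein_if_retract:
  assumes A: "cring A" and E: "injective_module A E"
    and i: "i \<in> module_hom A (self_module A) E" and g: "g \<in> module_hom A E (self_module A)"
    and gi: "\<And>a. a \<in> carrier A \<Longrightarrow> g (i a) = a"
  shows "gorenstein A"
proof -
  interpret A: cring A by fact
  \<comment> \<open>\<open>C X\<close> is the ideal \<open>X\<close> as a module of constant
    sequences. Only \<open>X = A\<close> and \<open>X = 0\<close> occur, the former in degree 0 and
    the latter above.\<close>
  define C :: "'a set \<Rightarrow> ('a, nat \<Rightarrow> 'a) module" where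
    "C X = \<lparr>carrier = (\<lambda>a n. a) ` X, mult = (\<lambda>f g. f), one = (\<lambda>n. \<zero>\<^bsub>A\<^esub>), zero = (\<lambda>n. \<zero>\<^bsub>A\<^esub>),
       add = (\<lambda>f g n. f n \<oplus>\<^bsub>A\<^esub> g n), smult = (\<lambda>a f n. a \<otimes>\<^bsub>A\<^esub> f n)\<rparr>" for X
  have C_module: "module A (C X)" if X: "ideal X A" for X
  proof -
    interpret X: ideal X A by fact
    have "abelian_group (C X)"
    proof (rule abelian_groupI)
      fix f assume "f \<in> carrier (C X)"
      then obtain a where "a \<in> X" "f = (\<lambda>n. a)" by (auto simp: C_def)
      then show "\<exists>g\<in>carrier (C X). g \<oplus>\<^bsub>C X\<^esub> f = \<zero>\<^bsub>C X\<^esub>"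
        by (intro bexI[of _ "\<lambda>n. \<ominus>\<^bsub>A\<^esub> a"]) (auto simp: C_def A.l_neg)
    qed (auto simp: C_def A.a_ac)
    then show ?thesis
      by (rule moduleI[OF A]) (auto simp: C_def A.l_distr A.r_distr A.m_assoc X.I_l_closed)
  qed
  \<comment> \<open>The extension property passes to the retract: extend \<open>j\<close> after
    \<open>v\<close> into \<open>E\<close>, then apply \<open>p\<close>.\<close>
  have C_inj: "injective_module A (C X)"
    if X: "ideal X A" and jp: "\<exists>j\<in>module_hom A (C X) E. \<exists>p\<in>module_hom A E (C X). \<forall>f\<in>carrier (C X). p (j f) = f" for X
    unfolding injective_module_def
  proof (intro conjI allI impI)
    fix M N :: "('a, 'a) module" and u v
    assume "module A M \<and> module A N \<and> u \<in> module_hom A M N \<and> inj_on u (carrier M) \<and> v \<in> module_hom A M (C X)"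
    then have 1: "module A M" "module A N" "u \<in> module_hom A M N" "inj_on u (carrier M)"
      "v \<in> module_hom A M (C X)" by auto
    from jp obtain j p where j: "j \<in> module_hom A (C X) E" and p: "p \<in> module_hom A E (C X)"
      and pj: "\<And>f. f \<in> carrier (C X) \<Longrightarrow> p (j f) = f" by auto
    obtain h where h: "h \<in> module_hom A N E" "\<And>x. x \<in> carrier M \<Longrightarrow> h (u x) = j (v x)"
      using injective_module_extend[OF E 1(1-4) module_hom_compose[OF 1(5) j]] by blast
    show "\<exists>h\<in>module_hom A N (C X). \<forall>x\<in>carrier M. h (u x) = v x"
      using module_hom_compose[OF h(1) p] h(2) pj module_hom_mem[OF 1(5)]
      by (intro bexI[of _ "\<lambda>x. p (h x)"]) auto
  qed (rule C_module[OF X])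
  have id: "ideal (carrier A) A" "ideal {\<zero>\<^bsub>A\<^esub>} A" by (rule A.oneideal, rule A.zeroideal)
  have full: "injective_module A (C (carrier A))"
  proof (rule C_inj[OF id(1)], intro bexI ballI)
    show "(\<lambda>f. i (f 0)) \<in> module_hom A (C (carrier A)) E"
      using i by (auto simp: module_hom_def C_def self_module_def Pi_iff)
    show "(\<lambda>x n. g x) \<in> module_hom A E (C (carrier A))"
      using g by (auto simp: module_hom_def C_def self_module_def Pi_iff)
    show "(\<lambda>n. g (i (f 0))) = f" if "f \<in> carrier (C (carrier A))" for f
      using that gi by (auto simp: C_def)
  qed
  have zero: "injective_module A (C {\<zero>\<^bsub>A\<^esub>})"
  proof (rule C_inj[OF id(2)], intro bexI ballI)
    interpret E: module A E using E by (simp add: injective_module_def)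
    show "(\<lambda>f. \<zero>\<^bsub>E\<^esub>) \<in> module_hom A (C {\<zero>\<^bsub>A\<^esub>}) E" by (auto simp: module_hom_def)
    show "(\<lambda>x n. \<zero>\<^bsub>A\<^esub>) \<in> module_hom A E (C {\<zero>\<^bsub>A\<^esub>})" by (auto simp: module_hom_def C_def)
    show "(\<lambda>n. \<zero>\<^bsub>A\<^esub>) = f" if "f \<in> carrier (C {\<zero>\<^bsub>A\<^esub>})" for f
      using that by (auto simp: C_def)
  qed
  \<comment> \<open>With zero modules from degree 1 on and all differentials zero, exactness only
    asks that \<open>A\<close> map onto the term of degree 0; the bound \<open>n\<close> is
    0.\<close>
  define I where "I k = C (if k = 0 then carrier A else {\<zero>\<^bsub>A\<^esub>})" for k :: nat
  have "finite_injective_dimension A (self_module A)"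
    unfolding finite_injective_dimension_def
  proof (intro exI conjI allI impI)
    show "injective_module A (I k)" for k using full zero by (simp add: I_def)
    show "(\<lambda>a n. a) \<in> module_hom A (self_module A) (I 0)"
      by (auto simp: module_hom_def I_def C_def self_module_def)
    show "inj_on (\<lambda>a n. a) (carrier (self_module A))" by (auto simp: inj_on_def fun_eq_iff)
    show "(\<lambda>f n. \<zero>\<^bsub>A\<^esub>) \<in> module_hom A (I k) (I (Suc k))" for k
      by (auto simp: module_hom_def I_def C_def)
    show "(\<lambda>a n. a) ` carrier (self_module A) = {x \<in> carrier (I 0). (\<lambda>n. \<zero>\<^bsub>A\<^esub>) = \<zero>\<^bsub>I 1\<^esub>}"
      by (auto simp: I_def C_def self_module_def)
    show "(\<lambda>f n. \<zero>\<^bsub>A\<^esub>) ` carrier (I k) = {x \<in> carrier (I (Suc k)). (\<lambda>n. \<zero>\<^bsub>A\<^esub>) = \<zero>\<^bsub>I (Suc (Suc k))\<^esub>}" for k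
      by (auto simp: I_def C_def)
    show "carrier (I k) = {\<zero>\<^bsub>I k\<^esub>}" if "0 < k" for k using that by (auto simp: I_def C_def)
  qed
  then show ?thesis by (simp add: gorenstein_def)
qed

section \<open>The injective envelope of the residue field\<close>

text \<open>The embedding of \<open>K\<close>, which \<open>injective_envelope\<close> only asserts
  to exist, is a parameter here, so that its inverse can serve as the coordinate on the
  socle.\<close>

locale local_envelope =
  fixes A :: "('a, 'b) ring_scheme" and \<mm> :: "'a set" and K :: "('k, 'c) ring_scheme" and \<pi> :: "'a \<Rightarrow> 'k"
    and E :: "('a, 'e, 'd) module_scheme" and \<iota> :: "'k \<Rightarrow> 'e"
  assumes artinian_local: "artinian_local_ring A \<mm> K \<pi>"
    and injective: "injective_module A E"
    and iota_hom: "\<iota> \<in> module_hom A (residue_module K \<pi>) E"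
    and iota_inj: "inj_on \<iota> (carrier K)"
    and essential: "\<And>H. submodule A H E \<Longrightarrow> H \<inter> \<iota> ` carrier K = {\<zero>\<^bsub>E\<^esub>} \<Longrightarrow> H = {\<zero>\<^bsub>E\<^esub>}"

sublocale local_envelope \<subseteq> E: module A E
  using injective by (simp add: injective_module_def)

sublocale local_envelope \<subseteq> K: field K
  using artinian_local by (simp add: artinian_local_ring_def)

context local_envelope
begin

lemma pi_hom: "\<pi> \<in> ring_hom A K" and pi_surj: "\<pi> ` carrier A = carrier K"
  using artinian_local by (auto simp: artinian_local_ring_def)

lemma pi_closed [simp]: "a \<in> carrier A \<Longrightarrow> \<pi> a \<in> carrier K"
  by (rule ring_hom_closed[OF pi_hom])

lemma pi_add [simp]: "a \<in> carrier A \<Longrightarrow> b \<in> carrier A \<Longrightarrow> \<pi> (a \<oplus>\<^bsub>A\<^esub> b) = \<pi> a \<oplus>\<^bsub>K\<^esub> \<pi> b"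
  by (rule ring_hom_add[OF pi_hom])

lemma pi_mult [simp]: "a \<in> carrier A \<Longrightarrow> b \<in> carrier A \<Longrightarrow> \<pi> (a \<otimes>\<^bsub>A\<^esub> b) = \<pi> a \<otimes>\<^bsub>K\<^esub> \<pi> b"
  by (rule ring_hom_mult[OF pi_hom])

lemma pi_one [simp]: "\<pi> \<one>\<^bsub>A\<^esub> = \<one>\<^bsub>K\<^esub>"
  by (rule ring_hom_one[OF pi_hom])

lemma pi_zero [simp]: "\<pi> \<zero>\<^bsub>A\<^esub> = \<zero>\<^bsub>K\<^esub>"
  by (rule ring_hom_zero[OF pi_hom E.R.ring_axioms K.ring_axioms])

lemma pi_minus [simp]: "a \<in> carrier A \<Longrightarrow> \<pi> (\<ominus>\<^bsub>A\<^esub> a) = \<ominus>\<^bsub>K\<^esub> \<pi> a"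
  using pi_add[of "\<ominus>\<^bsub>A\<^esub> a" a] by (metis E.R.a_inv_closed E.R.l_neg K.minus_equality pi_closed pi_zero)

lemma mem_max: "a \<in> \<mm> \<longleftrightarrow> a \<in> carrier A \<and> \<pi> a = \<zero>\<^bsub>K\<^esub>"
  using artinian_local by (auto simp: artinian_local_ring_def a_kernel_def')

lemma max_ideal: "maximalideal \<mm> A" and max_unique: "maximalideal J A \<Longrightarrow> J = \<mm>"
  using artinian_local by (auto simp: artinian_local_ring_def local_ring_def)

lemma artinian: "artinian_ring A"
  using artinian_local by (simp add: artinian_local_ring_def)

lemma lift_exists: "c \<in> carrier K \<Longrightarrow> \<exists>a\<in>carrier A. \<pi> a = c"
  using pi_surj by (metis imageE)

text \<open>Otherwise the principal ideal of \<open>a\<close> is proper and lies in a maximal ideal,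
  which can only be \<open>\<mm>\<close>.\<close>

lemma Units_if_not_max:
  assumes a: "a \<in> carrier A" "a \<notin> \<mm>"
  shows "\<exists>b\<in>carrier A. b \<otimes>\<^bsub>A\<^esub> a = \<one>\<^bsub>A\<^esub>"
proof -
  have "\<one>\<^bsub>A\<^esub> \<in> PIdl\<^bsub>A\<^esub> a"
  proof (rule ccontr)
    assume "\<one>\<^bsub>A\<^esub> \<notin> PIdl\<^bsub>A\<^esub> a"
    then obtain J where "maximalideal J A" "PIdl\<^bsub>A\<^esub> a \<subseteq> J"
      using E.R.proper_ideal_in_maximalideal[OF E.R.cgenideal_ideal[OF a(1)]] by auto
    then show False using max_unique E.R.cgenideal_self[OF a(1)] a(2) by auto
  qed
  then show ?thesis by (auto simp: cgenideal_def)
qed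

lemma iota_closed [simp]: "c \<in> carrier K \<Longrightarrow> \<iota> c \<in> carrier E"
  using module_hom_mem[OF iota_hom] by (simp add: module_constr_simps)

lemma iota_add: "c \<in> carrier K \<Longrightarrow> d \<in> carrier K \<Longrightarrow> \<iota> (c \<oplus>\<^bsub>K\<^esub> d) = \<iota> c \<oplus>\<^bsub>E\<^esub> \<iota> d"
  using module_hom_add[OF iota_hom, of c d] by (simp add: module_constr_simps)

lemma iota_smult: "a \<in> carrier A \<Longrightarrow> c \<in> carrier K \<Longrightarrow> \<iota> (\<pi> a \<otimes>\<^bsub>K\<^esub> c) = a \<odot>\<^bsub>E\<^esub> \<iota> c"
  using module_hom_smult[OF iota_hom, of a c] by (simp add: module_constr_simps)

lemma iota_zero [simp]: "\<iota> \<zero>\<^bsub>K\<^esub> = \<zero>\<^bsub>E\<^esub>"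
  using iota_smult[of "\<zero>\<^bsub>A\<^esub>" "\<zero>\<^bsub>K\<^esub>"] by simp

definition socle :: "'e set" where
  "socle = {x \<in> carrier E. \<forall>a\<in>\<mm>. a \<odot>\<^bsub>E\<^esub> x = \<zero>\<^bsub>E\<^esub>}"

lemma iota_socle: "c \<in> carrier K \<Longrightarrow> \<iota> c \<in> socle"
  using iota_smult by (auto simp: socle_def mem_max iota_smult[symmetric])

text \<open>\<open>a - b\<close> lies in \<open>\<mm>\<close>, so the action of \<open>A\<close> on
  the socle factors through \<open>K\<close>.\<close>

lemma smult_socle:
  assumes "a \<in> carrier A" "b \<in> carrier A" "\<pi> a = \<pi> b" "x \<in> socle"
  shows "a \<odot>\<^bsub>E\<^esub> x = b \<odot>\<^bsub>E\<^esub> x"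
proof -
  have x: "x \<in> carrier E" using assms by (simp add: socle_def)
  have "a \<oplus>\<^bsub>A\<^esub> \<ominus>\<^bsub>A\<^esub> b \<in> \<mm>" using assms by (simp add: mem_max K.r_neg)
  then have "(a \<oplus>\<^bsub>A\<^esub> \<ominus>\<^bsub>A\<^esub> b) \<odot>\<^bsub>E\<^esub> x = \<zero>\<^bsub>E\<^esub>" using assms by (simp add: socle_def)
  then have "a \<odot>\<^bsub>E\<^esub> x \<ominus>\<^bsub>E\<^esub> b \<odot>\<^bsub>E\<^esub> x = \<zero>\<^bsub>E\<^esub>"
    using assms x by (simp add: E.smult_l_distr E.smult_l_minus E.M.minus_eq)
  then show ?thesis using assms x by (subst (asm) E.M.minus_eq_zero_iff) auto
qed

text \<open>For \<open>x\<close> in the socle but outside the image of \<open>\<iota>\<close>, a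
  nonzero element of \<open>A x\<close> in that image would be a unit multiple of \<open>x\<close>
  and put \<open>x\<close> itself there. So \<open>A x\<close> meets the image in 0, and
  essentiality gives \<open>x = 0\<close>.\<close>

lemma socle_eq: "socle = \<iota> ` carrier K"
proof
  show "\<iota> ` carrier K \<subseteq> socle" using iota_socle by auto
  show "socle \<subseteq> \<iota> ` carrier K"
  proof
    fix x assume x: "x \<in> socle"
    have xE: "x \<in> carrier E" using x by (simp add: socle_def)
    show "x \<in> \<iota> ` carrier K"
    proof (rule ccontr)
      assume no: "x \<notin> \<iota> ` carrier K"
      let ?H = "(\<lambda>a. a \<odot>\<^bsub>E\<^esub> x) ` carrier A"
      have "submodule A ?H E"
      proof (rule submodule_criterion)
        show "module A E" by (rule E.module_axioms)
        show "?H \<subseteq> carrier E" using xE by auto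
        show "\<zero>\<^bsub>E\<^esub> \<in> ?H" using xE by (intro image_eqI[of _ _ "\<zero>\<^bsub>A\<^esub>"]) auto
        show "y \<oplus>\<^bsub>E\<^esub> z \<in> ?H" if yz: "y \<in> ?H" "z \<in> ?H" for y z
        proof -
          from yz obtain a b where "a \<in> carrier A" "b \<in> carrier A" "y = a \<odot>\<^bsub>E\<^esub> x" "z = b \<odot>\<^bsub>E\<^esub> x" by auto
          then show ?thesis using xE by (intro image_eqI[of _ _ "a \<oplus>\<^bsub>A\<^esub> b"]) (auto simp: E.smult_l_distr)
        qed
        show "a \<odot>\<^bsub>E\<^esub> y \<in> ?H" if ay: "a \<in> carrier A" "y \<in> ?H" for a y
        proof -
          from ay obtain b where "b \<in> carrier A" "y = b \<odot>\<^bsub>E\<^esub> x" by auto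
          then show ?thesis using xE ay by (intro image_eqI[of _ _ "a \<otimes>\<^bsub>A\<^esub> b"]) (auto simp: E.smult_assoc1)
        qed
      qed
      moreover have "?H \<inter> \<iota> ` carrier K = {\<zero>\<^bsub>E\<^esub>}"
      proof
        show "{\<zero>\<^bsub>E\<^esub>} \<subseteq> ?H \<inter> \<iota> ` carrier K"
          using xE by (auto intro!: image_eqI[of _ _ "\<zero>\<^bsub>A\<^esub>"] image_eqI[of _ _ "\<zero>\<^bsub>K\<^esub>"])
        show "?H \<inter> \<iota> ` carrier K \<subseteq> {\<zero>\<^bsub>E\<^esub>}"
        proof
          fix y assume "y \<in> ?H \<inter> \<iota> ` carrier K"
          then obtain a c where a: "a \<in> carrier A" "y = a \<odot>\<^bsub>E\<^esub> x" and c: "c \<in> carrier K" "y = \<iota> c" by auto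
          have "\<pi> a = \<zero>\<^bsub>K\<^esub>"
          proof (rule ccontr)
            assume "\<pi> a \<noteq> \<zero>\<^bsub>K\<^esub>"
            then have u: "\<pi> a \<in> Units K" using a K.field_Units by simp
            then obtain b where b: "b \<in> carrier A" "\<pi> b = inv\<^bsub>K\<^esub> \<pi> a" using lift_exists K.Units_inv_closed by metis
            have "x = (b \<otimes>\<^bsub>A\<^esub> a) \<odot>\<^bsub>E\<^esub> x"
              using smult_socle[of "\<one>\<^bsub>A\<^esub>" "b \<otimes>\<^bsub>A\<^esub> a" x] x a b u xE by simp
            also have "\<dots> = b \<odot>\<^bsub>E\<^esub> \<iota> c" using a b c xE by (simp add: E.smult_assoc1)
            also have "\<dots> = \<iota> (\<pi> b \<otimes>\<^bsub>K\<^esub> c)" by (rule iota_smult[OF b(1) c(1), symmetric])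
            finally have "x = \<iota> (\<pi> b \<otimes>\<^bsub>K\<^esub> c)" .
            moreover have "\<pi> b \<otimes>\<^bsub>K\<^esub> c \<in> carrier K" using pi_closed[OF b(1)] c(1) by (rule K.m_closed)
            ultimately show False using no by blast
          qed
          then have "a \<in> \<mm>" using a by (simp add: mem_max)
          then show "y \<in> {\<zero>\<^bsub>E\<^esub>}" using x a by (simp add: socle_def)
        qed
      qed
      ultimately have "?H = {\<zero>\<^bsub>E\<^esub>}" by (rule essential)
      moreover have "x \<in> ?H" using xE by (intro image_eqI[of _ _ "\<one>\<^bsub>A\<^esub>"]) auto
      ultimately have "x = \<zero>\<^bsub>E\<^esub>" by auto
      then show False using no iota_zero by (metis K.zero_closed image_eqI)
    qed
  qed
qed

text \<open>By \<open>socle_eq\<close> this identifies \<open>soc E\<close> with \<open>K\<close>.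
  Composed with multiplication by elements of \<open>soc A\<close> it provides the linear
  functionals on \<open>E\<close> that serve as coordinates.\<close>

definition coord :: "'e \<Rightarrow> 'k" where
  "coord = inv_into (carrier K) \<iota>"

lemma coord_iota [simp]: "c \<in> carrier K \<Longrightarrow> coord (\<iota> c) = c"
  using iota_inj by (simp add: coord_def)

lemma coord_closed [simp]: "x \<in> socle \<Longrightarrow> coord x \<in> carrier K"
  by (simp add: coord_def socle_eq inv_into_into)

lemma iota_coord [simp]: "x \<in> socle \<Longrightarrow> \<iota> (coord x) = x"
  by (simp add: coord_def socle_eq f_inv_into_f)

lemma coord_inj: "x \<in> socle \<Longrightarrow> y \<in> socle \<Longrightarrow> coord x = coord y \<Longrightarrow> x = y"
  by (metis iota_coord)

lemma socle_carrier: "x \<in> socle \<Longrightarrow> x \<in> carrier E"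
  by (simp add: socle_def)

lemma coord_add: "x \<in> socle \<Longrightarrow> y \<in> socle \<Longrightarrow> coord (x \<oplus>\<^bsub>E\<^esub> y) = coord x \<oplus>\<^bsub>K\<^esub> coord y"
  by (metis K.add.m_closed coord_closed coord_iota iota_add iota_coord)

lemma coord_smult: "a \<in> carrier A \<Longrightarrow> x \<in> socle \<Longrightarrow> coord (a \<odot>\<^bsub>E\<^esub> x) = \<pi> a \<otimes>\<^bsub>K\<^esub> coord x"
  by (metis K.m_closed coord_closed coord_iota iota_coord iota_smult pi_closed)

lemma coord_zero [simp]: "coord \<zero>\<^bsub>E\<^esub> = \<zero>\<^bsub>K\<^esub>"
  by (metis K.zero_closed coord_iota iota_zero)

section \<open>The socle of the ring and its pairing with the envelope\<close>

definition ring_socle :: "'a set" where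
  "ring_socle = annihilator A (self_module A) \<mm>"

lemma ring_socle_iff: "z \<in> ring_socle \<longleftrightarrow> z \<in> carrier A \<and> (\<forall>a\<in>\<mm>. a \<otimes>\<^bsub>A\<^esub> z = \<zero>\<^bsub>A\<^esub>)"
  using E.R.m_comm by (auto simp: ring_socle_def annihilator_def self_module_def mem_max)

lemma max_subset: "\<mm> \<subseteq> carrier A"
  by (auto simp: mem_max)

lemma self_module: "module A (self_module A)"
  by (rule self_module_is_module) (rule E.R.cring_axioms)

lemma ring_socle_ideal: "ideal ring_socle A"
  unfolding ring_socle_def
  by (rule module.annihilator_ideal[OF self_module]) (use max_subset in \<open>simp add: self_module_def\<close>)

lemma ring_socle_smult:
  assumes z: "z \<in> ring_socle" and x: "x \<in> carrier E"
  shows "z \<odot>\<^bsub>E\<^esub> x \<in> socle"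
proof -
  have zA: "z \<in> carrier A" using z by (simp add: ring_socle_iff)
  have "a \<odot>\<^bsub>E\<^esub> (z \<odot>\<^bsub>E\<^esub> x) = \<zero>\<^bsub>E\<^esub>" if "a \<in> \<mm>" for a
    using that zA z x max_subset by (subst E.smult_assoc1[symmetric]) (auto simp: ring_socle_iff)
  then show ?thesis using zA x by (simp add: socle_def)
qed

text \<open>The difference of \<open>a\<close> and \<open>b\<close> lies in \<open>\<mm>\<close>.
  Hence maps that multiply a socle element by arbitrary lifts of scalars from \<open>K\<close> are
  additive and linear.\<close>

lemma ring_socle_mult_eq:
  assumes "a \<in> carrier A" "b \<in> carrier A" "\<pi> a = \<pi> b" "z \<in> ring_socle"
  shows "a \<otimes>\<^bsub>A\<^esub> z = b \<otimes>\<^bsub>A\<^esub> z"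
proof -
  have z: "z \<in> carrier A" using assms by (simp add: ring_socle_iff)
  have "a \<oplus>\<^bsub>A\<^esub> \<ominus>\<^bsub>A\<^esub> b \<in> \<mm>" using assms by (simp add: mem_max K.r_neg)
  then have "(a \<oplus>\<^bsub>A\<^esub> \<ominus>\<^bsub>A\<^esub> b) \<otimes>\<^bsub>A\<^esub> z = \<zero>\<^bsub>A\<^esub>" using assms by (simp add: ring_socle_iff)
  then have "a \<otimes>\<^bsub>A\<^esub> z \<ominus>\<^bsub>A\<^esub> b \<otimes>\<^bsub>A\<^esub> z = \<zero>\<^bsub>A\<^esub>"
    using assms z by (simp add: E.R.l_distr E.R.l_minus E.R.minus_eq)
  then show ?thesis using assms z by (subst (asm) E.R.minus_eq_zero_iff) auto
qed

text \<open>An element that kills a nonzero \<open>z\<close> is not a unit, so it kills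
  \<open>\<iota> 1\<close>. Division by \<open>z\<close> then gives an \<open>e\<close> with
  \<open>z e = \<iota> 1\<close>, which is not 0.\<close>

lemma ring_socle_faithful:
  assumes z: "z \<in> ring_socle" and ann: "\<And>x. x \<in> carrier E \<Longrightarrow> z \<odot>\<^bsub>E\<^esub> x = \<zero>\<^bsub>E\<^esub>"
  shows "z = \<zero>\<^bsub>A\<^esub>"
proof (rule ccontr)
  assume nz: "z \<noteq> \<zero>\<^bsub>A\<^esub>"
  have zA: "z \<in> carrier A" using z by (simp add: ring_socle_iff)
  have "j \<odot>\<^bsub>E\<^esub> \<iota> \<one>\<^bsub>K\<^esub> = \<zero>\<^bsub>E\<^esub>" if j: "j \<in> carrier A" "j \<otimes>\<^bsub>A\<^esub> z = \<zero>\<^bsub>A\<^esub>" for j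
  proof -
    have "j \<in> \<mm>"
    proof (rule ccontr)
      assume "j \<notin> \<mm>"
      then obtain b where b: "b \<in> carrier A" "b \<otimes>\<^bsub>A\<^esub> j = \<one>\<^bsub>A\<^esub>" using Units_if_not_max j by auto
      have "z = (b \<otimes>\<^bsub>A\<^esub> j) \<otimes>\<^bsub>A\<^esub> z" using b zA by simp
      also have "\<dots> = b \<otimes>\<^bsub>A\<^esub> (j \<otimes>\<^bsub>A\<^esub> z)" using b j zA by (intro E.R.m_assoc)
      finally show False using j b nz by simp
    qed
    then show ?thesis using iota_socle[of "\<one>\<^bsub>K\<^esub>"] by (simp add: socle_def)
  qed
  then obtain e where e: "e \<in> carrier E" "\<And>j. j \<in> carrier A \<Longrightarrow> (j \<otimes>\<^bsub>A\<^esub> z) \<odot>\<^bsub>E\<^esub> e = j \<odot>\<^bsub>E\<^esub> \<iota> \<one>\<^bsub>K\<^esub>"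
    using injective_module_divide[OF injective E.R.oneideal zA, of "\<iota> \<one>\<^bsub>K\<^esub>"] by auto
  have "z \<odot>\<^bsub>E\<^esub> e = \<iota> \<one>\<^bsub>K\<^esub>" using e(2)[of "\<one>\<^bsub>A\<^esub>"] zA by simp
  then have "\<iota> \<one>\<^bsub>K\<^esub> = \<iota> \<zero>\<^bsub>K\<^esub>" using ann[OF e(1)] by simp
  then show False using iota_inj K.one_not_zero by (meson K.one_closed K.zero_closed inj_onD)
qed

text \<open>Matlis duality for \<open>soc A\<close>: its annihilator in \<open>E\<close> is \<open>\<mm> E\<close>.  Dividing by the elements of a
  finite set \<open>F \<subseteq> \<mm>\<close> with \<open>ann F = soc A\<close> one after the other, injectivity writes \<open>x\<close> as a
  combination of them.\<close>
lemma socle_orthogonal: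
  assumes N: "submodule A N E" and mN: "\<And>a e. a \<in> \<mm> \<Longrightarrow> e \<in> carrier E \<Longrightarrow> a \<odot>\<^bsub>E\<^esub> e \<in> N"
    and x: "x \<in> carrier E" and ann: "\<And>z. z \<in> ring_socle \<Longrightarrow> z \<odot>\<^bsub>E\<^esub> x = \<zero>\<^bsub>E\<^esub>"
  shows "x \<in> N"
proof -
  interpret SM: module A "self_module A" by (rule self_module)
  have "\<exists>F\<subseteq>\<mm>. finite F \<and> carrier A \<inter> annihilator A (self_module A) F = carrier A \<inter> ring_socle"
    unfolding ring_socle_def
    by (rule SM.annihilator_finite[OF artinian])
      (use max_subset E.R.oneideal in \<open>auto simp: self_module_def\<close>)
  then obtain F where F: "F \<subseteq> \<mm>" "finite F" "annihilator A (self_module A) F \<subseteq> ring_socle"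
    by (auto simp: annihilator_def)
  have "x \<in> N" if "finite F" "F \<subseteq> \<mm>" "x \<in> carrier E"
      "\<And>j. j \<in> annihilator A (self_module A) F \<Longrightarrow> j \<odot>\<^bsub>E\<^esub> x = \<zero>\<^bsub>E\<^esub>" for F x
    using that
  proof (induction F arbitrary: x rule: finite_induct)
    case empty
    have "\<one>\<^bsub>A\<^esub> \<odot>\<^bsub>E\<^esub> x = \<zero>\<^bsub>E\<^esub>" by (rule empty) (simp add: annihilator_def)
    then show ?case using empty submodule.zero_closed[OF N] by simp
  next
    case (insert a F)
    let ?J = "annihilator A (self_module A) F"
    have FA: "F \<subseteq> carrier A" and a: "a \<in> \<mm>" "a \<in> carrier A" using insert max_subset by auto
    have J: "ideal ?J A" by (rule SM.annihilator_ideal) (use FA in \<open>simp add: self_module_def\<close>)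
    have JA: "j \<in> carrier A" if "j \<in> ?J" for j using that by (simp add: annihilator_def)
    \<comment> \<open>If \<open>j\<close> kills \<open>F\<close> and \<open>j a = 0\<close>, then
      \<open>j\<close> kills all of \<open>insert a F\<close>, hence \<open>x\<close>; so
      \<open>x\<close> can be divided by \<open>a\<close> over the ideal \<open>?J\<close>. The
      remainder \<open>x - a e\<close> is killed by \<open>?J\<close>, which is what the induction
      hypothesis for \<open>F\<close> asks.\<close>
    have "\<exists>e\<in>carrier E. \<forall>j\<in>?J. (j \<otimes>\<^bsub>A\<^esub> a) \<odot>\<^bsub>E\<^esub> e = j \<odot>\<^bsub>E\<^esub> x"
      by (rule injective_module_divide[OF injective J a(2) insert.prems(2)])
        (rule insert.prems(3), auto simp: annihilator_def self_module_def)
    then obtain e where e: "e \<in> carrier E" "\<And>j. j \<in> ?J \<Longrightarrow> (j \<otimes>\<^bsub>A\<^esub> a) \<odot>\<^bsub>E\<^esub> e = j \<odot>\<^bsub>E\<^esub> x" by auto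
    have "x \<ominus>\<^bsub>E\<^esub> a \<odot>\<^bsub>E\<^esub> e \<in> N"
    proof (rule insert.IH)
      show "j \<odot>\<^bsub>E\<^esub> (x \<ominus>\<^bsub>E\<^esub> a \<odot>\<^bsub>E\<^esub> e) = \<zero>\<^bsub>E\<^esub>" if j: "j \<in> ?J" for j
        using e(2)[OF j] e(1) JA[OF j] a insert.prems(2)
        by (simp add: E.M.minus_eq E.smult_r_distr E.smult_r_minus E.smult_assoc1 E.M.r_neg)
    qed (use insert e a in auto)
    moreover have "a \<odot>\<^bsub>E\<^esub> e \<in> N" by (rule mN[OF a(1) e(1)])
    ultimately have "(x \<ominus>\<^bsub>E\<^esub> a \<odot>\<^bsub>E\<^esub> e) \<oplus>\<^bsub>E\<^esub> a \<odot>\<^bsub>E\<^esub> e \<in> N" by (rule submodule.m_closed[OF N])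
    then show ?case using e a insert.prems(2) by (simp add: E.M.minus_eq E.M.a_assoc E.M.l_neg)
  qed
  from this[OF F(2,1) x] F(3) ann show ?thesis by blast
qed

text \<open>\<open>s ` F\<close> is a basis of \<open>soc A\<close>, and \<open>F\<close> represents the dual basis of \<open>E / \<mm> E\<close> under the
  pairing \<open>(z, x) \<mapsto> z x\<close> into \<open>soc E = k\<close>.\<close>
definition dual_basis :: "'e set \<Rightarrow> ('e \<Rightarrow> 'a) \<Rightarrow> bool" where
  "dual_basis F s \<longleftrightarrow> finite F \<and> F \<subseteq> carrier E \<and> (\<forall>x\<in>F. s x \<in> ring_socle) \<and>
     (\<forall>x\<in>F. \<forall>y\<in>F. s x \<odot>\<^bsub>E\<^esub> y = (if y = x then \<iota> \<one>\<^bsub>K\<^esub> else \<zero>\<^bsub>E\<^esub>)) \<and>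
     (\<forall>z\<in>ring_socle. (\<forall>x\<in>F. z \<odot>\<^bsub>E\<^esub> x = \<zero>\<^bsub>E\<^esub>) \<longrightarrow> z = \<zero>\<^bsub>A\<^esub>)"

lemma dual_basisD:
  assumes "dual_basis F s"
  shows "finite F" "F \<subseteq> carrier E" "\<And>x. x \<in> F \<Longrightarrow> s x \<in> ring_socle"
    "\<And>x y. x \<in> F \<Longrightarrow> y \<in> F \<Longrightarrow> s x \<odot>\<^bsub>E\<^esub> y = (if y = x then \<iota> \<one>\<^bsub>K\<^esub> else \<zero>\<^bsub>E\<^esub>)"
    "\<And>z. z \<in> ring_socle \<Longrightarrow> (\<And>x. x \<in> F \<Longrightarrow> z \<odot>\<^bsub>E\<^esub> x = \<zero>\<^bsub>E\<^esub>) \<Longrightarrow> z = \<zero>\<^bsub>A\<^esub>"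
  using assms unfolding dual_basis_def by blast+

lemma dual_basis_exists: "\<exists>F s. dual_basis F s"
proof -
  \<comment> \<open>Take a finite subset of \<open>E\<close> of least size that separates \<open>soc A\<close>.\<close>
  define P where "P F \<longleftrightarrow> finite F \<and> F \<subseteq> carrier E \<and> ring_socle \<inter> annihilator A E F = {\<zero>\<^bsub>A\<^esub>}" for F
  have z0: "\<zero>\<^bsub>A\<^esub> \<in> ring_socle \<inter> annihilator A E F" if "F \<subseteq> carrier E" for F
    using that max_subset by (auto simp: ring_socle_iff annihilator_def)
  have "ring_socle \<inter> annihilator A E (carrier E) = {\<zero>\<^bsub>A\<^esub>}"
  proof (intro equalityI subsetI)
    fix z assume "z \<in> ring_socle \<inter> annihilator A E (carrier E)"
    then have "z = \<zero>\<^bsub>A\<^esub>" by (intro ring_socle_faithful) (simp_all add: annihilator_def)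
    then show "z \<in> {\<zero>\<^bsub>A\<^esub>}" by simp
  qed (use z0[of "carrier E"] in simp)
  \<comment> \<open>The finiteness lemma inside \<open>J = soc A\<close>, applied to all of
    \<open>E\<close>.\<close>
  then have "\<exists>F. P F"
    using E.annihilator_finite[OF artinian subset_refl ring_socle_ideal] unfolding P_def by auto
  then obtain F where F: "P F" and mn: "\<And>F'. card F' < card F \<Longrightarrow> \<not> P F'"
    using exists_least_iff[of "\<lambda>n. \<exists>F. P F \<and> card F = n"] by metis
  have fin: "finite F" and FE: "F \<subseteq> carrier E" using F by (auto simp: P_def)
  \<comment> \<open>By minimality some socle element kills \<open>F - {x}\<close> but not
    \<open>x\<close>; dividing it by the coordinate of its value at \<open>x\<close> gives the dual
    element.\<close>
  have "\<exists>z\<in>ring_socle. \<forall>y\<in>F. z \<odot>\<^bsub>E\<^esub> y = (if y = x then \<iota> \<one>\<^bsub>K\<^esub> else \<zero>\<^bsub>E\<^esub>)" if x: "x \<in> F" for x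
  proof -
    have "\<not> P (F - {x})" using card_Diff1_less[OF fin x] by (rule mn)
    then have "ring_socle \<inter> annihilator A E (F - {x}) \<noteq> {\<zero>\<^bsub>A\<^esub>}" using fin FE by (auto simp: P_def)
    then obtain z where z: "z \<in> ring_socle" "z \<in> annihilator A E (F - {x})" "z \<noteq> \<zero>\<^bsub>A\<^esub>"
      using z0[of "F - {x}"] FE by blast
    have zA: "z \<in> carrier A" and xE: "x \<in> carrier E" using z x FE by (auto simp: ring_socle_iff)
    have zs: "z \<odot>\<^bsub>E\<^esub> x \<in> socle" by (rule ring_socle_smult[OF z(1) xE])
    have "z \<odot>\<^bsub>E\<^esub> x \<noteq> \<zero>\<^bsub>E\<^esub>"
    proof
      assume "z \<odot>\<^bsub>E\<^esub> x = \<zero>\<^bsub>E\<^esub>"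
      then have "z \<in> ring_socle \<inter> annihilator A E F" using z by (auto simp: annihilator_def)
      moreover have "ring_socle \<inter> annihilator A E F = {\<zero>\<^bsub>A\<^esub>}" using F by (simp add: P_def)
      ultimately show False using z(3) by blast
    qed
    then have "coord (z \<odot>\<^bsub>E\<^esub> x) \<noteq> \<zero>\<^bsub>K\<^esub>" using iota_coord[OF zs] by auto
    then have u: "coord (z \<odot>\<^bsub>E\<^esub> x) \<in> Units K" using coord_closed[OF zs] K.field_Units by simp
    then obtain b where b: "b \<in> carrier A" "\<pi> b = inv\<^bsub>K\<^esub> coord (z \<odot>\<^bsub>E\<^esub> x)"
      using lift_exists K.Units_inv_closed by metis
    have "b \<odot>\<^bsub>E\<^esub> (z \<odot>\<^bsub>E\<^esub> x) = \<iota> (\<pi> b \<otimes>\<^bsub>K\<^esub> coord (z \<odot>\<^bsub>E\<^esub> x))"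
      using iota_smult[OF b(1) coord_closed[OF zs]] iota_coord[OF zs] by simp
    then have bz: "b \<odot>\<^bsub>E\<^esub> (z \<odot>\<^bsub>E\<^esub> x) = \<iota> \<one>\<^bsub>K\<^esub>" using b u by simp
    show ?thesis
    proof (intro bexI[of _ "b \<otimes>\<^bsub>A\<^esub> z"] ballI)
      show "b \<otimes>\<^bsub>A\<^esub> z \<in> ring_socle" using ideal.I_l_closed[OF ring_socle_ideal z(1) b(1)] .
      fix y assume y: "y \<in> F"
      then have yE: "y \<in> carrier E" using FE by auto
      have "(b \<otimes>\<^bsub>A\<^esub> z) \<odot>\<^bsub>E\<^esub> y = b \<odot>\<^bsub>E\<^esub> (z \<odot>\<^bsub>E\<^esub> y)" using b zA yE by (simp add: E.smult_assoc1)
      then show "(b \<otimes>\<^bsub>A\<^esub> z) \<odot>\<^bsub>E\<^esub> y = (if y = x then \<iota> \<one>\<^bsub>K\<^esub> else \<zero>\<^bsub>E\<^esub>)"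
        using bz z(2) y b by (auto simp: annihilator_def)
    qed
  qed
  then obtain s where s: "\<And>x. x \<in> F \<Longrightarrow> s x \<in> ring_socle"
    "\<And>x y. x \<in> F \<Longrightarrow> y \<in> F \<Longrightarrow> s x \<odot>\<^bsub>E\<^esub> y = (if y = x then \<iota> \<one>\<^bsub>K\<^esub> else \<zero>\<^bsub>E\<^esub>)" by metis
  have "z = \<zero>\<^bsub>A\<^esub>" if "z \<in> ring_socle" "\<forall>x\<in>F. z \<odot>\<^bsub>E\<^esub> x = \<zero>\<^bsub>E\<^esub>" for z
  proof -
    have "z \<in> ring_socle \<inter> annihilator A E F" using that by (simp add: annihilator_def ring_socle_iff)
    moreover have "ring_socle \<inter> annihilator A E F = {\<zero>\<^bsub>A\<^esub>}" using F by (simp add: P_def)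
    ultimately show ?thesis by blast
  qed
  then have "dual_basis F s" using fin FE s unfolding dual_basis_def by blast
  then show ?thesis by blast
qed

text \<open>Scalars act on the source. That \<open>f (c x)\<close> is again \<open>A\<close>-linear
  in \<open>x\<close> comes from commutativity of \<open>K\<close>, and additivity in
  \<open>c\<close> from additivity of \<open>f\<close>.\<close>

lemma residue_Hom_space_is_vectorspace: "vectorspace K (residue_Hom_space A K \<pi>)"
proof -
  let ?H = "Hom_module A (residue_module K \<pi>) (self_module A)" and ?V = "residue_Hom_space A K \<pi>"
  have KM: "module A (residue_module K \<pi>)"
    unfolding residue_module_def
    by (rule restrict_scalars_is_module[OF E.R.cring_axioms pi_hom self_module_is_module]) (rule K.cring_axioms)
  interpret H: module A ?H by (rule Hom_module_is_module[OF KM self_module])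
  have hom: "f c \<in> carrier A" "f (c \<oplus>\<^bsub>K\<^esub> d) = f c \<oplus>\<^bsub>A\<^esub> f d" "f (\<pi> a \<otimes>\<^bsub>K\<^esub> c) = a \<otimes>\<^bsub>A\<^esub> f c"
    if "f \<in> carrier ?V" "c \<in> carrier K" "d \<in> carrier K" "a \<in> carrier A" for f a c d
    using that by (auto simp: residue_Hom_space_def Let_def Hom_module_def module_hom_def module_constr_simps Pi_iff)
  have homI: "(\<lambda>x\<in>carrier K. f (c \<otimes>\<^bsub>K\<^esub> x)) \<in> carrier ?V" if f: "f \<in> carrier ?V" and c: "c \<in> carrier K" for f c
  proof -
    have "(\<lambda>x\<in>carrier K. f (c \<otimes>\<^bsub>K\<^esub> x)) \<in> module_hom A (residue_module K \<pi>) (self_module A)"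
    proof (rule module_homI)
      fix a x assume ax: "a \<in> carrier A" "x \<in> carrier (residue_module K \<pi>)"
      then have x: "x \<in> carrier K" by (simp add: module_constr_simps)
      have "c \<otimes>\<^bsub>K\<^esub> (\<pi> a \<otimes>\<^bsub>K\<^esub> x) = \<pi> a \<otimes>\<^bsub>K\<^esub> (c \<otimes>\<^bsub>K\<^esub> x)" using c ax x by (simp add: K.m_lcomm)
      then show "(\<lambda>x\<in>carrier K. f (c \<otimes>\<^bsub>K\<^esub> x)) (a \<odot>\<^bsub>residue_module K \<pi>\<^esub> x) =
          a \<odot>\<^bsub>self_module A\<^esub> (\<lambda>x\<in>carrier K. f (c \<otimes>\<^bsub>K\<^esub> x)) x"
        using hom(3)[OF f _ _ ax(1), of "c \<otimes>\<^bsub>K\<^esub> x" "\<zero>\<^bsub>K\<^esub>"] ax x c by (simp add: module_constr_simps)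
    qed (use hom[OF f _ _ E.R.zero_closed] c in \<open>auto simp: module_constr_simps K.r_distr\<close>)
    then show ?thesis by (simp add: residue_Hom_space_def Let_def Hom_module_def module_constr_simps)
  qed
  have "module K ?V"
  proof (rule moduleI)
    have "\<exists>g\<in>carrier ?H. g \<oplus>\<^bsub>?H\<^esub> f = \<zero>\<^bsub>?H\<^esub>" if "f \<in> carrier ?H" for f
      using that by (intro bexI[of _ "\<ominus>\<^bsub>?H\<^esub> f"]) (auto simp: H.M.l_neg)
    then show "abelian_group ?V"
      by (intro abelian_groupI) (auto simp: residue_Hom_space_def Let_def H.M.a_ac)
    show "cring K" by (rule K.cring_axioms)
    fix f g assume f: "f \<in> carrier ?V" and g: "g \<in> carrier ?V"
    note fh = hom[OF f _ _ E.R.zero_closed] and gh = hom[OF g _ _ E.R.zero_closed]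
    have f_ext: "f \<in> extensional (carrier K)"
      using f by (auto simp: residue_Hom_space_def Let_def Hom_module_def module_constr_simps)
    show "\<one>\<^bsub>K\<^esub> \<odot>\<^bsub>?V\<^esub> f = f"
      using f_ext by (intro extensionalityI[of _ "carrier K"]) (auto simp: residue_Hom_space_def Let_def)
    fix c assume c: "c \<in> carrier K"
    show "c \<odot>\<^bsub>?V\<^esub> f \<in> carrier ?V" using homI[OF f c] by (simp add: residue_Hom_space_def Let_def)
    show "c \<odot>\<^bsub>?V\<^esub> (f \<oplus>\<^bsub>?V\<^esub> g) = c \<odot>\<^bsub>?V\<^esub> f \<oplus>\<^bsub>?V\<^esub> c \<odot>\<^bsub>?V\<^esub> g"
      using c by (intro ext) (simp add: residue_Hom_space_def Let_def Hom_module_def module_constr_simps)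
    fix d assume d: "d \<in> carrier K"
    show "(c \<oplus>\<^bsub>K\<^esub> d) \<odot>\<^bsub>?V\<^esub> f = c \<odot>\<^bsub>?V\<^esub> f \<oplus>\<^bsub>?V\<^esub> d \<odot>\<^bsub>?V\<^esub> f"
      using c d fh by (intro ext) (simp add: residue_Hom_space_def Let_def Hom_module_def module_constr_simps K.l_distr)
    show "(c \<otimes>\<^bsub>K\<^esub> d) \<odot>\<^bsub>?V\<^esub> f = c \<odot>\<^bsub>?V\<^esub> (d \<odot>\<^bsub>?V\<^esub> f)"
      using c d by (intro ext) (simp add: residue_Hom_space_def Let_def K.m_ac)
  qed
  then show ?thesis by (simp add: vectorspace_def K.field_axioms)
qed

lemma coord_module_hom:
  assumes z: "\<And>i. i \<in> I \<Longrightarrow> z i \<in> ring_socle"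
  shows "(\<lambda>x. \<lambda>i\<in>I. coord (z i \<odot>\<^bsub>E\<^esub> x)) \<in> module_hom A E (restrict_scalars \<pi> (ring.func_space K I))"
proof (rule module_homI)
  have zA: "z i \<in> carrier A" if "i \<in> I" for i using z[OF that] by (simp add: ring_socle_iff)
  fix x assume x: "x \<in> carrier E"
  show "(\<lambda>i\<in>I. coord (z i \<odot>\<^bsub>E\<^esub> x)) \<in> carrier (restrict_scalars \<pi> (ring.func_space K I))"
    using ring_socle_smult[OF z x] by (simp add: restrict_scalars_def K.func_space_def)
  show "(\<lambda>i\<in>I. coord (z i \<odot>\<^bsub>E\<^esub> (x \<oplus>\<^bsub>E\<^esub> y))) =
      (\<lambda>i\<in>I. coord (z i \<odot>\<^bsub>E\<^esub> x)) \<oplus>\<^bsub>restrict_scalars \<pi> (ring.func_space K I)\<^esub> (\<lambda>i\<in>I. coord (z i \<odot>\<^bsub>E\<^esub> y))"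
    if y: "y \<in> carrier E" for y
    using x y zA ring_socle_smult[OF z x] ring_socle_smult[OF z y]
    by (intro ext) (simp add: restrict_scalars_def K.func_space_def E.smult_r_distr coord_add)
  fix a assume a: "a \<in> carrier A"
  have "z i \<odot>\<^bsub>E\<^esub> (a \<odot>\<^bsub>E\<^esub> x) = a \<odot>\<^bsub>E\<^esub> (z i \<odot>\<^bsub>E\<^esub> x)" if "i \<in> I" for i
    using zA[OF that] a x by (simp add: E.smult_assoc1[symmetric] E.R.m_comm)
  then show "(\<lambda>i\<in>I. coord (z i \<odot>\<^bsub>E\<^esub> (a \<odot>\<^bsub>E\<^esub> x))) =
      a \<odot>\<^bsub>restrict_scalars \<pi> (ring.func_space K I)\<^esub> (\<lambda>i\<in>I. coord (z i \<odot>\<^bsub>E\<^esub> x))"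
    using a ring_socle_smult[OF z x]
    by (intro ext) (simp add: restrict_scalars_def K.func_space_def coord_smult)
qed

text \<open>Evaluation at \<open>\<one>\<close> identifies \<open>Hom(k, A)\<close> with
  \<open>soc A\<close>, on which pairing with the elements of \<open>F\<close> gives coordinates:
  separation makes them injective, and \<open>s\<close> provides the unit vectors.\<close>

lemma ring_type_eq_card:
  assumes basis: "dual_basis F s"
  shows "ring_type A K \<pi> = card F"
proof -
  note F = dual_basisD(1,2)[OF basis] and s = dual_basisD(3)[OF basis] and dual = dual_basisD(4)[OF basis]
    and sep = dual_basisD(5)[OF basis]
  let ?V = "residue_Hom_space A K \<pi>"
  interpret V: vectorspace K ?V by (rule residue_Hom_space_is_vectorspace)
  have mV: "module K ?V" and mF: "module K (K.func_space F)"
    using V.module_axioms K.func_space_is_module by auto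
  have hom: "f c \<in> carrier A" "f (c \<oplus>\<^bsub>K\<^esub> d) = f c \<oplus>\<^bsub>A\<^esub> f d" "f (\<pi> a \<otimes>\<^bsub>K\<^esub> c) = a \<otimes>\<^bsub>A\<^esub> f c"
    if "f \<in> carrier ?V" "c \<in> carrier K" "d \<in> carrier K" "a \<in> carrier A" for f a c d
    using that by (auto simp: residue_Hom_space_def Let_def Hom_module_def module_hom_def module_constr_simps Pi_iff)
  have f_one: "f (\<pi> a) = a \<otimes>\<^bsub>A\<^esub> f \<one>\<^bsub>K\<^esub>" if "f \<in> carrier ?V" "a \<in> carrier A" for f a
    using hom(3)[OF that(1) K.one_closed K.one_closed that(2)] that by simp
  have soc: "f \<one>\<^bsub>K\<^esub> \<in> ring_socle" if f: "f \<in> carrier ?V" for f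
  proof -
    have "a \<otimes>\<^bsub>A\<^esub> f \<one>\<^bsub>K\<^esub> = \<zero>\<^bsub>A\<^esub>" if a: "a \<in> \<mm>" for a
    proof -
      have "a \<otimes>\<^bsub>A\<^esub> f \<one>\<^bsub>K\<^esub> = \<zero>\<^bsub>A\<^esub> \<otimes>\<^bsub>A\<^esub> f \<one>\<^bsub>K\<^esub>"
        using f_one[OF f, of a] f_one[OF f, of "\<zero>\<^bsub>A\<^esub>"] a by (simp add: mem_max)
      then show ?thesis using hom(1)[OF f K.one_closed K.one_closed E.R.zero_closed] by simp
    qed
    then show ?thesis using hom(1)[OF f K.one_closed K.one_closed E.R.zero_closed] by (simp add: ring_socle_iff)
  qed
  have sA: "s x \<in> carrier A" if "x \<in> F" for x using s[OF that] by (simp add: ring_socle_iff)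
  obtain l where l: "\<And>c. c \<in> carrier K \<Longrightarrow> l c \<in> carrier A" "\<And>c. c \<in> carrier K \<Longrightarrow> \<pi> (l c) = c"
    using lift_exists by metis
  \<comment> \<open>The homomorphism with value \<open>s x\<close> at \<open>\<one>\<close>; since
    \<open>s x\<close> is a socle element, the choice of the lift \<open>l c\<close> has no
    effect.\<close>
  define v where "v x = (\<lambda>c\<in>carrier K. l c \<otimes>\<^bsub>A\<^esub> s x)" for x
  define T where "T f = (\<lambda>x\<in>F. coord (f \<one>\<^bsub>K\<^esub> \<odot>\<^bsub>E\<^esub> x))" for f :: "'k \<Rightarrow> 'a"
  have in_soc: "f \<one>\<^bsub>K\<^esub> \<odot>\<^bsub>E\<^esub> x \<in> socle" if "f \<in> carrier ?V" "x \<in> F" for f x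
    using ring_socle_smult[OF soc[OF that(1)]] that(2) F(2) by auto
  have T: "T \<in> module_hom K ?V (K.func_space F)"
  proof (rule module_homI)
    fix f assume f: "f \<in> carrier ?V"
    show "T f \<in> carrier (K.func_space F)" using in_soc[OF f] by (auto simp: T_def K.func_space_def)
    show "T (f \<oplus>\<^bsub>?V\<^esub> g) = T f \<oplus>\<^bsub>K.func_space F\<^esub> T g" if g: "g \<in> carrier ?V" for g
    proof
      fix x
      have "(f \<oplus>\<^bsub>?V\<^esub> g) \<one>\<^bsub>K\<^esub> = f \<one>\<^bsub>K\<^esub> \<oplus>\<^bsub>A\<^esub> g \<one>\<^bsub>K\<^esub>"
        by (simp add: residue_Hom_space_def Let_def Hom_module_def module_constr_simps)
      then show "T (f \<oplus>\<^bsub>?V\<^esub> g) x = (T f \<oplus>\<^bsub>K.func_space F\<^esub> T g) x"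
        using F(2) in_soc[OF f, of x] in_soc[OF g, of x] hom(1)[OF f K.one_closed K.one_closed E.R.zero_closed]
          hom(1)[OF g K.one_closed K.one_closed E.R.zero_closed]
        by (auto simp: T_def K.func_space_def E.smult_l_distr coord_add subset_iff)
    qed
    show "T (c \<odot>\<^bsub>?V\<^esub> f) = c \<odot>\<^bsub>K.func_space F\<^esub> T f" if c: "c \<in> carrier K" for c
    proof
      fix x
      have "(c \<odot>\<^bsub>?V\<^esub> f) \<one>\<^bsub>K\<^esub> = l c \<otimes>\<^bsub>A\<^esub> f \<one>\<^bsub>K\<^esub>"
        using f_one[OF f l(1)[OF c]] c l by (simp add: residue_Hom_space_def Let_def)
      then show "T (c \<odot>\<^bsub>?V\<^esub> f) x = (c \<odot>\<^bsub>K.func_space F\<^esub> T f) x"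
        using F(2) in_soc[OF f, of x] hom(1)[OF f K.one_closed K.one_closed E.R.zero_closed] l c
        by (auto simp: T_def K.func_space_def E.smult_assoc1 coord_smult subset_iff)
    qed
  qed
  have inj: "inj_on T (carrier ?V)"
  proof (rule module_hom_inj_onI[OF mV mF T])
    fix f assume f: "f \<in> carrier ?V" and "T f = \<zero>\<^bsub>K.func_space F\<^esub>"
    then have Tz: "T f x = \<zero>\<^bsub>K\<^esub>" if "x \<in> F" for x using that by (simp add: K.func_space_def)
    have "f \<one>\<^bsub>K\<^esub> \<odot>\<^bsub>E\<^esub> x = \<zero>\<^bsub>E\<^esub>" if "x \<in> F" for x
      using Tz[OF that] that iota_coord[OF in_soc[OF f that]] by (simp add: T_def)
    then have f1: "f \<one>\<^bsub>K\<^esub> = \<zero>\<^bsub>A\<^esub>" by (rule sep[OF soc[OF f]])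
    have "f c = \<zero>\<^bsub>A\<^esub>" if "c \<in> carrier K" for c
      using f_one[OF f l(1)[OF that]] l that f1 by simp
    moreover have "f \<in> extensional (carrier K)"
      using f by (auto simp: residue_Hom_space_def Let_def Hom_module_def module_constr_simps)
    ultimately show "f = \<zero>\<^bsub>?V\<^esub>"
      by (intro extensionalityI[of _ "carrier K"])
        (auto simp: residue_Hom_space_def Let_def Hom_module_def module_constr_simps)
  qed
  have v: "v x \<in> carrier ?V" if x: "x \<in> F" for x
  proof -
    have "v x \<in> module_hom A (residue_module K \<pi>) (self_module A)"
    proof (rule module_homI)
      fix c assume "c \<in> carrier (residue_module K \<pi>)"
      then have c: "c \<in> carrier K" by (simp add: module_constr_simps)
      show "v x c \<in> carrier (self_module A)" using c l sA[OF x] by (simp add: v_def module_constr_simps)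
      show "v x (c \<oplus>\<^bsub>residue_module K \<pi>\<^esub> d) = v x c \<oplus>\<^bsub>self_module A\<^esub> v x d"
        if "d \<in> carrier (residue_module K \<pi>)" for d
      proof -
        have d: "d \<in> carrier K" using that by (simp add: module_constr_simps)
        have "l (c \<oplus>\<^bsub>K\<^esub> d) \<otimes>\<^bsub>A\<^esub> s x = (l c \<oplus>\<^bsub>A\<^esub> l d) \<otimes>\<^bsub>A\<^esub> s x"
          using c d l s[OF x] by (intro ring_socle_mult_eq) auto
        then show ?thesis using c d l sA[OF x] by (simp add: v_def module_constr_simps E.R.l_distr)
      qed
      fix a assume a: "a \<in> carrier A"
      have "l (\<pi> a \<otimes>\<^bsub>K\<^esub> c) \<otimes>\<^bsub>A\<^esub> s x = (a \<otimes>\<^bsub>A\<^esub> l c) \<otimes>\<^bsub>A\<^esub> s x"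
        using c a l s[OF x] by (intro ring_socle_mult_eq) auto
      then show "v x (a \<odot>\<^bsub>residue_module K \<pi>\<^esub> c) = a \<odot>\<^bsub>self_module A\<^esub> v x c"
        using c a l sA[OF x] by (simp add: v_def module_constr_simps E.R.m_assoc)
    qed
    then show ?thesis by (simp add: residue_Hom_space_def Let_def Hom_module_def module_constr_simps v_def)
  qed
  have "V.dim = card F"
  proof (rule V.dim_eq_card[OF F(1) T inj v])
    fix x assume x: "x \<in> F"
    have "v x \<one>\<^bsub>K\<^esub> = s x"
      using ring_socle_mult_eq[OF l(1)[OF K.one_closed] E.R.one_closed _ s[OF x]] l sA[OF x] by (simp add: v_def)
    then show "T (v x) = (\<lambda>y\<in>F. if y = x then \<one>\<^bsub>K\<^esub> else \<zero>\<^bsub>K\<^esub>)"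
      using dual[OF x] by (intro ext) (simp add: T_def)
  qed
  then show ?thesis by (simp add: ring_type_def)
qed

text \<open>A form of Nakayama's lemma: modulo \<open>\<mm> E\<close>, the set \<open>F\<close>
  generates \<open>E\<close>. Some \<open>n\<close> in \<open>N\<close> has the same pairings with
  all \<open>s x\<close> as a given \<open>e\<close>; then all of \<open>soc A\<close> kills
  \<open>e - n\<close>, and \<open>socle_orthogonal\<close> puts this difference into
  \<open>N\<close>.\<close>

lemma generated_by_dual_basis:
  assumes basis: "dual_basis F s"
    and N: "submodule A N E" and mN: "\<And>a e. a \<in> \<mm> \<Longrightarrow> e \<in> carrier E \<Longrightarrow> a \<odot>\<^bsub>E\<^esub> e \<in> N"
    and FN: "F \<subseteq> N"
  shows "N = carrier E"
proof
  note F = dual_basisD(1,2)[OF basis] and s = dual_basisD(3)[OF basis] and dual = dual_basisD(4)[OF basis]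
    and sep = dual_basisD(5)[OF basis]
  show NE: "N \<subseteq> carrier E" using N by (simp add: submodule_def)
  have zE: "z \<in> carrier A" if "z \<in> ring_socle" for z using that by (simp add: ring_socle_iff)
  \<comment> \<open>The elements \<open>s x\<close> span \<open>soc A\<close>: the socle elements
    killing \<open>e\<close> already realize every coordinate vector on \<open>F\<close>, and by
    \<open>sep\<close> a socle element is determined by its coordinates.\<close>
  have soc0: "z \<odot>\<^bsub>E\<^esub> e = \<zero>\<^bsub>E\<^esub>"
    if e: "e \<in> carrier E" "\<And>x. x \<in> F \<Longrightarrow> s x \<odot>\<^bsub>E\<^esub> e = \<zero>\<^bsub>E\<^esub>" and z: "z \<in> ring_socle" for e z
  proof -
    define \<tau> where "\<tau> z = (\<lambda>x\<in>F. coord (z \<odot>\<^bsub>E\<^esub> x))" for z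
    let ?U = "\<tau> ` {z \<in> ring_socle. z \<odot>\<^bsub>E\<^esub> e = \<zero>\<^bsub>E\<^esub>}"
    have soc: "z \<odot>\<^bsub>E\<^esub> x \<in> socle" if "z \<in> ring_socle" "x \<in> F" for z x
      using ring_socle_smult that F(2) by auto
    have tau_add: "\<tau> (y \<oplus>\<^bsub>A\<^esub> z) = \<tau> y \<oplus>\<^bsub>K.func_space F\<^esub> \<tau> z" if "y \<in> ring_socle" "z \<in> ring_socle" for y z
      using that soc zE F(2) by (auto simp: \<tau>_def K.func_space_def E.smult_l_distr coord_add subset_iff)
    have tau_mult: "\<tau> (a \<otimes>\<^bsub>A\<^esub> z) = \<pi> a \<odot>\<^bsub>K.func_space F\<^esub> \<tau> z" if "a \<in> carrier A" "z \<in> ring_socle" for a z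
      using that soc zE F(2) by (auto simp: \<tau>_def K.func_space_def E.smult_assoc1 coord_smult subset_iff)
    have zero: "\<zero>\<^bsub>A\<^esub> \<in> ring_socle" using max_subset by (auto simp: ring_socle_iff)
    have "?U = F \<rightarrow>\<^sub>E carrier K"
    proof (rule K.func_space_generated[OF F(1)])
      show "?U \<subseteq> F \<rightarrow>\<^sub>E carrier K" using soc by (auto simp: \<tau>_def)
      show "\<zero>\<^bsub>K.func_space F\<^esub> \<in> ?U"
        using zero e F(2) by (intro image_eqI[of _ _ "\<zero>\<^bsub>A\<^esub>"]) (auto simp: \<tau>_def K.func_space_def subset_iff)
      show "u \<oplus>\<^bsub>K.func_space F\<^esub> v \<in> ?U" if uv: "u \<in> ?U" "v \<in> ?U" for u v
      proof -
        from uv obtain y z where yz: "y \<in> ring_socle" "y \<odot>\<^bsub>E\<^esub> e = \<zero>\<^bsub>E\<^esub>" "u = \<tau> y"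
          "z \<in> ring_socle" "z \<odot>\<^bsub>E\<^esub> e = \<zero>\<^bsub>E\<^esub>" "v = \<tau> z" by auto
        then show ?thesis using e zE tau_add
          by (intro image_eqI[of _ _ "y \<oplus>\<^bsub>A\<^esub> z"])
            (auto simp: E.smult_l_distr intro: additive_subgroup.a_closed[OF ideal.axioms(1)[OF ring_socle_ideal]])
      qed
      show "c \<odot>\<^bsub>K.func_space F\<^esub> u \<in> ?U" if c: "c \<in> carrier K" and u: "u \<in> ?U" for c u
      proof -
        from u obtain z where z: "z \<in> ring_socle" "z \<odot>\<^bsub>E\<^esub> e = \<zero>\<^bsub>E\<^esub>" "u = \<tau> z" by auto
        obtain a where a: "a \<in> carrier A" "\<pi> a = c" using lift_exists c by auto
        show ?thesis using z a e zE tau_mult[OF a(1) z(1)] ideal.I_l_closed[OF ring_socle_ideal z(1) a(1)]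
          by (intro image_eqI[of _ _ "a \<otimes>\<^bsub>A\<^esub> z"]) (auto simp: E.smult_assoc1)
      qed
      show "(\<lambda>y\<in>F. if y = x then \<one>\<^bsub>K\<^esub> else \<zero>\<^bsub>K\<^esub>) \<in> ?U" if x: "x \<in> F" for x
        using s[OF x] e(2)[OF x] dual[OF x] by (intro image_eqI[of _ _ "s x"]) (auto simp: \<tau>_def fun_eq_iff)
    qed
    moreover have "\<tau> z \<in> F \<rightarrow>\<^sub>E carrier K" using soc[OF z] by (auto simp: \<tau>_def)
    ultimately have "\<tau> z \<in> ?U" by simp
    then obtain y where y: "y \<in> ring_socle" "y \<odot>\<^bsub>E\<^esub> e = \<zero>\<^bsub>E\<^esub>" "\<tau> z = \<tau> y" by blast
    have "z \<oplus>\<^bsub>A\<^esub> \<ominus>\<^bsub>A\<^esub> y = \<zero>\<^bsub>A\<^esub>"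
    proof (rule sep)
      show "z \<oplus>\<^bsub>A\<^esub> \<ominus>\<^bsub>A\<^esub> y \<in> ring_socle"
        using z y(1) additive_subgroup.a_closed[OF ideal.axioms(1)[OF ring_socle_ideal]]
          additive_subgroup.a_inv_closed[OF ideal.axioms(1)[OF ring_socle_ideal]] by blast
      fix x assume x: "x \<in> F"
      have "coord (z \<odot>\<^bsub>E\<^esub> x) = coord (y \<odot>\<^bsub>E\<^esub> x)" using fun_cong[OF y(3), of x] x by (simp add: \<tau>_def)
      then have "z \<odot>\<^bsub>E\<^esub> x = y \<odot>\<^bsub>E\<^esub> x" by (rule coord_inj[OF soc[OF z x] soc[OF y(1) x]])
      then show "(z \<oplus>\<^bsub>A\<^esub> \<ominus>\<^bsub>A\<^esub> y) \<odot>\<^bsub>E\<^esub> x = \<zero>\<^bsub>E\<^esub>"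
        using zE[OF z] zE[OF y(1)] F(2) x by (auto simp: E.smult_l_distr E.smult_l_minus E.M.r_neg subset_iff)
    qed
    then have "z = y" using zE[OF z] zE[OF y(1)] E.R.minus_eq_zero_iff[of z y] by (simp add: E.R.minus_eq)
    then show ?thesis using y by simp
  qed
  define \<gamma> where "\<gamma> e = (\<lambda>x\<in>F. coord (s x \<odot>\<^bsub>E\<^esub> e))" for e
  have \<gamma>: "\<gamma> \<in> module_hom A E (restrict_scalars \<pi> (K.func_space F))"
    using coord_module_hom[of F s] s unfolding \<gamma>_def by simp
  have g_add: "\<gamma> (x \<oplus>\<^bsub>E\<^esub> y) = \<gamma> x \<oplus>\<^bsub>K.func_space F\<^esub> \<gamma> y" if "x \<in> carrier E" "y \<in> carrier E" for x y
    using module_hom_add[OF \<gamma> that] by (simp add: restrict_scalars_def)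
  have g_smult: "\<gamma> (a \<odot>\<^bsub>E\<^esub> x) = \<pi> a \<odot>\<^bsub>K.func_space F\<^esub> \<gamma> x" if "a \<in> carrier A" "x \<in> carrier E" for a x
    using module_hom_smult[OF \<gamma> that] by (simp add: restrict_scalars_def)
  have g_closed: "\<gamma> x \<in> F \<rightarrow>\<^sub>E carrier K" if "x \<in> carrier E" for x
    using module_hom_mem[OF \<gamma> that] by (simp add: restrict_scalars_def K.func_space_def)
  \<comment> \<open>\<open>F\<close> lies in \<open>N\<close>, and the coordinates of its elements
    are the unit vectors.\<close>
  have img: "\<gamma> ` N = F \<rightarrow>\<^sub>E carrier K"
  proof (rule K.func_space_generated[OF F(1)])
    show "\<gamma> ` N \<subseteq> F \<rightarrow>\<^sub>E carrier K" using g_closed NE by auto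
    show "\<zero>\<^bsub>K.func_space F\<^esub> \<in> \<gamma> ` N"
      using submodule.zero_closed[OF N] s zE
      by (intro image_eqI[of _ _ "\<zero>\<^bsub>E\<^esub>"]) (auto simp: \<gamma>_def K.func_space_def)
    show "u \<oplus>\<^bsub>K.func_space F\<^esub> v \<in> \<gamma> ` N" if uv: "u \<in> \<gamma> ` N" "v \<in> \<gamma> ` N" for u v
    proof -
      from uv obtain x y where xy: "x \<in> N" "y \<in> N" "u = \<gamma> x" "v = \<gamma> y" by auto
      then have "\<gamma> (x \<oplus>\<^bsub>E\<^esub> y) = u \<oplus>\<^bsub>K.func_space F\<^esub> v" using g_add NE by auto
      then show ?thesis using submodule.m_closed[OF N xy(1,2)] by (metis image_eqI)
    qed
    show "c \<odot>\<^bsub>K.func_space F\<^esub> u \<in> \<gamma> ` N" if c: "c \<in> carrier K" and u: "u \<in> \<gamma> ` N" for c u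
    proof -
      from u obtain x where x: "x \<in> N" "u = \<gamma> x" by auto
      obtain a where a: "a \<in> carrier A" "\<pi> a = c" using lift_exists c by auto
      show ?thesis using x a g_smult[of a x] NE submodule.smult_closed[OF N, of a x]
        by (intro image_eqI[of _ _ "a \<odot>\<^bsub>E\<^esub> x"]) auto
    qed
    show "(\<lambda>y\<in>F. if y = x then \<one>\<^bsub>K\<^esub> else \<zero>\<^bsub>K\<^esub>) \<in> \<gamma> ` N" if x: "x \<in> F" for x
      using FN dual[OF _ x] x by (intro image_eqI[of _ _ x]) (auto simp: \<gamma>_def fun_eq_iff)
  qed
  show "carrier E \<subseteq> N"
  proof
    fix e assume e: "e \<in> carrier E"
    have "\<gamma> e \<in> \<gamma> ` N" using g_closed[OF e] img by simp
    then obtain n where n: "n \<in> N" "\<gamma> e = \<gamma> n" by blast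
    have nE: "n \<in> carrier E" using n NE by auto
    have "e \<oplus>\<^bsub>E\<^esub> \<ominus>\<^bsub>E\<^esub> n \<in> N"
    proof (rule socle_orthogonal[OF N mN])
      show "e \<oplus>\<^bsub>E\<^esub> \<ominus>\<^bsub>E\<^esub> n \<in> carrier E" using e nE by simp
      fix z assume z: "z \<in> ring_socle"
      show "z \<odot>\<^bsub>E\<^esub> (e \<oplus>\<^bsub>E\<^esub> \<ominus>\<^bsub>E\<^esub> n) = \<zero>\<^bsub>E\<^esub>"
      proof (rule soc0[OF _ _ z])
        show "e \<oplus>\<^bsub>E\<^esub> \<ominus>\<^bsub>E\<^esub> n \<in> carrier E" using e nE by simp
        fix x assume x: "x \<in> F"
        have "coord (s x \<odot>\<^bsub>E\<^esub> e) = coord (s x \<odot>\<^bsub>E\<^esub> n)" using fun_cong[OF n(2), of x] x by (simp add: \<gamma>_def)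
        then have "s x \<odot>\<^bsub>E\<^esub> e = s x \<odot>\<^bsub>E\<^esub> n"
          by (rule coord_inj[OF ring_socle_smult[OF s[OF x] e] ring_socle_smult[OF s[OF x] nE]])
        then show "s x \<odot>\<^bsub>E\<^esub> (e \<oplus>\<^bsub>E\<^esub> \<ominus>\<^bsub>E\<^esub> n) = \<zero>\<^bsub>E\<^esub>"
          using e nE zE[OF s[OF x]] by (simp add: E.smult_r_distr E.smult_r_minus E.M.r_neg)
      qed
    qed
    then have "(e \<oplus>\<^bsub>E\<^esub> \<ominus>\<^bsub>E\<^esub> n) \<oplus>\<^bsub>E\<^esub> n \<in> N" using n(1) by (rule submodule.m_closed[OF N])
    then show "e \<in> N" using e nE by (simp add: E.M.a_assoc E.M.l_neg)
  qed
qed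

end

section \<open>Consequences of failing to be Gorenstein\<close>

locale nongorenstein_envelope = local_envelope +
  assumes nongorenstein: "\<not> gorenstein A"
begin

lemma no_retract:
  assumes "i \<in> module_hom A (self_module A) E" "g \<in> module_hom A E (self_module A)"
  shows "\<exists>a\<in>carrier A. g (i a) \<noteq> a"
  using gorenstein_if_retract[OF E.R.cring_axioms injective assms] nongorenstein by blast

text \<open>If \<open>g x\<close> had an inverse \<open>b\<close>, the map sending \<open>a\<close>
  to \<open>a b x\<close> would be a section of \<open>g\<close> and make \<open>A\<close> a retract
  of \<open>E\<close>.\<close>

lemma hom_into_max:
  assumes g: "g \<in> module_hom A E (self_module A)" and x: "x \<in> carrier E"
  shows "g x \<in> \<mm>"
proof (rule ccontr)
  assume no: "g x \<notin> \<mm>"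
  have gx: "g x \<in> carrier A" using module_hom_mem[OF g x] by (simp add: self_module_def)
  then obtain b where b: "b \<in> carrier A" "b \<otimes>\<^bsub>A\<^esub> g x = \<one>\<^bsub>A\<^esub>" using Units_if_not_max no by auto
  have "(\<lambda>a. (a \<otimes>\<^bsub>A\<^esub> b) \<odot>\<^bsub>E\<^esub> x) \<in> module_hom A (self_module A) E"
    using b x by (auto simp: module_hom_def self_module_def E.R.l_distr E.smult_l_distr E.smult_assoc1)
  then obtain a where a: "a \<in> carrier A" "g ((a \<otimes>\<^bsub>A\<^esub> b) \<odot>\<^bsub>E\<^esub> x) \<noteq> a" using no_retract g by blast
  have "g ((a \<otimes>\<^bsub>A\<^esub> b) \<odot>\<^bsub>E\<^esub> x) = (a \<otimes>\<^bsub>A\<^esub> b) \<otimes>\<^bsub>A\<^esub> g x"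
    using module_hom_smult[OF g, of "a \<otimes>\<^bsub>A\<^esub> b" x] a b x by (simp add: self_module_def)
  then show False using a b gx by (simp add: E.R.m_assoc)
qed

text \<open>A field is Gorenstein: for \<open>\<mm> = 0\<close> all of \<open>E\<close> is socle,
  hence spanned by \<open>\<iota> 1\<close>, and \<open>A\<close> is isomorphic to
  \<open>E\<close>.\<close>

lemma max_nonzero: "\<mm> \<noteq> {\<zero>\<^bsub>A\<^esub>}"
proof
  assume m0: "\<mm> = {\<zero>\<^bsub>A\<^esub>}"
  let ?e = "\<iota> \<one>\<^bsub>K\<^esub>"
  have soc: "x \<in> socle" if x: "x \<in> carrier E" for x unfolding socle_def using x m0 by auto
  have se: "a \<odot>\<^bsub>E\<^esub> ?e = \<iota> (\<pi> a)" if "a \<in> carrier A" for a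
    using iota_smult[OF that K.one_closed] that by simp
  have ex: "\<exists>a\<in>carrier A. x = a \<odot>\<^bsub>E\<^esub> ?e" if x: "x \<in> carrier E" for x
  proof -
    obtain c where "c \<in> carrier K" "x = \<iota> c" using soc[OF x] unfolding socle_eq by auto
    then show ?thesis using lift_exists se by metis
  qed
  have uniq: "a = b" if ab: "a \<in> carrier A" "b \<in> carrier A" "a \<odot>\<^bsub>E\<^esub> ?e = b \<odot>\<^bsub>E\<^esub> ?e" for a b
  proof -
    have "\<pi> a = \<pi> b" using ab se iota_inj by (metis inj_onD pi_closed)
    then have "a \<oplus>\<^bsub>A\<^esub> \<ominus>\<^bsub>A\<^esub> b \<in> \<mm>" using ab by (simp add: mem_max K.r_neg)
    then have "a \<ominus>\<^bsub>A\<^esub> b = \<zero>\<^bsub>A\<^esub>" by (simp add: m0 E.R.minus_eq)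
    then show ?thesis using ab by (simp add: E.R.minus_eq_zero_iff)
  qed
  obtain g where g: "\<And>x. x \<in> carrier E \<Longrightarrow> g x \<in> carrier A" "\<And>x. x \<in> carrier E \<Longrightarrow> x = g x \<odot>\<^bsub>E\<^esub> ?e"
    using ex by metis
  have gs: "g (a \<odot>\<^bsub>E\<^esub> ?e) = a" if "a \<in> carrier A" for a
    using that g by (intro uniq) auto
  have "g \<in> module_hom A E (self_module A)"
  proof (rule module_homI)
    fix x assume x: "x \<in> carrier E"
    show "g x \<in> carrier (self_module A)" using g x by (simp add: self_module_def)
    show "g (x \<oplus>\<^bsub>E\<^esub> y) = g x \<oplus>\<^bsub>self_module A\<^esub> g y" if y: "y \<in> carrier E" for y
    proof -
      have "x \<oplus>\<^bsub>E\<^esub> y = (g x \<oplus>\<^bsub>A\<^esub> g y) \<odot>\<^bsub>E\<^esub> ?e"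
        using g(2)[OF x] g(2)[OF y] g(1)[OF x] g(1)[OF y] by (simp add: E.smult_l_distr)
      then show ?thesis using gs[of "g x \<oplus>\<^bsub>A\<^esub> g y"] g(1)[OF x] g(1)[OF y] by (simp add: self_module_def)
    qed
    fix a assume a: "a \<in> carrier A"
    have "a \<odot>\<^bsub>E\<^esub> x = (a \<otimes>\<^bsub>A\<^esub> g x) \<odot>\<^bsub>E\<^esub> ?e" using g(2)[OF x] g(1)[OF x] a by (simp add: E.smult_assoc1)
    then show "g (a \<odot>\<^bsub>E\<^esub> x) = a \<odot>\<^bsub>self_module A\<^esub> g x"
      using gs[of "a \<otimes>\<^bsub>A\<^esub> g x"] g(1)[OF x] a by (simp add: self_module_def)
  qed
  moreover have "(\<lambda>a. a \<odot>\<^bsub>E\<^esub> ?e) \<in> module_hom A (self_module A) E"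
    by (auto simp: module_hom_def self_module_def E.smult_l_distr E.smult_assoc1)
  ultimately show False using no_retract gs by blast
qed

text \<open>A unit in the socle would force \<open>\<mm> = 0\<close>. The inclusion lets maps with
  values in the socle count as maps into \<open>\<mm>\<close>, and it makes \<open>soc A\<close>
  kill \<open>soc E\<close>.\<close>

lemma ring_socle_subset: "ring_socle \<subseteq> \<mm>"
proof
  fix z assume z: "z \<in> ring_socle"
  show "z \<in> \<mm>"
  proof (rule ccontr)
    assume "z \<notin> \<mm>"
    then obtain b where b: "b \<in> carrier A" "b \<otimes>\<^bsub>A\<^esub> z = \<one>\<^bsub>A\<^esub>"
      using Units_if_not_max z by (auto simp: ring_socle_iff)
    have zA: "z \<in> carrier A" using z by (simp add: ring_socle_iff)
    have "a = \<zero>\<^bsub>A\<^esub>" if a: "a \<in> \<mm>" for a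
    proof -
      have aA: "a \<in> carrier A" using a max_subset by auto
      have "a = b \<otimes>\<^bsub>A\<^esub> (a \<otimes>\<^bsub>A\<^esub> z)" using b aA zA by (simp add: E.R.m_lcomm)
      then show ?thesis using z a b by (simp add: ring_socle_iff)
    qed
    moreover have "\<zero>\<^bsub>A\<^esub> \<in> \<mm>" by (simp add: mem_max)
    ultimately show False using max_nonzero by blast
  qed
qed

text \<open>If \<open>g\<close> did not kill \<open>soc E\<close>, it would be injective by essentiality, hence split; its image would
  be generated by an idempotent of \<open>\<mm>\<close>, that is, by \<open>0\<close>.\<close>
lemma hom_kills_socle:
  assumes g: "g \<in> module_hom A E (self_module A)" and x: "x \<in> socle"
  shows "g x = \<zero>\<^bsub>A\<^esub>"
proof (rule ccontr)
  assume nz: "g x \<noteq> \<zero>\<^bsub>A\<^esub>"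
  interpret SM: module A "self_module A" by (rule self_module)
  note Em = E.module_axioms
  let ?H = "{y \<in> carrier E. g y = \<zero>\<^bsub>self_module A\<^esub>}"
  have g_smult: "g (a \<odot>\<^bsub>E\<^esub> y) = a \<otimes>\<^bsub>A\<^esub> g y" if "a \<in> carrier A" "y \<in> carrier E" for a y
    using module_hom_smult[OF g that] by (simp add: self_module_def)
  have gA: "g y \<in> carrier A" if "y \<in> carrier E" for y
    using module_hom_mem[OF g that] by (simp add: self_module_def)
  have g0: "g \<zero>\<^bsub>E\<^esub> = \<zero>\<^bsub>A\<^esub>" using module_hom_zero[OF Em self_module g] by (simp add: self_module_def)
  \<comment> \<open>\<open>soc E\<close> is one-dimensional: if a nonzero \<open>c\<close> had
    \<open>g (\<iota> c) = 0\<close>, then \<open>x\<close> would be a multiple of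
    \<open>\<iota> c\<close> and \<open>g x\<close> would vanish too.\<close>
  have "?H = {\<zero>\<^bsub>E\<^esub>}"
  proof (rule essential[OF module_hom_kernel[OF Em self_module g]])
    show "?H \<inter> \<iota> ` carrier K = {\<zero>\<^bsub>E\<^esub>}"
    proof
      show "{\<zero>\<^bsub>E\<^esub>} \<subseteq> ?H \<inter> \<iota> ` carrier K"
        using g0 by (auto simp: self_module_def intro!: image_eqI[of _ _ "\<zero>\<^bsub>K\<^esub>"])
      show "?H \<inter> \<iota> ` carrier K \<subseteq> {\<zero>\<^bsub>E\<^esub>}"
      proof
        fix y assume "y \<in> ?H \<inter> \<iota> ` carrier K"
        then obtain c where c: "c \<in> carrier K" "y = \<iota> c" "g (\<iota> c) = \<zero>\<^bsub>A\<^esub>" by (auto simp: self_module_def)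
        obtain d where d: "d \<in> carrier K" "x = \<iota> d" using x unfolding socle_eq by auto
        have "c = \<zero>\<^bsub>K\<^esub>"
        proof (rule ccontr)
          assume "c \<noteq> \<zero>\<^bsub>K\<^esub>"
          then have u: "c \<in> Units K" using c K.field_Units by simp
          then obtain b where b: "b \<in> carrier A" "\<pi> b = d \<otimes>\<^bsub>K\<^esub> inv\<^bsub>K\<^esub> c"
            using lift_exists d K.m_closed K.Units_inv_closed by metis
          have "\<pi> b \<otimes>\<^bsub>K\<^esub> c = d" using b u c d by (simp add: K.m_assoc)
          then have "x = b \<odot>\<^bsub>E\<^esub> \<iota> c" using iota_smult[OF b(1) c(1)] d by simp
          then have "g x = b \<otimes>\<^bsub>A\<^esub> g (\<iota> c)" using g_smult[OF b(1)] c by simp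
          then show False using nz c b by simp
        qed
        then show "y \<in> {\<zero>\<^bsub>E\<^esub>}" using c by simp
      qed
    qed
  qed
  then have inj: "inj_on g (carrier E)" by (intro module_hom_inj_onI[OF Em self_module g]) auto
  have "(\<lambda>y. y) \<in> module_hom A E E" by (auto simp: module_hom_def)
  then obtain r where r: "r \<in> module_hom A (self_module A) E" "\<And>y. y \<in> carrier E \<Longrightarrow> r (g y) = y"
    using injective_module_extend[OF injective Em self_module g inj] by blast
  define e where "e = r \<one>\<^bsub>A\<^esub>"
  have e: "e \<in> carrier E" using module_hom_mem[OF r(1), of "\<one>\<^bsub>A\<^esub>"] by (simp add: self_module_def e_def)
  have re: "r a = a \<odot>\<^bsub>E\<^esub> e" if "a \<in> carrier A" for a
    using module_hom_smult[OF r(1) that, of "\<one>\<^bsub>A\<^esub>"] that by (simp add: self_module_def e_def)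
  \<comment> \<open>As \<open>r a = a e\<close>, the identity \<open>r (g y) = y\<close> says that
    \<open>g e\<close> acts as 1 on the image of \<open>g\<close>. So \<open>1 - g e\<close> kills
    \<open>g x\<close>, although it is a unit because \<open>g e\<close> lies in
    \<open>\<mm>\<close>.\<close>
  have ge: "g y \<otimes>\<^bsub>A\<^esub> g e = g y" if y: "y \<in> carrier E" for y
    using g_smult[OF gA[OF y] e] re[OF gA[OF y]] r(2)[OF y] by simp
  have xE: "x \<in> carrier E" using x by (rule socle_carrier)
  have "g e \<in> \<mm>" by (rule hom_into_max[OF g e])
  then have "\<one>\<^bsub>A\<^esub> \<oplus>\<^bsub>A\<^esub> \<ominus>\<^bsub>A\<^esub> g e \<notin> \<mm>" using gA[OF e] by (simp add: mem_max)
  then obtain b where b: "b \<in> carrier A" "b \<otimes>\<^bsub>A\<^esub> (\<one>\<^bsub>A\<^esub> \<oplus>\<^bsub>A\<^esub> \<ominus>\<^bsub>A\<^esub> g e) = \<one>\<^bsub>A\<^esub>"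
    using Units_if_not_max[of "\<one>\<^bsub>A\<^esub> \<oplus>\<^bsub>A\<^esub> \<ominus>\<^bsub>A\<^esub> g e"] gA[OF e] by auto
  have "g x \<otimes>\<^bsub>A\<^esub> (\<one>\<^bsub>A\<^esub> \<oplus>\<^bsub>A\<^esub> \<ominus>\<^bsub>A\<^esub> g e) = \<zero>\<^bsub>A\<^esub>"
    using gA[OF xE] gA[OF e] ge[OF xE] by (simp add: E.R.r_distr E.R.r_minus E.R.r_neg)
  then have "b \<otimes>\<^bsub>A\<^esub> (\<one>\<^bsub>A\<^esub> \<oplus>\<^bsub>A\<^esub> \<ominus>\<^bsub>A\<^esub> g e) \<otimes>\<^bsub>A\<^esub> g x = \<zero>\<^bsub>A\<^esub>"
    using b(1) gA[OF xE] gA[OF e]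
    by (subst E.R.m_assoc) (simp_all add: E.R.m_comm[of "\<one>\<^bsub>A\<^esub> \<oplus>\<^bsub>A\<^esub> \<ominus>\<^bsub>A\<^esub> g e" "g x"])
  then show False using b gA[OF xE] nz by simp
qed

text \<open>\<open>soc A\<close> lies in \<open>\<mm>\<close> and so kills \<open>soc E\<close>;
  orthogonality then places \<open>soc E\<close> in every submodule containing
  \<open>\<mm> E\<close>. Applied to the kernels of the mixed homomorphisms, this shows that they
  vanish on the socle.\<close>

lemma socle_in_submodule:
  assumes N: "submodule A N E" and mN: "\<And>a e. a \<in> \<mm> \<Longrightarrow> e \<in> carrier E \<Longrightarrow> a \<odot>\<^bsub>E\<^esub> e \<in> N"
    and x: "x \<in> socle"
  shows "x \<in> N"
proof (rule socle_orthogonal[OF N mN socle_carrier[OF x]])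
  fix z assume "z \<in> ring_socle"
  then have "z \<in> \<mm>" using ring_socle_subset by auto
  then show "z \<odot>\<^bsub>E\<^esub> x = \<zero>\<^bsub>E\<^esub>" using x by (simp add: socle_def)
qed

end

section \<open>Two local rings over a common ring\<close>

text \<open>The fiber product enters only through its two projections \<open>\<phi>\<close> and \<open>\<psi>\<close>, in a form that is
  symmetric in the two factors.\<close>
locale local_pair =
  S: nongorenstein_envelope S \<mm>\<^sub>S K \<pi>\<^sub>S E\<^sub>S \<iota>\<^sub>S + T: nongorenstein_envelope T \<mm>\<^sub>T K \<pi>\<^sub>T E\<^sub>T \<iota>\<^sub>T
  for S :: "('s, 'x) ring_scheme" and \<mm>\<^sub>S and K :: "('k, 'z) ring_scheme" and \<pi>\<^sub>S
    and E\<^sub>S :: "('s, 'es, 'u) module_scheme" and \<iota>\<^sub>S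
    and T :: "('t, 'y) ring_scheme" and \<mm>\<^sub>T and \<pi>\<^sub>T and E\<^sub>T :: "('t, 'et, 'v) module_scheme" and \<iota>\<^sub>T +
  fixes R :: "('r, 'w) ring_scheme" and \<phi> :: "'r \<Rightarrow> 's" and \<psi> :: "'r \<Rightarrow> 't" and \<rho> :: "'r \<Rightarrow> 'k"
  assumes cring_R: "cring R" and phi_hom: "\<phi> \<in> ring_hom R S" and psi_hom: "\<psi> \<in> ring_hom R T"
    and phi_surj: "\<phi> ` carrier R = carrier S" and psi_surj: "\<psi> ` carrier R = carrier T"
    and rho_phi: "\<And>r. r \<in> carrier R \<Longrightarrow> \<rho> r = \<pi>\<^sub>S (\<phi> r)"
    and rho_psi: "\<And>r. r \<in> carrier R \<Longrightarrow> \<rho> r = \<pi>\<^sub>T (\<psi> r)"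
    and lift_max: "\<And>s t. s \<in> \<mm>\<^sub>S \<Longrightarrow> t \<in> \<mm>\<^sub>T \<Longrightarrow> \<exists>r\<in>carrier R. \<phi> r = s \<and> \<psi> r = t"
    and jointly_inj: "\<And>r. r \<in> carrier R \<Longrightarrow> \<phi> r = \<zero>\<^bsub>S\<^esub> \<Longrightarrow> \<psi> r = \<zero>\<^bsub>T\<^esub> \<Longrightarrow> r = \<zero>\<^bsub>R\<^esub>"

sublocale local_pair \<subseteq> B: cring R
  by (rule cring_R)

context local_pair
begin

text \<open>One-sided statements are proved for \<open>S\<close> only and carried over to
  \<open>T\<close> by this exchange.\<close>

lemma swap: "local_pair T \<mm>\<^sub>T K \<pi>\<^sub>T E\<^sub>T \<iota>\<^sub>T S \<mm>\<^sub>S \<pi>\<^sub>S E\<^sub>S \<iota>\<^sub>S R \<psi> \<phi> \<rho>"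
proof (intro local_pair.intro local_pair_axioms.intro)
  show "\<exists>r\<in>carrier R. \<psi> r = t \<and> \<phi> r = s" if "t \<in> \<mm>\<^sub>T" "s \<in> \<mm>\<^sub>S" for s t
    using lift_max[OF that(2,1)] by auto
qed (fact S.nongorenstein_envelope_axioms T.nongorenstein_envelope_axioms cring_R phi_hom psi_hom
    phi_surj psi_surj rho_phi rho_psi | rule jointly_inj, assumption+)+

lemma phi_simps [simp]:
  "r \<in> carrier R \<Longrightarrow> \<phi> r \<in> carrier S"
  "r \<in> carrier R \<Longrightarrow> q \<in> carrier R \<Longrightarrow> \<phi> (r \<oplus>\<^bsub>R\<^esub> q) = \<phi> r \<oplus>\<^bsub>S\<^esub> \<phi> q"
  "r \<in> carrier R \<Longrightarrow> q \<in> carrier R \<Longrightarrow> \<phi> (r \<otimes>\<^bsub>R\<^esub> q) = \<phi> r \<otimes>\<^bsub>S\<^esub> \<phi> q"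
  "\<phi> \<zero>\<^bsub>R\<^esub> = \<zero>\<^bsub>S\<^esub>" "\<phi> \<one>\<^bsub>R\<^esub> = \<one>\<^bsub>S\<^esub>"
  using ring_hom_closed[OF phi_hom] ring_hom_add[OF phi_hom] ring_hom_mult[OF phi_hom] ring_hom_one[OF phi_hom]
    ring_hom_zero[OF phi_hom B.ring_axioms S.E.R.ring_axioms] by auto

lemma psi_simps [simp]:
  "r \<in> carrier R \<Longrightarrow> \<psi> r \<in> carrier T"
  "r \<in> carrier R \<Longrightarrow> q \<in> carrier R \<Longrightarrow> \<psi> (r \<oplus>\<^bsub>R\<^esub> q) = \<psi> r \<oplus>\<^bsub>T\<^esub> \<psi> q"
  "r \<in> carrier R \<Longrightarrow> q \<in> carrier R \<Longrightarrow> \<psi> (r \<otimes>\<^bsub>R\<^esub> q) = \<psi> r \<otimes>\<^bsub>T\<^esub> \<psi> q"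
  "\<psi> \<zero>\<^bsub>R\<^esub> = \<zero>\<^bsub>T\<^esub>" "\<psi> \<one>\<^bsub>R\<^esub> = \<one>\<^bsub>T\<^esub>"
  using ring_hom_closed[OF psi_hom] ring_hom_add[OF psi_hom] ring_hom_mult[OF psi_hom] ring_hom_one[OF psi_hom]
    ring_hom_zero[OF psi_hom B.ring_axioms T.E.R.ring_axioms] by auto

lemma phi_a_inv [simp]: "r \<in> carrier R \<Longrightarrow> \<phi> (\<ominus>\<^bsub>R\<^esub> r) = \<ominus>\<^bsub>S\<^esub> \<phi> r"
  using phi_simps(2)[of "\<ominus>\<^bsub>R\<^esub> r" r]
  by (metis B.a_inv_closed B.l_neg S.E.R.minus_equality phi_simps(1) phi_simps(4))

lemma psi_a_inv [simp]: "r \<in> carrier R \<Longrightarrow> \<psi> (\<ominus>\<^bsub>R\<^esub> r) = \<ominus>\<^bsub>T\<^esub> \<psi> r"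
  using psi_simps(2)[of "\<ominus>\<^bsub>R\<^esub> r" r]
  by (metis B.a_inv_closed B.l_neg T.E.R.minus_equality psi_simps(1) psi_simps(4))

lemma jointly_inj_eq:
  assumes "r \<in> carrier R" "q \<in> carrier R" "\<phi> r = \<phi> q" "\<psi> r = \<psi> q"
  shows "r = q"
proof -
  have "r \<oplus>\<^bsub>R\<^esub> \<ominus>\<^bsub>R\<^esub> q = \<zero>\<^bsub>R\<^esub>"
    using assms by (intro jointly_inj) (auto simp: S.E.R.r_neg T.E.R.r_neg)
  then show ?thesis using assms B.minus_eq_zero_iff by (simp add: B.minus_eq)
qed

lemma lift_left: "s \<in> \<mm>\<^sub>S \<Longrightarrow> \<exists>r\<in>carrier R. \<phi> r = s \<and> \<psi> r = \<zero>\<^bsub>T\<^esub>"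
  by (rule lift_max) (simp_all add: T.mem_max)

lemma lift_right: "t \<in> \<mm>\<^sub>T \<Longrightarrow> \<exists>r\<in>carrier R. \<phi> r = \<zero>\<^bsub>S\<^esub> \<and> \<psi> r = t"
  by (rule lift_max) (simp_all add: S.mem_max)

lemma rho_hom: "\<rho> \<in> ring_hom R K"
  by (rule ring_hom_memI) (auto simp: rho_phi)

section \<open>Diagonal and mixed homomorphisms\<close>

abbreviation "ES_R \<equiv> restrict_scalars \<phi> E\<^sub>S"
abbreviation "ET_R \<equiv> restrict_scalars \<psi> E\<^sub>T"
abbreviation "mS_R \<equiv> restrict_scalars \<phi> (ideal_module S \<mm>\<^sub>S)"
abbreviation "mT_R \<equiv> restrict_scalars \<psi> (ideal_module T \<mm>\<^sub>T)"

lemma modules: "module R ES_R" "module R ET_R" "module R mS_R" "module R mT_R"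
  using S.max_ideal T.max_ideal
  by (auto intro!: restrict_scalars_is_module[OF cring_R phi_hom] restrict_scalars_is_module[OF cring_R psi_hom]
      ideal_module_is_module S.E.module_axioms T.E.module_axioms S.E.R.cring_axioms T.E.R.cring_axioms
      maximalideal.axioms(1))

lemma self_module_R: "module R (self_module R)"
  by (rule self_module_is_module[OF cring_R])

text \<open>Scalars of \<open>S\<close> lift to \<open>R\<close> along the surjection
  \<open>\<phi>\<close>. The hypotheses are equations because \<open>g\<close> may be a map into
  \<open>\<mm>\<^sub>S\<close> or the \<open>S\<close>-component of a map into
  \<open>R\<close>.\<close>

lemma hom_S_linear:
  assumes add: "\<And>x y. x \<in> carrier E\<^sub>S \<Longrightarrow> y \<in> carrier E\<^sub>S \<Longrightarrow> g (x \<oplus>\<^bsub>E\<^sub>S\<^esub> y) = g x \<oplus>\<^bsub>S\<^esub> g y"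
    and cl: "\<And>x. x \<in> carrier E\<^sub>S \<Longrightarrow> g x \<in> carrier S"
    and smult: "\<And>r x. r \<in> carrier R \<Longrightarrow> x \<in> carrier E\<^sub>S \<Longrightarrow> g (\<phi> r \<odot>\<^bsub>E\<^sub>S\<^esub> x) = \<phi> r \<otimes>\<^bsub>S\<^esub> g x"
  shows "g \<in> module_hom S E\<^sub>S (self_module S)"
proof (rule module_homI)
  fix s x assume "s \<in> carrier S" "x \<in> carrier E\<^sub>S"
  moreover then obtain r where "r \<in> carrier R" "s = \<phi> r" using phi_surj by auto
  ultimately show "g (s \<odot>\<^bsub>E\<^sub>S\<^esub> x) = s \<odot>\<^bsub>self_module S\<^esub> g x"
    using smult by (simp add: self_module_def)
qed (use add cl in \<open>auto simp: self_module_def\<close>)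

text \<open>The identity works: \<open>R\<close>-linear and \<open>S\<close>-linear maps agree, and
  by \<open>hom_into_max\<close> a map into \<open>S\<close> already has its values in
  \<open>\<mm>\<^sub>S\<close>.\<close>

lemma diag_Hom:
  "module_isomorphic R (Hom_module R ES_R mS_R) (restrict_scalars \<phi> (Hom_module S E\<^sub>S (self_module S)))"
proof (rule module_isomorphicI[where f = "\<lambda>g. g"])
  show "g \<in> carrier (restrict_scalars \<phi> (Hom_module S E\<^sub>S (self_module S)))"
    if g: "g \<in> carrier (Hom_module R ES_R mS_R)" for g
  proof -
    have "g \<in> module_hom S E\<^sub>S (self_module S)"
      using g S.max_subset by (intro hom_S_linear) (auto simp: Hom_module_def module_hom_def module_constr_simps)
    then show ?thesis using g by (simp add: Hom_module_def module_constr_simps)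
  qed
  show "\<exists>h\<in>carrier (Hom_module R ES_R mS_R). h = g"
    if g: "g \<in> carrier (restrict_scalars \<phi> (Hom_module S E\<^sub>S (self_module S)))" for g
  proof -
    have gh: "g \<in> module_hom S E\<^sub>S (self_module S)" using g by (simp add: Hom_module_def restrict_scalars_def)
    have "g \<in> module_hom R ES_R mS_R"
      using gh S.hom_into_max[OF gh] by (auto simp: module_hom_def module_constr_simps)
    then show ?thesis using g by (simp add: Hom_module_def module_constr_simps)
  qed
qed (auto simp: Hom_module_def module_constr_simps)

lemma cross_facts:
  assumes g: "g \<in> module_hom R ES_R mT_R"
  shows "\<And>x. x \<in> carrier E\<^sub>S \<Longrightarrow> g x \<in> carrier T"
    and "\<And>x y. x \<in> carrier E\<^sub>S \<Longrightarrow> y \<in> carrier E\<^sub>S \<Longrightarrow> g (x \<oplus>\<^bsub>E\<^sub>S\<^esub> y) = g x \<oplus>\<^bsub>T\<^esub> g y"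
    and "\<And>r x. r \<in> carrier R \<Longrightarrow> x \<in> carrier E\<^sub>S \<Longrightarrow> g (\<phi> r \<odot>\<^bsub>E\<^sub>S\<^esub> x) = \<psi> r \<otimes>\<^bsub>T\<^esub> g x"
    and "g \<zero>\<^bsub>E\<^sub>S\<^esub> = \<zero>\<^bsub>T\<^esub>"
  using g T.max_subset module_hom_zero[OF modules(1,4) g] by (auto simp: module_hom_def module_constr_simps)

text \<open>Lift an element \<open>t\<close> of \<open>\<mm>\<^sub>T\<close> to an \<open>r\<close>
  with \<open>\<phi> r = 0\<close>; then \<open>t (g x) = g (0 x) = 0\<close>. Stated for values in
  \<open>T\<close>, it also covers the components of maps into \<open>R\<close>.\<close>

lemma cross_ring_socle:
  assumes cl: "\<And>x. x \<in> carrier E\<^sub>S \<Longrightarrow> g x \<in> carrier T"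
    and smult: "\<And>r x. r \<in> carrier R \<Longrightarrow> x \<in> carrier E\<^sub>S \<Longrightarrow> g (\<phi> r \<odot>\<^bsub>E\<^sub>S\<^esub> x) = \<psi> r \<otimes>\<^bsub>T\<^esub> g x"
    and x: "x \<in> carrier E\<^sub>S"
  shows "g x \<in> T.ring_socle"
proof -
  have "t \<otimes>\<^bsub>T\<^esub> g x = \<zero>\<^bsub>T\<^esub>" if t: "t \<in> \<mm>\<^sub>T" for t
  proof -
    obtain r where r: "r \<in> carrier R" "\<phi> r = \<zero>\<^bsub>S\<^esub>" "\<psi> r = t" using lift_right[OF t] by auto
    have "t \<otimes>\<^bsub>T\<^esub> g x = g \<zero>\<^bsub>E\<^sub>S\<^esub>" using smult[OF r(1) x] r x by simp
    also have "\<dots> = \<zero>\<^bsub>T\<^esub>" using smult[OF B.zero_closed x] x cl by simp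
    finally show ?thesis .
  qed
  then show ?thesis using cl[OF x] by (simp add: T.ring_socle_iff)
qed

text \<open>An \<open>s\<close> in \<open>\<mm>\<^sub>S\<close> lifts to an \<open>r\<close> with
  \<open>\<psi> r = 0\<close>, so \<open>g (s x) = 0\<close>. The two parts are the form in which
  \<open>generated_by_dual_basis\<close> and \<open>socle_in_submodule\<close> take a submodule
  containing \<open>\<mm>\<^sub>S E\<^sub>S\<close>.\<close>

lemma cross_kernel:
  assumes g: "g \<in> module_hom R ES_R mT_R"
  shows "submodule S {x \<in> carrier E\<^sub>S. g x = \<zero>\<^bsub>T\<^esub>} E\<^sub>S"
    and "\<And>s x. s \<in> \<mm>\<^sub>S \<Longrightarrow> x \<in> carrier E\<^sub>S \<Longrightarrow> s \<odot>\<^bsub>E\<^sub>S\<^esub> x \<in> {x \<in> carrier E\<^sub>S. g x = \<zero>\<^bsub>T\<^esub>}"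
proof -
  note gf = cross_facts[OF g]
  show "submodule S {x \<in> carrier E\<^sub>S. g x = \<zero>\<^bsub>T\<^esub>} E\<^sub>S"
  proof (rule submodule_criterion[OF S.E.module_axioms])
    fix s x assume s: "s \<in> carrier S" and x: "x \<in> {x \<in> carrier E\<^sub>S. g x = \<zero>\<^bsub>T\<^esub>}"
    obtain r where "r \<in> carrier R" "s = \<phi> r" using s phi_surj by auto
    then show "s \<odot>\<^bsub>E\<^sub>S\<^esub> x \<in> {x \<in> carrier E\<^sub>S. g x = \<zero>\<^bsub>T\<^esub>}" using gf(3)[of r x] x by simp
  qed (use gf in auto)
  fix s x assume s: "s \<in> \<mm>\<^sub>S" and x: "x \<in> carrier E\<^sub>S"
  obtain r where "r \<in> carrier R" "\<phi> r = s" "\<psi> r = \<zero>\<^bsub>T\<^esub>" using lift_left[OF s] by auto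
  then show "s \<odot>\<^bsub>E\<^sub>S\<^esub> x \<in> {x \<in> carrier E\<^sub>S. g x = \<zero>\<^bsub>T\<^esub>}" using gf(3)[of r x] gf(1)[OF x] x by auto
qed

text \<open>Homomorphisms \<open>E\<^sub>S \<rightarrow> \<mm>\<^sub>T\<close> kill \<open>\<mm>\<^sub>S E\<^sub>S\<close> and land in \<open>soc T\<close>, so they are matrices with respect to
  bases of \<open>E\<^sub>S / \<mm>\<^sub>S E\<^sub>S\<close> and \<open>soc T\<close>; both have the size of the type.\<close>
lemma cross_Hom:
  obtains I :: "('es \<times> 'et) set" where "finite I" "card I = ring_type S K \<pi>\<^sub>S * ring_type T K \<pi>\<^sub>T"
    "module_isomorphic R (Hom_module R ES_R mT_R) (restrict_scalars \<rho> (ring.func_space K I))"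
proof -
  obtain F s where Fs: "S.dual_basis F s" using S.dual_basis_exists by auto
  obtain G t where Gt: "T.dual_basis G t" using T.dual_basis_exists by auto
  note F = S.dual_basisD(1,2)[OF Fs] and s = S.dual_basisD(3)[OF Fs] and s_dual = S.dual_basisD(4)[OF Fs]
  note G = T.dual_basisD(1,2)[OF Gt] and t = T.dual_basisD(3)[OF Gt] and t_dual = T.dual_basisD(4)[OF Gt]
    and t_sep = T.dual_basisD(5)[OF Gt]
  have tT: "t y \<in> carrier T" if "y \<in> G" for y using t[OF that] by (simp add: T.ring_socle_iff)
  let ?I = "F \<times> G"
  let ?H = "Hom_module R ES_R mT_R" and ?KI = "restrict_scalars \<rho> (S.K.func_space ?I)"
  have fin: "finite ?I" using F G by simp
  \<comment> \<open>The matrix of \<open>g\<close>: the entry at \<open>(x, y)\<close> pairs the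
    socle element \<open>g x\<close> with \<open>y\<close> and reads off the coordinate in
    \<open>soc E\<^sub>T = k\<close>.\<close>
  define \<alpha> where "\<alpha> g = (\<lambda>(x, y)\<in>?I. T.coord (g x \<odot>\<^bsub>E\<^sub>T\<^esub> y))" for g
  have H: "g \<in> module_hom R ES_R mT_R" "g \<in> extensional (carrier E\<^sub>S)" if "g \<in> carrier ?H" for g
    using that by (auto simp: Hom_module_def restrict_scalars_def)
  have soc: "g x \<in> T.ring_socle" if "g \<in> carrier ?H" "x \<in> carrier E\<^sub>S" for g x
    using cross_ring_socle[of g] cross_facts[OF H(1)[OF that(1)]] that(2) by blast
  have gT: "g x \<in> carrier T" if "g \<in> carrier ?H" "x \<in> carrier E\<^sub>S" for g x
    using soc[OF that] by (simp add: T.ring_socle_iff)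
  have soc': "g x \<odot>\<^bsub>E\<^sub>T\<^esub> y \<in> T.socle" if "g \<in> carrier ?H" "x \<in> F" "y \<in> G" for g x y
    using T.ring_socle_smult[OF soc[OF that(1)]] that F G by auto
  have \<alpha>: "\<alpha> \<in> module_hom R ?H ?KI"
  proof (rule module_homI)
    fix g assume g: "g \<in> carrier ?H"
    show "\<alpha> g \<in> carrier ?KI" using soc'[OF g] by (auto simp: \<alpha>_def restrict_scalars_def S.K.func_space_def)
    show "\<alpha> (g \<oplus>\<^bsub>?H\<^esub> h) = \<alpha> g \<oplus>\<^bsub>?KI\<^esub> \<alpha> h" if h: "h \<in> carrier ?H" for h
    proof
      fix p
      show "\<alpha> (g \<oplus>\<^bsub>?H\<^esub> h) p = (\<alpha> g \<oplus>\<^bsub>?KI\<^esub> \<alpha> h) p"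
      proof (cases "p \<in> ?I")
        case True
        then obtain x y where p: "p = (x, y)" "x \<in> F" "y \<in> G" by auto
        have xy: "x \<in> carrier E\<^sub>S" "y \<in> carrier E\<^sub>T" using p F G by auto
        have "(g \<oplus>\<^bsub>?H\<^esub> h) x \<odot>\<^bsub>E\<^sub>T\<^esub> y = g x \<odot>\<^bsub>E\<^sub>T\<^esub> y \<oplus>\<^bsub>E\<^sub>T\<^esub> h x \<odot>\<^bsub>E\<^sub>T\<^esub> y"
          using gT[OF g] gT[OF h] xy by (simp add: Hom_module_def module_constr_simps T.E.smult_l_distr)
        then show ?thesis using p T.coord_add[OF soc'[OF g] soc'[OF h]]
          by (simp add: \<alpha>_def restrict_scalars_def S.K.func_space_def)
      next
        case False
        then show ?thesis by (simp add: \<alpha>_def restrict_scalars_def S.K.func_space_def)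
      qed
    qed
    show "\<alpha> (r \<odot>\<^bsub>?H\<^esub> g) = r \<odot>\<^bsub>?KI\<^esub> \<alpha> g" if r: "r \<in> carrier R" for r
    proof
      fix p
      show "\<alpha> (r \<odot>\<^bsub>?H\<^esub> g) p = (r \<odot>\<^bsub>?KI\<^esub> \<alpha> g) p"
      proof (cases "p \<in> ?I")
        case True
        then obtain x y where p: "p = (x, y)" "x \<in> F" "y \<in> G" by auto
        have xy: "x \<in> carrier E\<^sub>S" "y \<in> carrier E\<^sub>T" using p F G by auto
        have "(r \<odot>\<^bsub>?H\<^esub> g) x \<odot>\<^bsub>E\<^sub>T\<^esub> y = \<psi> r \<odot>\<^bsub>E\<^sub>T\<^esub> (g x \<odot>\<^bsub>E\<^sub>T\<^esub> y)"
          using gT[OF g] xy r by (simp add: Hom_module_def module_constr_simps T.E.smult_assoc1)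
        then show ?thesis using p r T.coord_smult[OF _ soc'[OF g], of "\<psi> r"] rho_psi[OF r]
          by (simp add: \<alpha>_def restrict_scalars_def S.K.func_space_def)
      next
        case False
        then show ?thesis by (simp add: \<alpha>_def restrict_scalars_def S.K.func_space_def)
      qed
    qed
  qed
  have H_module: "module R ?H" by (rule Hom_module_is_module[OF modules(1,4)])
  interpret H: module R ?H by (rule H_module)
  have KI_module: "module R ?KI"
    by (rule restrict_scalars_is_module[OF cring_R rho_hom S.K.func_space_is_module])
  have inj: "inj_on \<alpha> (carrier ?H)"
  proof (rule module_hom_inj_onI[OF H_module KI_module \<alpha>])
    fix g assume g: "g \<in> carrier ?H" and z: "\<alpha> g = \<zero>\<^bsub>?KI\<^esub>"
    have gF: "g x = \<zero>\<^bsub>T\<^esub>" if x: "x \<in> F" for x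
    proof (rule t_sep)
      show "g x \<in> T.ring_socle" using soc[OF g] x F by auto
      fix y assume y: "y \<in> G"
      have "\<alpha> g (x, y) = \<zero>\<^bsub>K\<^esub>" using z x y by (simp add: restrict_scalars_def S.K.func_space_def)
      then show "g x \<odot>\<^bsub>E\<^sub>T\<^esub> y = \<zero>\<^bsub>E\<^sub>T\<^esub>"
        using T.iota_coord[OF soc'[OF g x y]] x y by (simp add: \<alpha>_def)
    qed
    \<comment> \<open>\<open>g\<close> vanishes on \<open>F\<close> and on
      \<open>\<mm>\<^sub>S E\<^sub>S\<close>, which together generate
      \<open>E\<^sub>S\<close>.\<close>
    have "{x \<in> carrier E\<^sub>S. g x = \<zero>\<^bsub>T\<^esub>} = carrier E\<^sub>S"
      by (rule S.generated_by_dual_basis[OF Fs cross_kernel[OF H(1)[OF g]]]) (use F gF in auto)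
    then show "g = \<zero>\<^bsub>?H\<^esub>"
      using H(2)[OF g] by (intro extensionalityI[of _ "carrier E\<^sub>S"]) (auto simp: Hom_module_def module_constr_simps)
  qed
  have unit: "(\<lambda>q\<in>?I. if q = p then \<one>\<^bsub>K\<^esub> else \<zero>\<^bsub>K\<^esub>) \<in> \<alpha> ` carrier ?H" if p: "p \<in> ?I" for p
  proof -
    obtain x y where xy: "p = (x, y)" "x \<in> F" "y \<in> G" using p by auto
    obtain l where l: "\<And>c. c \<in> carrier K \<Longrightarrow> l c \<in> carrier T" "\<And>c. c \<in> carrier K \<Longrightarrow> \<pi>\<^sub>T (l c) = c"
      using T.lift_exists by metis
    \<comment> \<open>The functional on \<open>E\<^sub>S\<close> dual to \<open>x\<close>. The
      matrix unit at \<open>(x, y)\<close> is the map sending \<open>e\<close> to \<open>c e\<close>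
      times \<open>t y\<close>, written with a lift of \<open>c e\<close> to
      \<open>T\<close>.\<close>
    define c where "c e = S.coord (s x \<odot>\<^bsub>E\<^sub>S\<^esub> e)" for e
    have soc_e: "s x \<odot>\<^bsub>E\<^sub>S\<^esub> e \<in> S.socle" if "e \<in> carrier E\<^sub>S" for e by (rule S.ring_socle_smult[OF s[OF xy(2)] that])
    have sS: "s x \<in> carrier S" using s[OF xy(2)] by (simp add: S.ring_socle_iff)
    have cK: "c e \<in> carrier K" if "e \<in> carrier E\<^sub>S" for e using soc_e[OF that] by (simp add: c_def)
    have c_add: "c (e \<oplus>\<^bsub>E\<^sub>S\<^esub> f) = c e \<oplus>\<^bsub>K\<^esub> c f" if "e \<in> carrier E\<^sub>S" "f \<in> carrier E\<^sub>S" for e f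
      using that soc_e sS by (simp add: c_def S.E.smult_r_distr S.coord_add)
    have c_smult: "c (a \<odot>\<^bsub>E\<^sub>S\<^esub> e) = \<pi>\<^sub>S a \<otimes>\<^bsub>K\<^esub> c e" if "a \<in> carrier S" "e \<in> carrier E\<^sub>S" for a e
    proof -
      have "s x \<odot>\<^bsub>E\<^sub>S\<^esub> (a \<odot>\<^bsub>E\<^sub>S\<^esub> e) = a \<odot>\<^bsub>E\<^sub>S\<^esub> (s x \<odot>\<^bsub>E\<^sub>S\<^esub> e)"
        using that sS by (simp add: S.E.smult_assoc1[symmetric] S.E.R.m_comm)
      then show ?thesis using that soc_e by (simp add: c_def S.coord_smult)
    qed
    define g where "g = (\<lambda>e\<in>carrier E\<^sub>S. l (c e) \<otimes>\<^bsub>T\<^esub> t y)"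
    note mult_eq = T.ring_socle_mult_eq[OF _ _ _ t[OF xy(3)]]
    have "g \<in> module_hom R ES_R mT_R"
    proof (rule module_homI)
      fix e assume "e \<in> carrier ES_R"
      then have e: "e \<in> carrier E\<^sub>S" by (simp add: restrict_scalars_def)
      \<comment> \<open>Here the target \<open>\<mm>\<^sub>T\<close> matters: a map into
        \<open>soc T\<close> is a map into \<open>\<mm>\<^sub>T\<close> because \<open>T\<close> is
        not a field.\<close>
      have "t y \<in> \<mm>\<^sub>T" using t[OF xy(3)] T.ring_socle_subset by auto
      then show "g e \<in> carrier mT_R"
        using e l(1)[OF cK[OF e]] T.max_ideal
        by (simp add: g_def module_constr_simps ideal.I_l_closed[OF maximalideal.axioms(1)])
      show "g (e \<oplus>\<^bsub>ES_R\<^esub> f) = g e \<oplus>\<^bsub>mT_R\<^esub> g f" if "f \<in> carrier ES_R" for f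
      proof -
        have f: "f \<in> carrier E\<^sub>S" using that by (simp add: restrict_scalars_def)
        have "l (c (e \<oplus>\<^bsub>E\<^sub>S\<^esub> f)) \<otimes>\<^bsub>T\<^esub> t y = (l (c e) \<oplus>\<^bsub>T\<^esub> l (c f)) \<otimes>\<^bsub>T\<^esub> t y"
          using e f l cK c_add by (intro mult_eq) auto
        then show ?thesis using e f l cK tT[OF xy(3)] by (simp add: g_def module_constr_simps T.E.R.l_distr)
      qed
      fix r assume r: "r \<in> carrier R"
      have "l (c (\<phi> r \<odot>\<^bsub>E\<^sub>S\<^esub> e)) \<otimes>\<^bsub>T\<^esub> t y = (\<psi> r \<otimes>\<^bsub>T\<^esub> l (c e)) \<otimes>\<^bsub>T\<^esub> t y"
        using e r l cK c_smult rho_phi[OF r] rho_psi[OF r] by (intro mult_eq) auto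
      then show "g (r \<odot>\<^bsub>ES_R\<^esub> e) = r \<odot>\<^bsub>mT_R\<^esub> g e"
        using e r l cK tT[OF xy(3)] by (simp add: g_def module_constr_simps T.E.R.m_assoc)
    qed
    then have gH: "g \<in> carrier ?H" by (simp add: Hom_module_def g_def restrict_scalars_def)
    have "\<alpha> g q = (\<lambda>q\<in>?I. if q = p then \<one>\<^bsub>K\<^esub> else \<zero>\<^bsub>K\<^esub>) q" for q
    proof (cases "q \<in> ?I")
      case True
      then obtain x' y' where q: "q = (x', y')" "x' \<in> F" "y' \<in> G" by auto
      have E: "x' \<in> carrier E\<^sub>S" "y' \<in> carrier E\<^sub>T" using q F G by auto
      have cx: "c x' = (if x' = x then \<one>\<^bsub>K\<^esub> else \<zero>\<^bsub>K\<^esub>)" using s_dual[OF xy(2) q(2)] by (simp add: c_def)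
      have "g x' \<odot>\<^bsub>E\<^sub>T\<^esub> y' = l (c x') \<odot>\<^bsub>E\<^sub>T\<^esub> (t y \<odot>\<^bsub>E\<^sub>T\<^esub> y')"
        using E l(1)[OF cK[OF E(1)]] tT[OF xy(3)] by (simp add: g_def T.E.smult_assoc1)
      moreover have "t y \<odot>\<^bsub>E\<^sub>T\<^esub> y' \<in> T.socle" by (rule T.ring_socle_smult[OF t[OF xy(3)] E(2)])
      ultimately have "T.coord (g x' \<odot>\<^bsub>E\<^sub>T\<^esub> y') = c x' \<otimes>\<^bsub>K\<^esub> T.coord (t y \<odot>\<^bsub>E\<^sub>T\<^esub> y')"
        using T.coord_smult[OF l(1)[OF cK[OF E(1)]]] l(2)[OF cK[OF E(1)]] by simp
      then show ?thesis using q cx t_dual[OF xy(3) q(3)] xy by (simp add: \<alpha>_def)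
    next
      case False
      then show ?thesis by (simp add: \<alpha>_def)
    qed
    then have "\<alpha> g = (\<lambda>q\<in>?I. if q = p then \<one>\<^bsub>K\<^esub> else \<zero>\<^bsub>K\<^esub>)" by (rule ext)
    then show ?thesis using gH by (metis image_eqI)
  qed
  have surj: "\<alpha> ` carrier ?H = ?I \<rightarrow>\<^sub>E carrier K"
  proof (rule S.K.func_space_generated[OF fin])
    show "\<alpha> ` carrier ?H \<subseteq> ?I \<rightarrow>\<^sub>E carrier K"
      using module_hom_mem[OF \<alpha>] by (auto simp: restrict_scalars_def S.K.func_space_def)
    have "\<alpha> \<zero>\<^bsub>?H\<^esub> = \<zero>\<^bsub>S.K.func_space ?I\<^esub>"
      using module_hom_zero[OF H_module KI_module \<alpha>] by (simp add: restrict_scalars_def)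
    then show "\<zero>\<^bsub>S.K.func_space ?I\<^esub> \<in> \<alpha> ` carrier ?H" using H.M.zero_closed by (metis image_eqI)
    show "u \<oplus>\<^bsub>S.K.func_space ?I\<^esub> v \<in> \<alpha> ` carrier ?H" if uv: "u \<in> \<alpha> ` carrier ?H" "v \<in> \<alpha> ` carrier ?H" for u v
    proof -
      from uv obtain g h where gh: "g \<in> carrier ?H" "h \<in> carrier ?H" "u = \<alpha> g" "v = \<alpha> h" by auto
      have "u \<oplus>\<^bsub>S.K.func_space ?I\<^esub> v = \<alpha> (g \<oplus>\<^bsub>?H\<^esub> h)"
        unfolding module_hom_add[OF \<alpha> gh(1,2)] gh(3,4) by (simp add: restrict_scalars_def)
      then show ?thesis using H.M.a_closed[OF gh(1,2)] by simp
    qed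
    show "c \<odot>\<^bsub>S.K.func_space ?I\<^esub> u \<in> \<alpha> ` carrier ?H" if c: "c \<in> carrier K" and u: "u \<in> \<alpha> ` carrier ?H" for c u
    proof -
      from u obtain g where g: "g \<in> carrier ?H" "u = \<alpha> g" by auto
      obtain a where a: "a \<in> carrier S" "\<pi>\<^sub>S a = c" using S.lift_exists[OF c] by auto
      obtain r where r: "r \<in> carrier R" "\<phi> r = a" using a(1) phi_surj by (metis imageE)
      have "c \<odot>\<^bsub>S.K.func_space ?I\<^esub> u = \<alpha> (r \<odot>\<^bsub>?H\<^esub> g)"
        unfolding module_hom_smult[OF \<alpha> r(1) g(1)] using a r g rho_phi[OF r(1)] by (simp add: restrict_scalars_def)
      then show ?thesis using H.smult_closed[OF r(1) g(1)] by simp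
    qed
  qed (rule unit)
  have "module_isomorphic R ?H ?KI"
    unfolding module_isomorphic_def bij_betw_def
    using \<alpha> inj surj by (intro bexI[of _ \<alpha>]) (auto simp: restrict_scalars_def S.K.func_space_def)
  moreover have "card ?I = ring_type S K \<pi>\<^sub>S * ring_type T K \<pi>\<^sub>T"
    using S.ring_type_eq_card[OF Fs] T.ring_type_eq_card[OF Gt]
    by (simp add: card_cartesian_product)
  ultimately show ?thesis using that fin by blast
qed

end

section \<open>The injective envelope over the common ring\<close>

locale local_pair_envelope =
  local_pair S \<mm>\<^sub>S K \<pi>\<^sub>S E\<^sub>S \<iota>\<^sub>S T \<mm>\<^sub>T \<pi>\<^sub>T E\<^sub>T \<iota>\<^sub>T R \<phi> \<psi> \<rho>
  for S :: "('s, 'x) ring_scheme" and \<mm>\<^sub>S and K :: "('k, 'z) ring_scheme" and \<pi>\<^sub>S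
    and E\<^sub>S :: "('s, 'es, 'u) module_scheme" and \<iota>\<^sub>S
    and T :: "('t, 'y) ring_scheme" and \<mm>\<^sub>T and \<pi>\<^sub>T and E\<^sub>T :: "('t, 'et, 'v) module_scheme" and \<iota>\<^sub>T
    and R :: "('r, 'w) ring_scheme" and \<phi> \<psi> \<rho> +
  fixes E\<^sub>R :: "('r, 'er, 'q) module_scheme" and \<iota>\<^sub>R :: "'k \<Rightarrow> 'er"
  assumes injective_R: "injective_module R E\<^sub>R"
    and iota_R: "\<iota>\<^sub>R \<in> module_hom R (residue_module K \<rho>) E\<^sub>R"
    and iota_R_inj: "inj_on \<iota>\<^sub>R (carrier K)"
    and essential_R: "\<And>H. submodule R H E\<^sub>R \<Longrightarrow> H \<inter> \<iota>\<^sub>R ` carrier K = {\<zero>\<^bsub>E\<^sub>R\<^esub>} \<Longrightarrow> H = {\<zero>\<^bsub>E\<^sub>R\<^esub>}"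

sublocale local_pair_envelope \<subseteq> ER: module R E\<^sub>R
  using injective_R by (simp add: injective_module_def)

context local_pair_envelope
begin

lemma swap_envelope: "local_pair_envelope T \<mm>\<^sub>T K \<pi>\<^sub>T E\<^sub>T \<iota>\<^sub>T S \<mm>\<^sub>S \<pi>\<^sub>S E\<^sub>S \<iota>\<^sub>S R \<psi> \<phi> \<rho> E\<^sub>R \<iota>\<^sub>R"
  by (intro local_pair_envelope.intro local_pair_envelope_axioms.intro swap injective_R iota_R iota_R_inj)
    (rule essential_R)

lemma iota_R_zero: "\<iota>\<^sub>R \<zero>\<^bsub>K\<^esub> = \<zero>\<^bsub>E\<^sub>R\<^esub>"
proof -
  have "\<zero>\<^bsub>R\<^esub> \<odot>\<^bsub>residue_module K \<rho>\<^esub> \<zero>\<^bsub>K\<^esub> = \<zero>\<^bsub>K\<^esub>" by (simp add: module_constr_simps rho_phi)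
  moreover have "\<iota>\<^sub>R (\<zero>\<^bsub>R\<^esub> \<odot>\<^bsub>residue_module K \<rho>\<^esub> \<zero>\<^bsub>K\<^esub>) = \<zero>\<^bsub>R\<^esub> \<odot>\<^bsub>E\<^sub>R\<^esub> \<iota>\<^sub>R \<zero>\<^bsub>K\<^esub>"
    by (rule module_hom_smult[OF iota_R]) (simp_all add: module_constr_simps)
  moreover have "\<iota>\<^sub>R \<zero>\<^bsub>K\<^esub> \<in> carrier E\<^sub>R"
    by (rule module_hom_mem[OF iota_R]) (simp add: module_constr_simps)
  ultimately show ?thesis by simp
qed

text \<open>The image of \<open>E\<^sub>S\<close> is injective over \<open>S\<close>, so it splits off the part of \<open>E\<^sub>R\<close> killed by
  \<open>ker \<phi>\<close>; a complement would avoid \<open>k\<close>.\<close>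
lemma component:
  obtains p where "p \<in> module_hom R ES_R E\<^sub>R" "inj_on p (carrier E\<^sub>S)"
    "\<And>b. b \<in> carrier E\<^sub>R \<Longrightarrow> (\<And>r. r \<in> carrier R \<Longrightarrow> \<phi> r = \<zero>\<^bsub>S\<^esub> \<Longrightarrow> r \<odot>\<^bsub>E\<^sub>R\<^esub> b = \<zero>\<^bsub>E\<^sub>R\<^esub>) \<Longrightarrow> b \<in> p ` carrier E\<^sub>S"
proof -
  have KR: "module R (residue_module K \<rho>)"
    unfolding residue_module_def
    by (rule restrict_scalars_is_module[OF cring_R rho_hom self_module_is_module]) (rule S.K.cring_axioms)
  have i: "\<iota>\<^sub>S \<in> module_hom R (residue_module K \<rho>) ES_R"
    by (rule module_homI) (auto simp: module_constr_simps S.iota_add rho_phi S.iota_smult)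
  have ii: "inj_on \<iota>\<^sub>S (carrier (residue_module K \<rho>))" using S.iota_inj by (simp add: module_constr_simps)
  \<comment> \<open>\<open>p\<close> extends \<open>\<iota>\<^sub>R\<close> along
    \<open>\<iota>\<^sub>S\<close>. Its kernel meets the image of \<open>\<iota>\<^sub>S\<close> in
    0 and is an \<open>S\<close>-submodule, so it vanishes by essentiality of
    \<open>E\<^sub>S\<close>.\<close>
  obtain p where p: "p \<in> module_hom R ES_R E\<^sub>R" and pi: "\<And>c. c \<in> carrier K \<Longrightarrow> p (\<iota>\<^sub>S c) = \<iota>\<^sub>R c"
    using injective_module_extend[OF injective_R KR modules(1) i ii iota_R] by (auto simp: module_constr_simps)
  have p_mem: "p x \<in> carrier E\<^sub>R" if "x \<in> carrier E\<^sub>S" for x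
    using module_hom_mem[OF p] that by (simp add: restrict_scalars_def)
  have p_add: "p (x \<oplus>\<^bsub>E\<^sub>S\<^esub> y) = p x \<oplus>\<^bsub>E\<^sub>R\<^esub> p y" if "x \<in> carrier E\<^sub>S" "y \<in> carrier E\<^sub>S" for x y
    using module_hom_add[OF p, of x y] that by (simp add: restrict_scalars_def)
  have p_smult: "p (\<phi> r \<odot>\<^bsub>E\<^sub>S\<^esub> x) = r \<odot>\<^bsub>E\<^sub>R\<^esub> p x" if "r \<in> carrier R" "x \<in> carrier E\<^sub>S" for r x
    using module_hom_smult[OF p, of r x] that by (simp add: restrict_scalars_def)
  have p_zero: "p \<zero>\<^bsub>E\<^sub>S\<^esub> = \<zero>\<^bsub>E\<^sub>R\<^esub>"
    using module_hom_zero[OF modules(1) ER.module_axioms p] by (simp add: restrict_scalars_def)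
  let ?N = "{x \<in> carrier E\<^sub>S. p x = \<zero>\<^bsub>E\<^sub>R\<^esub>}"
  have "?N = {\<zero>\<^bsub>E\<^sub>S\<^esub>}"
  proof (rule S.essential)
    show "submodule S ?N E\<^sub>S"
    proof (rule submodule_criterion[OF S.E.module_axioms])
      fix s x assume s: "s \<in> carrier S" and x: "x \<in> ?N"
      obtain r where "r \<in> carrier R" "s = \<phi> r" using s phi_surj by auto
      then show "s \<odot>\<^bsub>E\<^sub>S\<^esub> x \<in> ?N" using x p_smult[of r x] by simp
    qed (auto simp: p_zero p_add)
    show "?N \<inter> \<iota>\<^sub>S ` carrier K = {\<zero>\<^bsub>E\<^sub>S\<^esub>}"
    proof
      show "{\<zero>\<^bsub>E\<^sub>S\<^esub>} \<subseteq> ?N \<inter> \<iota>\<^sub>S ` carrier K"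
        using p_zero S.iota_zero by (auto intro!: image_eqI[of _ _ "\<zero>\<^bsub>K\<^esub>"])
      show "?N \<inter> \<iota>\<^sub>S ` carrier K \<subseteq> {\<zero>\<^bsub>E\<^sub>S\<^esub>}"
      proof
        fix x assume "x \<in> ?N \<inter> \<iota>\<^sub>S ` carrier K"
        then obtain c where c: "c \<in> carrier K" "x = \<iota>\<^sub>S c" "p (\<iota>\<^sub>S c) = \<zero>\<^bsub>E\<^sub>R\<^esub>" by auto
        then have "\<iota>\<^sub>R c = \<iota>\<^sub>R \<zero>\<^bsub>K\<^esub>" using pi iota_R_zero by simp
        then have "c = \<zero>\<^bsub>K\<^esub>" using c(1) iota_R_inj by (meson S.K.zero_closed inj_onD)
        then show "x \<in> {\<zero>\<^bsub>E\<^sub>S\<^esub>}" using c by simp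
      qed
    qed
  qed
  then have p_ker: "x = \<zero>\<^bsub>E\<^sub>S\<^esub>" if "x \<in> carrier E\<^sub>S" "p x = \<zero>\<^bsub>E\<^sub>R\<^esub>" for x using that by blast
  have p_inj: "inj_on p (carrier E\<^sub>S)"
    using module_hom_inj_onI[OF modules(1) ER.module_axioms p] p_ker by (simp add: restrict_scalars_def)
  \<comment> \<open>The largest submodule of \<open>E\<^sub>R\<close> on which \<open>R\<close> acts
    through \<open>\<phi>\<close>; the aim is that \<open>p\<close> maps onto it.\<close>
  define B where "B = {b \<in> carrier E\<^sub>R. \<forall>r\<in>carrier R. \<phi> r = \<zero>\<^bsub>S\<^esub> \<longrightarrow> r \<odot>\<^bsub>E\<^sub>R\<^esub> b = \<zero>\<^bsub>E\<^sub>R\<^esub>}"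
  have BE: "b \<in> carrier E\<^sub>R" if "b \<in> B" for b using that by (simp add: B_def)
  have B_sub: "submodule R B E\<^sub>R"
  proof (rule submodule_criterion[OF ER.module_axioms])
    show "r \<odot>\<^bsub>E\<^sub>R\<^esub> b \<in> B" if r: "r \<in> carrier R" and b: "b \<in> B" for r b
    proof -
      have "q \<odot>\<^bsub>E\<^sub>R\<^esub> (r \<odot>\<^bsub>E\<^sub>R\<^esub> b) = \<zero>\<^bsub>E\<^sub>R\<^esub>" if q: "q \<in> carrier R" "\<phi> q = \<zero>\<^bsub>S\<^esub>" for q
      proof -
        have "q \<odot>\<^bsub>E\<^sub>R\<^esub> (r \<odot>\<^bsub>E\<^sub>R\<^esub> b) = r \<odot>\<^bsub>E\<^sub>R\<^esub> (q \<odot>\<^bsub>E\<^sub>R\<^esub> b)"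
          using q r BE[OF b] by (simp add: ER.smult_assoc1[symmetric] B.m_comm)
        then show ?thesis using b q r by (simp add: B_def)
      qed
      then show ?thesis using r BE[OF b] by (simp add: B_def)
    qed
  qed (auto simp: B_def ER.smult_r_distr)
  have B_eq: "r \<odot>\<^bsub>E\<^sub>R\<^esub> b = q \<odot>\<^bsub>E\<^sub>R\<^esub> b" if "r \<in> carrier R" "q \<in> carrier R" "\<phi> r = \<phi> q" "b \<in> B" for r q b
  proof -
    have "(r \<oplus>\<^bsub>R\<^esub> \<ominus>\<^bsub>R\<^esub> q) \<odot>\<^bsub>E\<^sub>R\<^esub> b = \<zero>\<^bsub>E\<^sub>R\<^esub>" using that by (simp add: B_def S.E.R.r_neg)
    then have "r \<odot>\<^bsub>E\<^sub>R\<^esub> b \<ominus>\<^bsub>E\<^sub>R\<^esub> q \<odot>\<^bsub>E\<^sub>R\<^esub> b = \<zero>\<^bsub>E\<^sub>R\<^esub>"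
      using that BE by (simp add: ER.smult_l_distr ER.smult_l_minus ER.M.minus_eq)
    then show ?thesis using that BE by (subst (asm) ER.M.minus_eq_zero_iff) auto
  qed
  have p_B: "p x \<in> B" if x: "x \<in> carrier E\<^sub>S" for x
  proof -
    have "r \<odot>\<^bsub>E\<^sub>R\<^esub> p x = \<zero>\<^bsub>E\<^sub>R\<^esub>" if "r \<in> carrier R" "\<phi> r = \<zero>\<^bsub>S\<^esub>" for r
      using p_smult[OF that(1) x] that(2) x p_zero by simp
    then show ?thesis using p_mem[OF x] by (simp add: B_def)
  qed
  have "\<exists>r\<in>carrier R. \<phi> r = s" if "s \<in> carrier S" for s
    using that phi_surj by (metis imageE)
  then obtain \<sigma> where \<sigma>: "\<And>s. s \<in> carrier S \<Longrightarrow> \<sigma> s \<in> carrier R" "\<And>s. s \<in> carrier S \<Longrightarrow> \<phi> (\<sigma> s) = s"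
    by metis
  \<comment> \<open>\<open>B\<close> as an \<open>S\<close>-module, with scalars lifted by the
    section \<open>\<sigma>\<close>; \<open>B_eq\<close> makes the action independent of the
    lifts.\<close>
  define BS where "BS = \<lparr>carrier = B, mult = mult E\<^sub>R, one = one E\<^sub>R, zero = zero E\<^sub>R, add = add E\<^sub>R,
      smult = (\<lambda>s b. \<sigma> s \<odot>\<^bsub>E\<^sub>R\<^esub> b)\<rparr>"
  note Bsm = submodule.smult_closed[OF B_sub] and Badd = submodule.m_closed[OF B_sub]
  have BS_module: "module S BS"
  proof (rule moduleI[OF S.E.R.cring_axioms])
    interpret Bm: module R "ER.md B" by (rule ER.submodule_is_module[OF B_sub])
    show "abelian_group BS"
    proof (rule abelian_groupI)
      fix b assume "b \<in> carrier BS"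
      then show "\<exists>b'\<in>carrier BS. b' \<oplus>\<^bsub>BS\<^esub> b = \<zero>\<^bsub>BS\<^esub>"
        using Bm.M.l_neg[of b] Bm.M.a_inv_closed[of b] by (auto simp: BS_def)
    qed (use Badd submodule.zero_closed[OF B_sub] BE in \<open>auto simp: BS_def ER.M.a_ac\<close>)
    fix s b assume s: "s \<in> carrier S" and "b \<in> carrier BS"
    then have b: "b \<in> B" by (simp add: BS_def)
    show "s \<odot>\<^bsub>BS\<^esub> b \<in> carrier BS" using Bsm[OF \<sigma>(1)[OF s] b] by (simp add: BS_def)
    show "s \<odot>\<^bsub>BS\<^esub> (b \<oplus>\<^bsub>BS\<^esub> c) = s \<odot>\<^bsub>BS\<^esub> b \<oplus>\<^bsub>BS\<^esub> s \<odot>\<^bsub>BS\<^esub> c" if "c \<in> carrier BS" for c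
      using that s b \<sigma> BE by (simp add: BS_def ER.smult_r_distr)
    fix t assume t: "t \<in> carrier S"
    have "\<sigma> (s \<oplus>\<^bsub>S\<^esub> t) \<odot>\<^bsub>E\<^sub>R\<^esub> b = (\<sigma> s \<oplus>\<^bsub>R\<^esub> \<sigma> t) \<odot>\<^bsub>E\<^sub>R\<^esub> b" using s t \<sigma> b by (intro B_eq) auto
    then show "(s \<oplus>\<^bsub>S\<^esub> t) \<odot>\<^bsub>BS\<^esub> b = s \<odot>\<^bsub>BS\<^esub> b \<oplus>\<^bsub>BS\<^esub> t \<odot>\<^bsub>BS\<^esub> b"
      using s t \<sigma> BE[OF b] by (simp add: BS_def ER.smult_l_distr)
    have "\<sigma> (s \<otimes>\<^bsub>S\<^esub> t) \<odot>\<^bsub>E\<^sub>R\<^esub> b = (\<sigma> s \<otimes>\<^bsub>R\<^esub> \<sigma> t) \<odot>\<^bsub>E\<^sub>R\<^esub> b" using s t \<sigma> b by (intro B_eq) auto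
    then show "(s \<otimes>\<^bsub>S\<^esub> t) \<odot>\<^bsub>BS\<^esub> b = s \<odot>\<^bsub>BS\<^esub> (t \<odot>\<^bsub>BS\<^esub> b)"
      using s t \<sigma> BE[OF b] by (simp add: BS_def ER.smult_assoc1)
  next
    fix b assume "b \<in> carrier BS"
    then have b: "b \<in> B" by (simp add: BS_def)
    have "\<sigma> \<one>\<^bsub>S\<^esub> \<odot>\<^bsub>E\<^sub>R\<^esub> b = \<one>\<^bsub>R\<^esub> \<odot>\<^bsub>E\<^sub>R\<^esub> b" using \<sigma> b by (intro B_eq) auto
    then show "\<one>\<^bsub>S\<^esub> \<odot>\<^bsub>BS\<^esub> b = b" using BE[OF b] by (simp add: BS_def)
  qed
  have p_S: "p \<in> module_hom S E\<^sub>S BS"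
  proof (rule module_homI)
    fix s x assume s: "s \<in> carrier S" and x: "x \<in> carrier E\<^sub>S"
    show "p (s \<odot>\<^bsub>E\<^sub>S\<^esub> x) = s \<odot>\<^bsub>BS\<^esub> p x" using p_smult[OF \<sigma>(1)[OF s] x] \<sigma>(2)[OF s] by (simp add: BS_def)
  qed (use p_B p_add in \<open>auto simp: BS_def\<close>)
  have "(\<lambda>x. x) \<in> module_hom S E\<^sub>S E\<^sub>S" by (auto simp: module_hom_def)
  then obtain q where q: "q \<in> module_hom S BS E\<^sub>S" "\<And>x. x \<in> carrier E\<^sub>S \<Longrightarrow> q (p x) = x"
    using injective_module_extend[OF S.injective S.E.module_axioms BS_module p_S p_inj] by blast
  have q_mem: "q b \<in> carrier E\<^sub>S" if "b \<in> B" for b using module_hom_mem[OF q(1)] that by (simp add: BS_def)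
  have q_add: "q (b \<oplus>\<^bsub>E\<^sub>R\<^esub> c) = q b \<oplus>\<^bsub>E\<^sub>S\<^esub> q c" if "b \<in> B" "c \<in> B" for b c
    using module_hom_add[OF q(1), of b c] that by (simp add: BS_def)
  have q_smult: "q (r \<odot>\<^bsub>E\<^sub>R\<^esub> b) = \<phi> r \<odot>\<^bsub>E\<^sub>S\<^esub> q b" if r: "r \<in> carrier R" and b: "b \<in> B" for r b
  proof -
    have "r \<odot>\<^bsub>E\<^sub>R\<^esub> b = \<phi> r \<odot>\<^bsub>BS\<^esub> b" using B_eq[OF r \<sigma>(1) _ b, of "\<phi> r"] \<sigma> r by (simp add: BS_def)
    then show ?thesis using module_hom_smult[OF q(1), of "\<phi> r" b] r b by (simp add: BS_def)
  qed
  have q_zero: "q \<zero>\<^bsub>E\<^sub>R\<^esub> = \<zero>\<^bsub>E\<^sub>S\<^esub>" using q(2)[of "\<zero>\<^bsub>E\<^sub>S\<^esub>"] p_zero by simp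
  let ?H = "{b \<in> B. q b = \<zero>\<^bsub>E\<^sub>S\<^esub>}"
  \<comment> \<open>On \<open>\<iota>\<^sub>R c = p (\<iota>\<^sub>S c)\<close> the retraction
    \<open>q\<close> has the value \<open>\<iota>\<^sub>S c\<close>, so its kernel meets the image
    of \<open>\<iota>\<^sub>R\<close> in 0 and vanishes by essentiality of
    \<open>E\<^sub>R\<close>.\<close>
  have H0: "?H = {\<zero>\<^bsub>E\<^sub>R\<^esub>}"
  proof (rule essential_R)
    show "submodule R ?H E\<^sub>R"
      by (rule submodule_criterion[OF ER.module_axioms])
        (use BE Badd Bsm submodule.zero_closed[OF B_sub] in \<open>auto simp: q_zero q_add q_smult\<close>)
    show "?H \<inter> \<iota>\<^sub>R ` carrier K = {\<zero>\<^bsub>E\<^sub>R\<^esub>}"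
    proof
      show "{\<zero>\<^bsub>E\<^sub>R\<^esub>} \<subseteq> ?H \<inter> \<iota>\<^sub>R ` carrier K"
        using q_zero iota_R_zero submodule.zero_closed[OF B_sub] by (auto intro!: image_eqI[of _ _ "\<zero>\<^bsub>K\<^esub>"])
      show "?H \<inter> \<iota>\<^sub>R ` carrier K \<subseteq> {\<zero>\<^bsub>E\<^sub>R\<^esub>}"
      proof
        fix b assume "b \<in> ?H \<inter> \<iota>\<^sub>R ` carrier K"
        then obtain c where c: "c \<in> carrier K" "b = p (\<iota>\<^sub>S c)" "q b = \<zero>\<^bsub>E\<^sub>S\<^esub>" using pi by auto
        then have "\<iota>\<^sub>S c = \<zero>\<^bsub>E\<^sub>S\<^esub>" using q(2)[of "\<iota>\<^sub>S c"] by simp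
        then show "b \<in> {\<zero>\<^bsub>E\<^sub>R\<^esub>}" using c p_zero by simp
      qed
    qed
  qed
  have "b \<in> p ` carrier E\<^sub>S" if b: "b \<in> B" for b
  proof -
    \<comment> \<open>\<open>b - p (q b)\<close> lies in the kernel of \<open>q\<close>, which is
      0.\<close>
    let ?d = "p (\<ominus>\<^bsub>E\<^sub>S\<^esub> q b)"
    have d: "?d \<in> B" using p_B q_mem[OF b] by simp
    have "q (b \<oplus>\<^bsub>E\<^sub>R\<^esub> ?d) = \<zero>\<^bsub>E\<^sub>S\<^esub>" using q_add[OF b d] q(2) q_mem[OF b] by (simp add: S.E.M.r_neg)
    then have z: "b \<oplus>\<^bsub>E\<^sub>R\<^esub> ?d = \<zero>\<^bsub>E\<^sub>R\<^esub>" using H0 Badd[OF b d] by blast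
    have "?d \<oplus>\<^bsub>E\<^sub>R\<^esub> p (q b) = \<zero>\<^bsub>E\<^sub>R\<^esub>" using p_add[of "\<ominus>\<^bsub>E\<^sub>S\<^esub> q b" "q b"] q_mem[OF b] p_zero by (simp add: S.E.M.l_neg)
    then have "b = p (q b)"
      using z BE[OF b] BE[OF d] p_mem[OF q_mem[OF b]] by (metis ER.M.a_assoc ER.M.l_zero ER.M.r_zero)
    then show ?thesis using q_mem[OF b] by blast
  qed
  then show ?thesis using that[OF p p_inj] by (auto simp: B_def)
qed

text \<open>Extend \<open>\<mm>\<^sub>S \<oplus> \<mm>\<^sub>T \<rightarrow> E\<^sub>R\<close>, \<open>(s, t) \<mapsto> (s, 0) x\<close>, to \<open>R\<close>: the value at \<open>1\<close> is \<open>b\<close>.\<close>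
lemma decompose:
  assumes x: "x \<in> carrier E\<^sub>R"
  obtains b c where "b \<in> carrier E\<^sub>R" "c \<in> carrier E\<^sub>R" "x = b \<oplus>\<^bsub>E\<^sub>R\<^esub> c"
    "\<And>r. r \<in> carrier R \<Longrightarrow> \<phi> r = \<zero>\<^bsub>S\<^esub> \<Longrightarrow> r \<odot>\<^bsub>E\<^sub>R\<^esub> b = \<zero>\<^bsub>E\<^sub>R\<^esub>"
    "\<And>r. r \<in> carrier R \<Longrightarrow> \<psi> r = \<zero>\<^bsub>T\<^esub> \<Longrightarrow> r \<odot>\<^bsub>E\<^sub>R\<^esub> c = \<zero>\<^bsub>E\<^sub>R\<^esub>"
proof -
  define I where "I = {r \<in> carrier R. \<rho> r = \<zero>\<^bsub>K\<^esub>}"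
  have IR: "r \<in> carrier R" if "r \<in> I" for r using that by (simp add: I_def)
  have I: "ideal I R"
  proof (rule idealI)
    show "ring R" by (rule B.ring_axioms)
    show "subgroup I (add_monoid R)"
      by (rule B.add.subgroupI) (auto simp: I_def rho_phi intro!: exI[of _ "\<zero>\<^bsub>R\<^esub>"])
    show "b \<otimes>\<^bsub>R\<^esub> a \<in> I" "a \<otimes>\<^bsub>R\<^esub> b \<in> I" if "a \<in> I" "b \<in> carrier R" for a b
      using that by (auto simp: I_def rho_phi)
  qed
  \<comment> \<open>\<open>\<theta> r\<close> will be the \<open>\<mm>\<^sub>S\<close>-part of
    \<open>r\<close>, that is, the element \<open>(\<phi> r, 0)\<close> of \<open>R\<close>.\<close>
  have "\<exists>q\<in>carrier R. \<phi> q = \<phi> r \<and> \<psi> q = \<zero>\<^bsub>T\<^esub>" if "r \<in> I" for r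
    using that by (intro lift_left) (auto simp: I_def S.mem_max rho_phi)
  then obtain \<theta> where l: "\<And>r. r \<in> I \<Longrightarrow> \<theta> r \<in> carrier R" "\<And>r. r \<in> I \<Longrightarrow> \<phi> (\<theta> r) = \<phi> r"
    "\<And>r. r \<in> I \<Longrightarrow> \<psi> (\<theta> r) = \<zero>\<^bsub>T\<^esub>" by metis
  have "(\<lambda>r. \<theta> r \<odot>\<^bsub>E\<^sub>R\<^esub> x) \<in> module_hom R (ideal_module R I) E\<^sub>R"
  proof (rule module_homI)
    fix r assume "r \<in> carrier (ideal_module R I)"
    then have r: "r \<in> I" by (simp add: ideal_module_def)
    show "\<theta> r \<odot>\<^bsub>E\<^sub>R\<^esub> x \<in> carrier E\<^sub>R" using l r x by simp
    show "\<theta> (r \<oplus>\<^bsub>ideal_module R I\<^esub> q) \<odot>\<^bsub>E\<^sub>R\<^esub> x = \<theta> r \<odot>\<^bsub>E\<^sub>R\<^esub> x \<oplus>\<^bsub>E\<^sub>R\<^esub> \<theta> q \<odot>\<^bsub>E\<^sub>R\<^esub> x"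
      if "q \<in> carrier (ideal_module R I)" for q
    proof -
      have q: "q \<in> I" using that by (simp add: ideal_module_def)
      have rq: "r \<oplus>\<^bsub>R\<^esub> q \<in> I" using r q by (auto simp: I_def rho_phi)
      have "\<theta> (r \<oplus>\<^bsub>R\<^esub> q) = \<theta> r \<oplus>\<^bsub>R\<^esub> \<theta> q"
        using l[OF r] l[OF q] l[OF rq] IR[OF r] IR[OF q] by (intro jointly_inj_eq) auto
      then show ?thesis using l r q x by (simp add: module_constr_simps ER.smult_l_distr)
    qed
    fix a assume a: "a \<in> carrier R"
    have ar: "a \<otimes>\<^bsub>R\<^esub> r \<in> I" using r a by (auto simp: I_def rho_phi)
    have "\<theta> (a \<otimes>\<^bsub>R\<^esub> r) = a \<otimes>\<^bsub>R\<^esub> \<theta> r"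
      using l[OF r] l[OF ar] IR[OF r] a by (intro jointly_inj_eq) auto
    then show "\<theta> (a \<odot>\<^bsub>ideal_module R I\<^esub> r) \<odot>\<^bsub>E\<^sub>R\<^esub> x = a \<odot>\<^bsub>E\<^sub>R\<^esub> (\<theta> r \<odot>\<^bsub>E\<^sub>R\<^esub> x)"
      using l r a x by (simp add: module_constr_simps ER.smult_assoc1)
  qed
  from injective_module_baer[OF injective_R I this]
  obtain b where b: "b \<in> carrier E\<^sub>R" "\<And>r. r \<in> I \<Longrightarrow> \<theta> r \<odot>\<^bsub>E\<^sub>R\<^esub> x = r \<odot>\<^bsub>E\<^sub>R\<^esub> b" by auto
  show ?thesis
  proof (rule that[of b "x \<ominus>\<^bsub>E\<^sub>R\<^esub> b"])
    show "b \<in> carrier E\<^sub>R" "x \<ominus>\<^bsub>E\<^sub>R\<^esub> b \<in> carrier E\<^sub>R" using b x by auto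
    show "x = b \<oplus>\<^bsub>E\<^sub>R\<^esub> (x \<ominus>\<^bsub>E\<^sub>R\<^esub> b)"
    proof -
      have "b \<oplus>\<^bsub>E\<^sub>R\<^esub> (x \<oplus>\<^bsub>E\<^sub>R\<^esub> \<ominus>\<^bsub>E\<^sub>R\<^esub> b) = x \<oplus>\<^bsub>E\<^sub>R\<^esub> (b \<oplus>\<^bsub>E\<^sub>R\<^esub> \<ominus>\<^bsub>E\<^sub>R\<^esub> b)"
        using b(1) x by (intro ER.M.a_lcomm) auto
      then show ?thesis using b(1) x by (simp add: ER.M.minus_eq ER.M.r_neg)
    qed
    \<comment> \<open>If \<open>\<phi> r = 0\<close> then \<open>\<theta> r = 0\<close>, so
      \<open>r b = 0\<close>; if \<open>\<psi> r = 0\<close> then \<open>\<theta> r = r\<close>, so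
      \<open>r x = r b\<close>.\<close>
    fix r assume r: "r \<in> carrier R"
    show "r \<odot>\<^bsub>E\<^sub>R\<^esub> b = \<zero>\<^bsub>E\<^sub>R\<^esub>" if z: "\<phi> r = \<zero>\<^bsub>S\<^esub>"
    proof -
      have rI: "r \<in> I" using r z by (simp add: I_def rho_phi)
      have "\<theta> r = \<zero>\<^bsub>R\<^esub>" using l[OF rI] z by (intro jointly_inj) auto
      then show ?thesis using b(2)[OF rI] x by simp
    qed
    show "r \<odot>\<^bsub>E\<^sub>R\<^esub> (x \<ominus>\<^bsub>E\<^sub>R\<^esub> b) = \<zero>\<^bsub>E\<^sub>R\<^esub>" if z: "\<psi> r = \<zero>\<^bsub>T\<^esub>"
    proof -
      have rI: "r \<in> I" using r z by (simp add: I_def rho_psi)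
      have "\<theta> r = r" using l[OF rI] z r by (intro jointly_inj_eq) auto
      then have "r \<odot>\<^bsub>E\<^sub>R\<^esub> x = r \<odot>\<^bsub>E\<^sub>R\<^esub> b" using b(2)[OF rI] by simp
      then show ?thesis
        using r x b(1) by (simp add: ER.M.minus_eq ER.smult_r_distr ER.smult_r_minus ER.M.r_neg)
    qed
  qed
qed

text \<open>The components of a homomorphism \<open>E\<^sub>R \<rightarrow> R\<close> on \<open>E\<^sub>S\<close> are \<open>E\<^sub>S \<rightarrow> S\<close>, not surjective as \<open>S\<close> is not
  Gorenstein, and \<open>E\<^sub>S \<rightarrow> T\<close>, with values in \<open>soc T\<close>.\<close>
lemma dual_component_max:
  assumes f: "f \<in> module_hom R E\<^sub>R (self_module R)" and p: "p \<in> module_hom R ES_R E\<^sub>R"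
    and x: "x \<in> carrier E\<^sub>S"
  shows "\<phi> (f (p x)) \<in> \<mm>\<^sub>S" and "\<psi> (f (p x)) \<in> \<mm>\<^sub>T"
proof -
  have fp: "(\<lambda>x. f (p x)) \<in> module_hom R ES_R (self_module R)" by (rule module_hom_compose[OF p f])
  have cl: "f (p y) \<in> carrier R" if "y \<in> carrier E\<^sub>S" for y
    using module_hom_mem[OF fp] that by (simp add: module_constr_simps)
  have add: "f (p (y \<oplus>\<^bsub>E\<^sub>S\<^esub> z)) = f (p y) \<oplus>\<^bsub>R\<^esub> f (p z)" if "y \<in> carrier E\<^sub>S" "z \<in> carrier E\<^sub>S" for y z
    using module_hom_add[OF fp, of y z] that by (simp add: module_constr_simps)
  have smult: "f (p (\<phi> r \<odot>\<^bsub>E\<^sub>S\<^esub> y)) = r \<otimes>\<^bsub>R\<^esub> f (p y)" if "r \<in> carrier R" "y \<in> carrier E\<^sub>S" for r y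
    using module_hom_smult[OF fp, of r y] that by (simp add: module_constr_simps)
  have "(\<lambda>x. \<phi> (f (p x))) \<in> module_hom S E\<^sub>S (self_module S)"
    by (rule hom_S_linear) (auto simp: cl add smult)
  from S.hom_into_max[OF this x] show "\<phi> (f (p x)) \<in> \<mm>\<^sub>S" .
  have "\<psi> (f (p x)) \<in> T.ring_socle"
    using x by (rule cross_ring_socle[where g = "\<lambda>x. \<psi> (f (p x))", rotated 2]) (auto simp: cl smult)
  then show "\<psi> (f (p x)) \<in> \<mm>\<^sub>T" using T.ring_socle_subset by auto
qed

text \<open>The component in \<open>\<mm>\<^sub>S\<close> is a map from \<open>E\<^sub>S\<close> to
  \<open>S\<close>, covered by \<open>hom_kills_socle\<close>; the one in
  \<open>\<mm>\<^sub>T\<close> kills \<open>\<mm>\<^sub>S E\<^sub>S\<close>, which contains the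
  socle.\<close>

lemma kills_socle_left:
  assumes h: "h \<in> module_hom R (direct_sum ES_R ET_R) (direct_sum mS_R mT_R)" and x: "x \<in> S.socle"
  shows "h (x, \<zero>\<^bsub>E\<^sub>T\<^esub>) = (\<zero>\<^bsub>S\<^esub>, \<zero>\<^bsub>T\<^esub>)"
proof -
  let ?i = "\<lambda>x. (x, \<zero>\<^bsub>E\<^sub>T\<^esub>)"
  have i: "?i \<in> module_hom R ES_R (direct_sum ES_R ET_R)"
    by (rule module_homI) (auto simp: module_constr_simps)
  have f: "fst \<in> module_hom R (direct_sum mS_R mT_R) mS_R" and s: "snd \<in> module_hom R (direct_sum mS_R mT_R) mT_R"
    by (auto simp: module_hom_def direct_sum_def)
  have h1: "(\<lambda>x. fst (h (?i x))) \<in> module_hom R ES_R mS_R"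
    by (rule module_hom_compose[OF module_hom_compose[OF i h] f])
  have h2: "(\<lambda>x. snd (h (?i x))) \<in> module_hom R ES_R mT_R"
    by (rule module_hom_compose[OF module_hom_compose[OF i h] s])
  have "(\<lambda>x. fst (h (?i x))) \<in> module_hom S E\<^sub>S (self_module S)"
    using h1 S.max_subset by (intro hom_S_linear) (auto simp: module_hom_def module_constr_simps)
  from S.hom_kills_socle[OF this x] have "fst (h (?i x)) = \<zero>\<^bsub>S\<^esub>" .
  moreover have "snd (h (?i x)) = \<zero>\<^bsub>T\<^esub>"
    using S.socle_in_submodule[OF cross_kernel[OF h2] x] by simp
  ultimately show ?thesis by (simp add: prod_eq_iff)
qed

lemma kills_socles:
  assumes h: "h \<in> module_hom R (direct_sum ES_R ET_R) (direct_sum mS_R mT_R)"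
    and x: "x \<in> S.socle" and y: "y \<in> T.socle"
  shows "h (x, y) = (\<zero>\<^bsub>S\<^esub>, \<zero>\<^bsub>T\<^esub>)"
proof -
  interpret sw: local_pair_envelope T \<mm>\<^sub>T K \<pi>\<^sub>T E\<^sub>T \<iota>\<^sub>T S \<mm>\<^sub>S \<pi>\<^sub>S E\<^sub>S \<iota>\<^sub>S R \<psi> \<phi> \<rho> E\<^sub>R \<iota>\<^sub>R by (rule swap_envelope)
  \<comment> \<open>Exchanging the factors in source and target makes the second summand the first
    one of the swapped setting.\<close>
  have "(\<lambda>z. prod.swap (h (prod.swap z))) \<in> module_hom R (direct_sum ET_R ES_R) (direct_sum mT_R mS_R)"
    using h by (force simp: module_hom_def direct_sum_def Pi_iff)
  from sw.kills_socle_left[OF this y] have "h (\<zero>\<^bsub>E\<^sub>S\<^esub>, y) = (\<zero>\<^bsub>S\<^esub>, \<zero>\<^bsub>T\<^esub>)" by (metis swap_simp swap_swap)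
  moreover have "h (x, \<zero>\<^bsub>E\<^sub>T\<^esub>) = (\<zero>\<^bsub>S\<^esub>, \<zero>\<^bsub>T\<^esub>)" by (rule kills_socle_left[OF h x])
  moreover have "(x, y) = (x, \<zero>\<^bsub>E\<^sub>T\<^esub>) \<oplus>\<^bsub>direct_sum ES_R ET_R\<^esub> (\<zero>\<^bsub>E\<^sub>S\<^esub>, y)"
    using x y by (simp add: module_constr_simps S.socle_carrier T.socle_carrier)
  moreover have "h ((x, \<zero>\<^bsub>E\<^sub>T\<^esub>) \<oplus>\<^bsub>direct_sum ES_R ET_R\<^esub> (\<zero>\<^bsub>E\<^sub>S\<^esub>, y)) =
      h (x, \<zero>\<^bsub>E\<^sub>T\<^esub>) \<oplus>\<^bsub>direct_sum mS_R mT_R\<^esub> h (\<zero>\<^bsub>E\<^sub>S\<^esub>, y)"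
    using x y by (intro module_hom_add[OF h]) (auto simp: module_constr_simps S.socle_carrier T.socle_carrier)
  ultimately show ?thesis by (simp add: module_constr_simps)
qed

text \<open>Since \<open>E\<^sub>R = E\<^sub>S + E\<^sub>T\<close> with \<open>E\<^sub>S \<inter> E\<^sub>T\<close> contained in both socles, homomorphisms from \<open>E\<^sub>R\<close> are
  homomorphisms from \<open>E\<^sub>S \<oplus> E\<^sub>T\<close> killing part of the socles, which all of them do.\<close>
lemma dual_isomorphic:
  "module_isomorphic R (dual_module R E\<^sub>R) (Hom_module R (direct_sum ES_R ET_R) (direct_sum mS_R mT_R))"
proof -
  interpret sw: local_pair_envelope T \<mm>\<^sub>T K \<pi>\<^sub>T E\<^sub>T \<iota>\<^sub>T S \<mm>\<^sub>S \<pi>\<^sub>S E\<^sub>S \<iota>\<^sub>S R \<psi> \<phi> \<rho> E\<^sub>R \<iota>\<^sub>R by (rule swap_envelope)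
  obtain p where p: "p \<in> module_hom R ES_R E\<^sub>R" "inj_on p (carrier E\<^sub>S)"
    and p_img: "\<And>b. b \<in> carrier E\<^sub>R \<Longrightarrow> (\<And>r. r \<in> carrier R \<Longrightarrow> \<phi> r = \<zero>\<^bsub>S\<^esub> \<Longrightarrow> r \<odot>\<^bsub>E\<^sub>R\<^esub> b = \<zero>\<^bsub>E\<^sub>R\<^esub>) \<Longrightarrow> b \<in> p ` carrier E\<^sub>S"
    using component by blast
  obtain q where q: "q \<in> module_hom R ET_R E\<^sub>R" "inj_on q (carrier E\<^sub>T)"
    and q_img: "\<And>b. b \<in> carrier E\<^sub>R \<Longrightarrow> (\<And>r. r \<in> carrier R \<Longrightarrow> \<psi> r = \<zero>\<^bsub>T\<^esub> \<Longrightarrow> r \<odot>\<^bsub>E\<^sub>R\<^esub> b = \<zero>\<^bsub>E\<^sub>R\<^esub>) \<Longrightarrow> b \<in> q ` carrier E\<^sub>T"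
    using sw.component by blast
  let ?D = "direct_sum ES_R ET_R" and ?M = "direct_sum mS_R mT_R"
  let ?dual = "Hom_module R E\<^sub>R (self_module R)" and ?H = "Hom_module R ?D ?M"
  interpret D: module R ?D by (rule direct_sum_is_module[OF modules(1,2)])
  have M_module: "module R ?M" by (rule direct_sum_is_module[OF modules(3,4)])
  interpret M: module R ?M by (rule M_module)
  have p_mem: "p x \<in> carrier E\<^sub>R" if "x \<in> carrier E\<^sub>S" for x
    using module_hom_mem[OF p(1)] that by (simp add: restrict_scalars_def)
  have q_mem: "q y \<in> carrier E\<^sub>R" if "y \<in> carrier E\<^sub>T" for y
    using module_hom_mem[OF q(1)] that by (simp add: restrict_scalars_def)
  have p_add: "p (x \<oplus>\<^bsub>E\<^sub>S\<^esub> y) = p x \<oplus>\<^bsub>E\<^sub>R\<^esub> p y" if "x \<in> carrier E\<^sub>S" "y \<in> carrier E\<^sub>S" for x y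
    using module_hom_add[OF p(1), of x y] that by (simp add: restrict_scalars_def)
  have q_add: "q (x \<oplus>\<^bsub>E\<^sub>T\<^esub> y) = q x \<oplus>\<^bsub>E\<^sub>R\<^esub> q y" if "x \<in> carrier E\<^sub>T" "y \<in> carrier E\<^sub>T" for x y
    using module_hom_add[OF q(1), of x y] that by (simp add: restrict_scalars_def)
  have p_smult: "p (\<phi> r \<odot>\<^bsub>E\<^sub>S\<^esub> x) = r \<odot>\<^bsub>E\<^sub>R\<^esub> p x" if "r \<in> carrier R" "x \<in> carrier E\<^sub>S" for r x
    using module_hom_smult[OF p(1), of r x] that by (simp add: restrict_scalars_def)
  have q_smult: "q (\<psi> r \<odot>\<^bsub>E\<^sub>T\<^esub> x) = r \<odot>\<^bsub>E\<^sub>R\<^esub> q x" if "r \<in> carrier R" "x \<in> carrier E\<^sub>T" for r x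
    using module_hom_smult[OF q(1), of r x] that by (simp add: restrict_scalars_def)
  have p_zero: "p \<zero>\<^bsub>E\<^sub>S\<^esub> = \<zero>\<^bsub>E\<^sub>R\<^esub>"
    using module_hom_zero[OF modules(1) ER.module_axioms p(1)] by (simp add: restrict_scalars_def)
  have q_zero: "q \<zero>\<^bsub>E\<^sub>T\<^esub> = \<zero>\<^bsub>E\<^sub>R\<^esub>"
    using module_hom_zero[OF modules(2) ER.module_axioms q(1)] by (simp add: restrict_scalars_def)
  define P where "P = (\<lambda>(x, y). p x \<oplus>\<^bsub>E\<^sub>R\<^esub> q y)"
  have P: "P \<in> module_hom R ?D E\<^sub>R"
    by (rule module_homI)
      (auto simp: P_def direct_sum_def restrict_scalars_def p_mem q_mem p_add q_add p_smult q_smult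
        ER.smult_r_distr ER.M.a_ac)
  have P_surj: "\<exists>z\<in>carrier ?D. P z = e" if e: "e \<in> carrier E\<^sub>R" for e
  proof -
    from decompose[OF e] obtain b c where bc: "b \<in> carrier E\<^sub>R" "c \<in> carrier E\<^sub>R" "e = b \<oplus>\<^bsub>E\<^sub>R\<^esub> c"
      "\<And>r. r \<in> carrier R \<Longrightarrow> \<phi> r = \<zero>\<^bsub>S\<^esub> \<Longrightarrow> r \<odot>\<^bsub>E\<^sub>R\<^esub> b = \<zero>\<^bsub>E\<^sub>R\<^esub>"
      "\<And>r. r \<in> carrier R \<Longrightarrow> \<psi> r = \<zero>\<^bsub>T\<^esub> \<Longrightarrow> r \<odot>\<^bsub>E\<^sub>R\<^esub> c = \<zero>\<^bsub>E\<^sub>R\<^esub>" by metis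
    obtain x where "x \<in> carrier E\<^sub>S" "b = p x" using p_img[OF bc(1,4)] by auto
    moreover obtain y where "y \<in> carrier E\<^sub>T" "c = q y" using q_img[OF bc(2,5)] by auto
    ultimately show ?thesis
      using bc by (intro bexI[of _ "(x, y)"]) (auto simp: P_def direct_sum_def restrict_scalars_def)
  qed
  \<comment> \<open>Acting on \<open>P (x, y) = 0\<close> with a lift of \<open>(s, 0)\<close>
    leaves \<open>p (s x) = 0\<close>, and injectivity of \<open>p\<close> gives
    \<open>s x = 0\<close>; likewise for \<open>y\<close>.\<close>
  have P_ker: "x \<in> S.socle \<and> y \<in> T.socle" if x: "x \<in> carrier E\<^sub>S" and y: "y \<in> carrier E\<^sub>T" and z: "P (x, y) = \<zero>\<^bsub>E\<^sub>R\<^esub>" for x y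
  proof -
    have Pz: "p (\<phi> r \<odot>\<^bsub>E\<^sub>S\<^esub> x) \<oplus>\<^bsub>E\<^sub>R\<^esub> q (\<psi> r \<odot>\<^bsub>E\<^sub>T\<^esub> y) = \<zero>\<^bsub>E\<^sub>R\<^esub>" if r: "r \<in> carrier R" for r
    proof -
      have "p (\<phi> r \<odot>\<^bsub>E\<^sub>S\<^esub> x) \<oplus>\<^bsub>E\<^sub>R\<^esub> q (\<psi> r \<odot>\<^bsub>E\<^sub>T\<^esub> y) = r \<odot>\<^bsub>E\<^sub>R\<^esub> P (x, y)"
        using r x y by (simp add: P_def p_smult q_smult p_mem q_mem ER.smult_r_distr)
      then show ?thesis using z r by simp
    qed
    have "s \<odot>\<^bsub>E\<^sub>S\<^esub> x = \<zero>\<^bsub>E\<^sub>S\<^esub>" if s: "s \<in> \<mm>\<^sub>S" for s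
    proof -
      obtain r where r: "r \<in> carrier R" "\<phi> r = s" "\<psi> r = \<zero>\<^bsub>T\<^esub>" using lift_left[OF s] by auto
      have sx: "s \<odot>\<^bsub>E\<^sub>S\<^esub> x \<in> carrier E\<^sub>S" using r x by auto
      have "p (s \<odot>\<^bsub>E\<^sub>S\<^esub> x) = p \<zero>\<^bsub>E\<^sub>S\<^esub>" using Pz[OF r(1)] r(2,3) y q_zero p_zero p_mem[OF sx] by simp
      then show ?thesis using inj_onD[OF p(2)] sx by blast
    qed
    moreover have "t \<odot>\<^bsub>E\<^sub>T\<^esub> y = \<zero>\<^bsub>E\<^sub>T\<^esub>" if t: "t \<in> \<mm>\<^sub>T" for t
    proof -
      obtain r where r: "r \<in> carrier R" "\<phi> r = \<zero>\<^bsub>S\<^esub>" "\<psi> r = t" using lift_right[OF t] by auto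
      have ty: "t \<odot>\<^bsub>E\<^sub>T\<^esub> y \<in> carrier E\<^sub>T" using r y by auto
      have "q (t \<odot>\<^bsub>E\<^sub>T\<^esub> y) = q \<zero>\<^bsub>E\<^sub>T\<^esub>" using Pz[OF r(1)] r(2,3) x q_zero p_zero q_mem[OF ty] by simp
      then show ?thesis using inj_onD[OF q(2)] ty by blast
    qed
    ultimately show ?thesis using x y by (simp add: S.socle_def T.socle_def)
  qed
  \<comment> \<open>An element of \<open>R\<close> is recorded by its two projections; those of
    \<open>f (P z)\<close> lie in the maximal ideals by \<open>dual_component_max\<close> for both
    summands.\<close>
  define \<Phi> where "\<Phi> f = (\<lambda>z\<in>carrier ?D. (\<phi> (f (P z)), \<psi> (f (P z))))" for f
  have f_mem: "f e \<in> carrier R" if "f \<in> carrier ?dual" "e \<in> carrier E\<^sub>R" for f e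
    using that by (auto simp: Hom_module_def module_hom_def self_module_def)
  have P_mem: "P z \<in> carrier E\<^sub>R" if "z \<in> carrier ?D" for z using module_hom_mem[OF P that] .
  have "module_isomorphic R ?dual ?H"
  proof (rule module_isomorphicI[where f = \<Phi>])
    fix f assume f: "f \<in> carrier ?dual"
    then have fh: "f \<in> module_hom R E\<^sub>R (self_module R)" by (simp add: Hom_module_def)
    have fP: "(\<lambda>z. f (P z)) \<in> module_hom R ?D (self_module R)" by (rule module_hom_compose[OF P fh])
    have "(\<lambda>z. (\<phi> (f (P z)), \<psi> (f (P z)))) \<in> module_hom R ?D ?M"
    proof (rule module_homI)
      fix z assume z: "z \<in> carrier ?D"
      obtain x y where xy: "z = (x, y)" "x \<in> carrier E\<^sub>S" "y \<in> carrier E\<^sub>T"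
        using z by (auto simp: direct_sum_def restrict_scalars_def)
      have "f (P z) = f (p x) \<oplus>\<^bsub>R\<^esub> f (q y)"
        using module_hom_add[OF fh p_mem[OF xy(2)] q_mem[OF xy(3)]] xy by (simp add: P_def self_module_def)
      then show "(\<phi> (f (P z)), \<psi> (f (P z))) \<in> carrier ?M"
        using dual_component_max[OF fh p(1) xy(2)] sw.dual_component_max[OF fh q(1) xy(3)]
          f_mem[OF f p_mem[OF xy(2)]] f_mem[OF f q_mem[OF xy(3)]]
        by (simp add: module_constr_simps S.mem_max T.mem_max)
    next
      fix z w assume z: "z \<in> carrier ?D" and w: "w \<in> carrier ?D"
      have "f (P (z \<oplus>\<^bsub>?D\<^esub> w)) = f (P z) \<oplus>\<^bsub>R\<^esub> f (P w)" using module_hom_add[OF fP z w] by (simp add: self_module_def)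
      then show "(\<phi> (f (P (z \<oplus>\<^bsub>?D\<^esub> w))), \<psi> (f (P (z \<oplus>\<^bsub>?D\<^esub> w)))) =
          (\<phi> (f (P z)), \<psi> (f (P z))) \<oplus>\<^bsub>?M\<^esub> (\<phi> (f (P w)), \<psi> (f (P w)))"
        using f_mem[OF f P_mem[OF z]] f_mem[OF f P_mem[OF w]] by (simp add: module_constr_simps)
    next
      fix r z assume r: "r \<in> carrier R" and z: "z \<in> carrier ?D"
      have "f (P (r \<odot>\<^bsub>?D\<^esub> z)) = r \<otimes>\<^bsub>R\<^esub> f (P z)" using module_hom_smult[OF fP r z] by (simp add: self_module_def)
      then show "(\<phi> (f (P (r \<odot>\<^bsub>?D\<^esub> z))), \<psi> (f (P (r \<odot>\<^bsub>?D\<^esub> z)))) = r \<odot>\<^bsub>?M\<^esub> (\<phi> (f (P z)), \<psi> (f (P z)))"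
        using f_mem[OF f P_mem[OF z]] r by (simp add: module_constr_simps)
    qed
    then show "\<Phi> f \<in> carrier ?H"
      by (simp add: \<Phi>_def Hom_module_def module_hom_restrict[OF D.module_axioms])
    show "\<Phi> (f \<oplus>\<^bsub>?dual\<^esub> g) = \<Phi> f \<oplus>\<^bsub>?H\<^esub> \<Phi> g" if g: "g \<in> carrier ?dual" for g
    proof
      fix z
      show "\<Phi> (f \<oplus>\<^bsub>?dual\<^esub> g) z = (\<Phi> f \<oplus>\<^bsub>?H\<^esub> \<Phi> g) z"
        using f_mem[OF f P_mem[of z]] f_mem[OF g P_mem[of z]] P_mem[of z]
        by (simp add: \<Phi>_def Hom_module_def module_constr_simps)
    qed
    show "\<Phi> (r \<odot>\<^bsub>?dual\<^esub> f) = r \<odot>\<^bsub>?H\<^esub> \<Phi> f" if r: "r \<in> carrier R" for r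
    proof
      fix z
      show "\<Phi> (r \<odot>\<^bsub>?dual\<^esub> f) z = (r \<odot>\<^bsub>?H\<^esub> \<Phi> f) z"
        using f_mem[OF f P_mem[of z]] P_mem[of z] r
        by (simp add: \<Phi>_def Hom_module_def module_constr_simps)
    qed
  next
    show "inj_on \<Phi> (carrier ?dual)"
    proof (rule inj_onI)
      fix f g assume f: "f \<in> carrier ?dual" and g: "g \<in> carrier ?dual" and eq: "\<Phi> f = \<Phi> g"
      have "f e = g e" if e: "e \<in> carrier E\<^sub>R" for e
      proof -
        obtain z where z: "z \<in> carrier ?D" "P z = e" using P_surj[OF e] by auto
        show ?thesis
          using fun_cong[OF eq, of z] z f_mem[OF f e] f_mem[OF g e] by (intro jointly_inj_eq) (auto simp: \<Phi>_def)
      qed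
      then show "f = g" using f g by (intro extensionalityI[of _ "carrier E\<^sub>R"]) (auto simp: Hom_module_def)
    qed
  next
    fix h assume hH: "h \<in> carrier ?H"
    then have h: "h \<in> module_hom R ?D ?M" and h_ext: "h \<in> extensional (carrier ?D)"
      by (auto simp: Hom_module_def)
    have h_P: "h z = h w" if z: "z \<in> carrier ?D" and w: "w \<in> carrier ?D" and eq: "P z = P w" for z w
    proof -
      have zw: "z \<ominus>\<^bsub>?D\<^esub> w \<in> carrier ?D" using z w by simp
      then obtain x y where xy: "z \<ominus>\<^bsub>?D\<^esub> w = (x, y)" "x \<in> carrier E\<^sub>S" "y \<in> carrier E\<^sub>T"
        by (auto simp: direct_sum_def restrict_scalars_def)
      have "P (z \<ominus>\<^bsub>?D\<^esub> w) = \<zero>\<^bsub>E\<^sub>R\<^esub>"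
        using module_hom_minus[OF D.module_axioms ER.module_axioms P z w] eq P_mem[OF w]
        by (simp add: ER.M.minus_eq_zero_iff)
      then have "h (z \<ominus>\<^bsub>?D\<^esub> w) = \<zero>\<^bsub>?M\<^esub>"
        using P_ker[OF xy(2,3)] kills_socles[OF h] xy(1) by (simp add: module_constr_simps)
      then have "h z \<ominus>\<^bsub>?M\<^esub> h w = \<zero>\<^bsub>?M\<^esub>"
        using module_hom_minus[OF D.module_axioms M_module h z w] by simp
      then show ?thesis
        using module_hom_mem[OF h z] module_hom_mem[OF h w] by (simp add: M.M.minus_eq_zero_iff)
    qed
    \<comment> \<open>A pair from the two maximal ideals comes from an element of \<open>R\<close>,
      unique by \<open>jointly_inj_eq\<close>; \<open>\<theta> z\<close> denotes the one belonging
      to \<open>h z\<close>.\<close>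
    have "\<exists>r\<in>carrier R. (\<phi> r, \<psi> r) = h z" if z: "z \<in> carrier ?D" for z
    proof -
      have "fst (h z) \<in> \<mm>\<^sub>S" "snd (h z) \<in> \<mm>\<^sub>T"
        using module_hom_mem[OF h z] by (auto simp: module_constr_simps)
      then show ?thesis using lift_max by (metis prod.collapse)
    qed
    then obtain \<theta> where l: "\<And>z. z \<in> carrier ?D \<Longrightarrow> \<theta> z \<in> carrier R"
      "\<And>z. z \<in> carrier ?D \<Longrightarrow> (\<phi> (\<theta> z), \<psi> (\<theta> z)) = h z" by metis
    have \<phi>_l: "\<phi> (\<theta> z) = fst (h z)" and \<psi>_l: "\<psi> (\<theta> z) = snd (h z)" if "z \<in> carrier ?D" for z
      using l(2)[OF that] by (metis fst_conv, metis snd_conv)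
    have M_ops: "fst (a \<oplus>\<^bsub>?M\<^esub> b) = fst a \<oplus>\<^bsub>S\<^esub> fst b" "snd (a \<oplus>\<^bsub>?M\<^esub> b) = snd a \<oplus>\<^bsub>T\<^esub> snd b"
      "fst (r \<odot>\<^bsub>?M\<^esub> a) = \<phi> r \<otimes>\<^bsub>S\<^esub> fst a" "snd (r \<odot>\<^bsub>?M\<^esub> a) = \<psi> r \<otimes>\<^bsub>T\<^esub> snd a" for a b r
      by (simp_all add: module_constr_simps)
    \<comment> \<open>\<open>\<zeta>\<close> is an arbitrary section of \<open>P\<close>; by
      \<open>h_P\<close> the resulting \<open>f\<close> satisfies
      \<open>f (P z) = \<theta> z\<close> for every \<open>z\<close>.\<close>
    obtain \<zeta> where \<zeta>: "\<And>e. e \<in> carrier E\<^sub>R \<Longrightarrow> \<zeta> e \<in> carrier ?D" "\<And>e. e \<in> carrier E\<^sub>R \<Longrightarrow> P (\<zeta> e) = e"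
      using P_surj by metis
    define f where "f = (\<lambda>e\<in>carrier E\<^sub>R. \<theta> (\<zeta> e))"
    have f: "f (P z) = \<theta> z" if z: "z \<in> carrier ?D" for z
    proof -
      have "h (\<zeta> (P z)) = h z" using \<zeta> P_mem[OF z] z by (intro h_P) auto
      then have "\<phi> (\<theta> (\<zeta> (P z))) = \<phi> (\<theta> z)" "\<psi> (\<theta> (\<zeta> (P z))) = \<psi> (\<theta> z)"
        using \<phi>_l[OF z] \<psi>_l[OF z] \<phi>_l[OF \<zeta>(1)[OF P_mem[OF z]]] \<psi>_l[OF \<zeta>(1)[OF P_mem[OF z]]] by simp_all
      then have "\<theta> (\<zeta> (P z)) = \<theta> z" using l(1) \<zeta>(1)[OF P_mem[OF z]] z by (intro jointly_inj_eq) auto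
      then show ?thesis using P_mem[OF z] by (simp add: f_def)
    qed
    have "f \<in> module_hom R E\<^sub>R (self_module R)"
    proof (rule module_homI)
      fix e assume e: "e \<in> carrier E\<^sub>R"
      obtain z where z: "z \<in> carrier ?D" "e = P z" using P_surj[OF e] by auto
      show "f e \<in> carrier (self_module R)" using z f l by (simp add: self_module_def)
      show "f (e \<oplus>\<^bsub>E\<^sub>R\<^esub> e') = f e \<oplus>\<^bsub>self_module R\<^esub> f e'" if e': "e' \<in> carrier E\<^sub>R" for e'
      proof -
        obtain w where w: "w \<in> carrier ?D" "e' = P w" using P_surj[OF e'] by auto
        have zw: "z \<oplus>\<^bsub>?D\<^esub> w \<in> carrier ?D" using z w by simp
        have "h (z \<oplus>\<^bsub>?D\<^esub> w) = h z \<oplus>\<^bsub>?M\<^esub> h w" by (rule module_hom_add[OF h z(1) w(1)])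
        then have "\<theta> (z \<oplus>\<^bsub>?D\<^esub> w) = \<theta> z \<oplus>\<^bsub>R\<^esub> \<theta> w"
          using l(1)[OF z(1)] l(1)[OF w(1)] l(1)[OF zw]
          by (intro jointly_inj_eq) (simp_all add: \<phi>_l[OF z(1)] \<phi>_l[OF w(1)] \<phi>_l[OF zw]
              \<psi>_l[OF z(1)] \<psi>_l[OF w(1)] \<psi>_l[OF zw] M_ops)
        then show ?thesis
          using f[OF zw] f[OF z(1)] f[OF w(1)] module_hom_add[OF P z(1) w(1)] z w by (simp add: self_module_def)
      qed
      fix r assume r: "r \<in> carrier R"
      have rz: "r \<odot>\<^bsub>?D\<^esub> z \<in> carrier ?D" using z r by simp
      have "h (r \<odot>\<^bsub>?D\<^esub> z) = r \<odot>\<^bsub>?M\<^esub> h z" by (rule module_hom_smult[OF h r z(1)])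
      then have "\<theta> (r \<odot>\<^bsub>?D\<^esub> z) = r \<otimes>\<^bsub>R\<^esub> \<theta> z"
        using l(1)[OF z(1)] l(1)[OF rz] r
        by (intro jointly_inj_eq)
          (simp_all add: \<phi>_l[OF z(1)] \<phi>_l[OF rz] \<psi>_l[OF z(1)] \<psi>_l[OF rz] M_ops)
      then show "f (r \<odot>\<^bsub>E\<^sub>R\<^esub> e) = r \<odot>\<^bsub>self_module R\<^esub> f e"
        using f[OF rz] f[OF z(1)] module_hom_smult[OF P r z(1)] z by (simp add: self_module_def)
    qed
    then have "f \<in> carrier ?dual" by (simp add: Hom_module_def f_def)
    moreover have "\<Phi> f = h"
      using h_ext f l(2) by (intro extensionalityI[of _ "carrier ?D"]) (auto simp: \<Phi>_def)
    ultimately show "\<exists>f\<in>carrier ?dual. \<Phi> f = h" by blast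
  qed
  then show ?thesis by (simp add: dual_module_def)
qed

text \<open>The diagonal blocks are the two duals by \<open>diag_Hom\<close>. Each of the two mixed
  blocks is a space of matrices of size \<open>type S\<close> by \<open>type T\<close> or its
  transpose, whence the factor 2.\<close>

lemma Hom_decomposition:
  "module_isomorphic R (Hom_module R (direct_sum ES_R ET_R) (direct_sum mS_R mT_R))
    (direct_sum (direct_sum (restrict_scalars \<phi> (Hom_module S E\<^sub>S (self_module S)))
                            (restrict_scalars \<psi> (Hom_module T E\<^sub>T (self_module T))))
                (residue_power K \<rho> (2 * ring_type S K \<pi>\<^sub>S * ring_type T K \<pi>\<^sub>T)))"
proof -
  interpret sw: local_pair_envelope T \<mm>\<^sub>T K \<pi>\<^sub>T E\<^sub>T \<iota>\<^sub>T S \<mm>\<^sub>S \<pi>\<^sub>S E\<^sub>S \<iota>\<^sub>S R \<psi> \<phi> \<rho> E\<^sub>R \<iota>\<^sub>R by (rule swap_envelope)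
  let ?n = "2 * ring_type S K \<pi>\<^sub>S * ring_type T K \<pi>\<^sub>T"
  obtain I :: "('es \<times> 'et) set" where I: "finite I" "card I = ring_type S K \<pi>\<^sub>S * ring_type T K \<pi>\<^sub>T"
    "module_isomorphic R (Hom_module R ES_R mT_R) (restrict_scalars \<rho> (ring.func_space K I))"
    by (rule cross_Hom)
  obtain J :: "('et \<times> 'es) set" where J: "finite J" "card J = ring_type T K \<pi>\<^sub>T * ring_type S K \<pi>\<^sub>S"
    "module_isomorphic R (Hom_module R ET_R mS_R) (restrict_scalars \<rho> (ring.func_space K J))"
    by (rule sw.cross_Hom)
  have "card (I <+> J) = ?n" using I J by (simp add: card_Plus mult.commute)
  then obtain b where b: "bij_betw b (I <+> J) {..<?n}"
    using I(1) J(1) bij_betw_iff_card[of "I <+> J" "{..<?n}"] by auto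
  have "module_isomorphic R (direct_sum (Hom_module R ES_R mT_R) (Hom_module R ET_R mS_R)) (residue_power K \<rho> ?n)"
    unfolding residue_power_def
    by (rule module_isomorphic_trans[OF module_isomorphic_direct_sum[OF I(3) J(3)]
          func_space_direct_sum[OF S.K.cring_axioms b]])
  from module_isomorphic_direct_sum[OF module_isomorphic_direct_sum[OF diag_Hom sw.diag_Hom] this]
  show ?thesis
    by (rule module_isomorphic_trans[OF Hom_module_direct_sum[OF modules]])
qed

text \<open>The zero set of \<open>\<rho>\<close> stands for \<open>\<mm>\<^sub>R\<close>: in the
  fiber product it is \<open>\<mm>\<^sub>S \<times> \<mm>\<^sub>T\<close>, and each \<open>s\<close>
  in \<open>\<mm>\<^sub>S\<close> is hit by \<open>(s, 0)\<close>.\<close>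

lemma image_max: "\<phi> ` {r \<in> carrier R. \<rho> r = \<zero>\<^bsub>K\<^esub>} = \<mm>\<^sub>S"
proof (intro equalityI subsetI)
  fix s assume "s \<in> \<mm>\<^sub>S"
  moreover then obtain r where "r \<in> carrier R" "\<phi> r = s" using lift_left by blast
  ultimately show "s \<in> \<phi> ` {r \<in> carrier R. \<rho> r = \<zero>\<^bsub>K\<^esub>}"
    by (intro image_eqI[of _ _ r]) (auto simp: S.mem_max rho_phi)
qed (auto simp: S.mem_max rho_phi)

text \<open>Isomorphisms preserve annihilation. The power of \<open>k\<close> is killed in any case,
  and on the other summands \<open>r\<close> acts through \<open>\<phi> r\<close> and
  \<open>\<psi> r\<close>, which run over \<open>\<mm>\<^sub>S\<close> and
  \<open>\<mm>\<^sub>T\<close>.\<close>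

lemma annihilates_dual:
  "annihilates {r \<in> carrier R. \<rho> r = \<zero>\<^bsub>K\<^esub>} (dual_module R E\<^sub>R) \<longleftrightarrow>
   annihilates \<mm>\<^sub>S (dual_module S E\<^sub>S) \<and> annihilates \<mm>\<^sub>T (dual_module T E\<^sub>T)"
proof -
  let ?I = "{r \<in> carrier R. \<rho> r = \<zero>\<^bsub>K\<^esub>}"
  let ?HS = "Hom_module S E\<^sub>S (self_module S)" and ?HT = "Hom_module T E\<^sub>T (self_module T)"
  let ?V = "residue_power K \<rho> (2 * ring_type S K \<pi>\<^sub>S * ring_type T K \<pi>\<^sub>T)"
  let ?N = "direct_sum (direct_sum (restrict_scalars \<phi> ?HS) (restrict_scalars \<psi> ?HT)) ?V"
  have HS: "module S ?HS" and HT: "module T ?HT"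
    by (rule Hom_module_is_module[OF S.E.module_axioms S.self_module],
        rule Hom_module_is_module[OF T.E.module_axioms T.self_module])
  interpret HS: module S ?HS by (rule HS)
  interpret HT: module T ?HT by (rule HT)
  have V: "module R ?V" unfolding residue_power_def
    by (rule restrict_scalars_is_module[OF cring_R rho_hom S.K.func_space_is_module])
  interpret V: module R ?V by (rule V)
  have N: "module R ?N"
    by (intro direct_sum_is_module V restrict_scalars_is_module[OF cring_R phi_hom HS]
        restrict_scalars_is_module[OF cring_R psi_hom HT])
  have dual: "module R (dual_module R E\<^sub>R)"
    unfolding dual_module_def by (rule Hom_module_is_module[OF ER.module_axioms self_module_R])
  have V0: "annihilates ?I ?V"
    unfolding annihilates_def
  proof (intro ballI)
    fix r v assume r: "r \<in> ?I" and v: "v \<in> carrier ?V"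
    have "v i \<in> carrier K" if "i < 2 * ring_type S K \<pi>\<^sub>S * ring_type T K \<pi>\<^sub>T" for i
      using v that by (auto simp: residue_power_def restrict_scalars_def S.K.func_space_def)
    then show "r \<odot>\<^bsub>?V\<^esub> v = \<zero>\<^bsub>?V\<^esub>"
      using r by (intro ext) (simp add: residue_power_def restrict_scalars_def S.K.func_space_def)
  qed
  have "annihilates ?I (dual_module R E\<^sub>R) \<longleftrightarrow> annihilates ?I ?N"
    by (rule annihilates_isomorphic[OF dual N module_isomorphic_trans[OF dual_isomorphic Hom_decomposition]]) auto
  also have "\<dots> \<longleftrightarrow> annihilates (\<phi> ` ?I) ?HS \<and> annihilates (\<psi> ` ?I) ?HT"
    using V0 HS.M.zero_closed HT.M.zero_closed V.M.zero_closed
    by (fastforce simp: annihilates_def direct_sum_def restrict_scalars_def)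
  also have "\<phi> ` ?I = \<mm>\<^sub>S" by (rule image_max)
  also have "\<psi> ` ?I = \<mm>\<^sub>T" by (rule local_pair_envelope.image_max[OF swap_envelope])
  finally show ?thesis by (simp add: dual_module_def)
qed

end

section \<open>The fiber product as an instance\<close>

lemma fiber_product_cring:
  assumes "artinian_local_ring S \<mm>\<^sub>S K \<pi>\<^sub>S" "artinian_local_ring T \<mm>\<^sub>T K \<pi>\<^sub>T"
  shows "cring (fiber_product S T \<pi>\<^sub>S \<pi>\<^sub>T)"
proof -
  have S: "cring S" "\<pi>\<^sub>S \<in> ring_hom S K" and T: "cring T" "\<pi>\<^sub>T \<in> ring_hom T K" and K: "field K"
    using assms by (auto simp: artinian_local_ring_def local_ring_def)
  interpret S: cring S by (rule S)
  interpret T: cring T by (rule T)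
  interpret K: field K by (rule K)
  interpret s: ring_hom_cring S K \<pi>\<^sub>S
    using S by (simp add: ring_hom_cring_def ring_hom_cring_axioms_def S.cring_axioms K.cring_axioms)
  interpret t: ring_hom_cring T K \<pi>\<^sub>T
    using T by (simp add: ring_hom_cring_def ring_hom_cring_axioms_def T.cring_axioms K.cring_axioms)
  let ?R = "fiber_product S T \<pi>\<^sub>S \<pi>\<^sub>T"
  note defs = fiber_product_def RDirProd_def DirProd_def monoid.defs
  show ?thesis
  proof (rule cringI)
    show "abelian_group ?R"
    proof (rule abelian_groupI)
      fix x assume x: "x \<in> carrier ?R"
      then show "\<exists>y\<in>carrier ?R. y \<oplus>\<^bsub>?R\<^esub> x = \<zero>\<^bsub>?R\<^esub>"
        by (intro bexI[of _ "(\<ominus>\<^bsub>S\<^esub> fst x, \<ominus>\<^bsub>T\<^esub> snd x)"]) (auto simp: defs S.l_neg T.l_neg)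
    qed (auto simp: defs S.a_ac T.a_ac)
    show "comm_monoid ?R"
      by (rule comm_monoidI) (auto simp: defs S.m_ac T.m_ac)
  qed (auto simp: defs S.l_distr T.l_distr)
qed

lemma injective_envelopeD:
  assumes "injective_envelope A (residue_module K \<pi>) E"
  shows "injective_module A E"
    and "\<exists>\<iota>\<in>module_hom A (residue_module K \<pi>) E. inj_on \<iota> (carrier K) \<and>
      (\<forall>H. submodule A H E \<and> H \<inter> \<iota> ` carrier K = {\<zero>\<^bsub>E\<^esub>} \<longrightarrow> H = {\<zero>\<^bsub>E\<^esub>})"
  using assms by (simp_all add: injective_envelope_def module_constr_simps)

theorem theorem4p19:
  fixes S :: "('s, 'x) ring_scheme" and T :: "('t, 'y) ring_scheme" and K :: "('k, 'z) ring_scheme"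
    and \<mm>\<^sub>S :: "'s set" and \<mm>\<^sub>T :: "'t set" and \<pi>\<^sub>S :: "'s \<Rightarrow> 'k" and \<pi>\<^sub>T :: "'t \<Rightarrow> 'k"
    and R :: "('s \<times> 't) ring"
    and E\<^sub>S :: "('s, 'es) module" and E\<^sub>T :: "('t, 'et) module" and E\<^sub>R :: "('s \<times> 't, 'er) module"
  assumes "artinian_local_ring S \<mm>\<^sub>S K \<pi>\<^sub>S"
    and "artinian_local_ring T \<mm>\<^sub>T K \<pi>\<^sub>T"
    and "R = fiber_product S T \<pi>\<^sub>S \<pi>\<^sub>T"
    and "injective_envelope S (residue_module K \<pi>\<^sub>S) E\<^sub>S"
    and "injective_envelope T (residue_module K \<pi>\<^sub>T) E\<^sub>T"
    and "injective_envelope R (residue_module K (\<pi>\<^sub>S \<circ> fst)) E\<^sub>R"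
    and "\<not> gorenstein S"
    and "\<not> gorenstein T"
  shows "module_isomorphic R
           (dual_module R E\<^sub>R)
           (Hom_module R
              (direct_sum (restrict_scalars fst E\<^sub>S) (restrict_scalars snd E\<^sub>T))
              (direct_sum (restrict_scalars fst (ideal_module S \<mm>\<^sub>S))
                          (restrict_scalars snd (ideal_module T \<mm>\<^sub>T)))) \<and>
         module_isomorphic R
           (Hom_module R
              (direct_sum (restrict_scalars fst E\<^sub>S) (restrict_scalars snd E\<^sub>T))
              (direct_sum (restrict_scalars fst (ideal_module S \<mm>\<^sub>S))
                          (restrict_scalars snd (ideal_module T \<mm>\<^sub>T))))
           (direct_sum
              (direct_sum (restrict_scalars fst (Hom_module S E\<^sub>S (self_module S)))
                          (restrict_scalars snd (Hom_module T E\<^sub>T (self_module T))))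
              (residue_power K (\<pi>\<^sub>S \<circ> fst) (2 * ring_type S K \<pi>\<^sub>S * ring_type T K \<pi>\<^sub>T))) \<and>
         (annihilates \<mm>\<^sub>S (dual_module S E\<^sub>S) \<and> annihilates \<mm>\<^sub>T (dual_module T E\<^sub>T) \<longleftrightarrow>
          annihilates (\<mm>\<^sub>S \<times> \<mm>\<^sub>T) (dual_module R E\<^sub>R))"
proof -
  obtain \<iota>\<^sub>S where S: "\<iota>\<^sub>S \<in> module_hom S (residue_module K \<pi>\<^sub>S) E\<^sub>S"
    "inj_on \<iota>\<^sub>S (carrier K)" "\<And>H. submodule S H E\<^sub>S \<Longrightarrow> H \<inter> \<iota>\<^sub>S ` carrier K = {\<zero>\<^bsub>E\<^sub>S\<^esub>} \<Longrightarrow> H = {\<zero>\<^bsub>E\<^sub>S\<^esub>}"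
    using injective_envelopeD(2)[OF assms(4)] by blast
  obtain \<iota>\<^sub>T where T: "\<iota>\<^sub>T \<in> module_hom T (residue_module K \<pi>\<^sub>T) E\<^sub>T"
    "inj_on \<iota>\<^sub>T (carrier K)" "\<And>H. submodule T H E\<^sub>T \<Longrightarrow> H \<inter> \<iota>\<^sub>T ` carrier K = {\<zero>\<^bsub>E\<^sub>T\<^esub>} \<Longrightarrow> H = {\<zero>\<^bsub>E\<^sub>T\<^esub>}"
    using injective_envelopeD(2)[OF assms(5)] by blast
  obtain \<iota>\<^sub>R where R: "\<iota>\<^sub>R \<in> module_hom R (residue_module K (\<pi>\<^sub>S \<circ> fst)) E\<^sub>R"
    "inj_on \<iota>\<^sub>R (carrier K)" "\<And>H. submodule R H E\<^sub>R \<Longrightarrow> H \<inter> \<iota>\<^sub>R ` carrier K = {\<zero>\<^bsub>E\<^sub>R\<^esub>} \<Longrightarrow> H = {\<zero>\<^bsub>E\<^sub>R\<^esub>}"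
    using injective_envelopeD(2)[OF assms(6)] by blast
  interpret S: nongorenstein_envelope S \<mm>\<^sub>S K \<pi>\<^sub>S E\<^sub>S \<iota>\<^sub>S
    by (intro nongorenstein_envelope.intro local_envelope.intro nongorenstein_envelope_axioms.intro assms(1,7)
      injective_envelopeD(1)[OF assms(4)] S(1,2)) (rule S(3))
  interpret T: nongorenstein_envelope T \<mm>\<^sub>T K \<pi>\<^sub>T E\<^sub>T \<iota>\<^sub>T
    by (intro nongorenstein_envelope.intro local_envelope.intro nongorenstein_envelope_axioms.intro assms(2,8)
      injective_envelopeD(1)[OF assms(5)] T(1,2)) (rule T(3))
  note defs = assms(3) fiber_product_def RDirProd_def DirProd_def monoid.defs
  \<comment> \<open>An element of one factor is completed to a pair by lifting its residue to the
    other factor.\<close>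
  have surj: "fst ` carrier R = carrier S" "snd ` carrier R = carrier T"
  proof (safe intro!: subset_antisym)
    show "s \<in> fst ` carrier R" if s: "s \<in> carrier S" for s
    proof -
      obtain t where "t \<in> carrier T" "\<pi>\<^sub>T t = \<pi>\<^sub>S s" using T.lift_exists[OF S.pi_closed[OF s]] by auto
      then show ?thesis using s by (intro image_eqI[of _ _ "(s, t)"]) (auto simp: defs)
    qed
    show "t \<in> snd ` carrier R" if t: "t \<in> carrier T" for t
    proof -
      obtain s where "s \<in> carrier S" "\<pi>\<^sub>S s = \<pi>\<^sub>T t" using S.lift_exists[OF T.pi_closed[OF t]] by auto
      then show ?thesis using t by (intro image_eqI[of _ _ "(s, t)"]) (auto simp: defs)
    qed
  qed (auto simp: defs)
  \<comment> \<open>The lift demanded for \<open>s\<close> and \<open>t\<close> in the maximal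
    ideals is the pair \<open>(s, t)\<close>, which belongs to \<open>R\<close> since both residues
    are 0. The two formulas for the residue map agree by the definition of the fiber
    product.\<close>
  interpret local_pair_envelope S \<mm>\<^sub>S K \<pi>\<^sub>S E\<^sub>S \<iota>\<^sub>S T \<mm>\<^sub>T \<pi>\<^sub>T E\<^sub>T \<iota>\<^sub>T R fst snd "\<pi>\<^sub>S \<circ> fst" E\<^sub>R \<iota>\<^sub>R
  proof (intro local_pair_envelope.intro local_pair.intro local_pair_axioms.intro local_pair_envelope_axioms.intro
      S.nongorenstein_envelope_axioms T.nongorenstein_envelope_axioms injective_envelopeD(1)[OF assms(6)] R(1,2) surj)
    show "cring R" unfolding assms(3) by (rule fiber_product_cring[OF assms(1,2)])
    show "fst \<in> ring_hom R S" "snd \<in> ring_hom R T" by (auto intro!: ring_hom_memI simp: defs)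
    show "\<exists>r\<in>carrier R. fst r = s \<and> snd r = t" if "s \<in> \<mm>\<^sub>S" "t \<in> \<mm>\<^sub>T" for s t
      using that by (intro bexI[of _ "(s, t)"]) (auto simp: defs S.mem_max T.mem_max)
    show "H = {\<zero>\<^bsub>E\<^sub>R\<^esub>}" if "submodule R H E\<^sub>R" "H \<inter> \<iota>\<^sub>R ` carrier K = {\<zero>\<^bsub>E\<^sub>R\<^esub>}" for H
      using that by (rule R(3))
  qed (auto simp: defs)
  have "{r \<in> carrier R. (\<pi>\<^sub>S \<circ> fst) r = \<zero>\<^bsub>K\<^esub>} = \<mm>\<^sub>S \<times> \<mm>\<^sub>T"
    by (auto simp: defs S.mem_max T.mem_max)
  then show ?thesis using dual_isomorphic Hom_decomposition annihilates_dual by simp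
qed

end
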